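(* Let the volumetric term of the energy be described by the polytropic gas equation of state $$e_{\mathrm s}(\rho,\eta)=c_{\mathrm V}\,\theta_{\mathrm{ref}}\Big(\frac{\rho}{\rho_{\mathrm{ref}}}\Big)^{\gamma-1}\exp\Big(\frac{\eta}{c_{\mathrm V}}\Big),$$ where $\gamma>1$ and $c_{\mathrm V},\theta_{\mathrm{ref}},\rho_{\mathrm{ref}}>0$ are constants. Then the scalar quantity $\rho\widetilde E$, where $$\widetilde E:=\tfrac12|\mathbf v|^2+\widetilde{e_{\mathrm s}}(\rho,\eta,\mathbf F,\mathbf Y,y)+\tfrac{\tau_0}{2\kappa}|\mathbf j|^2+\tfrac{\alpha}{2}K_0\operatorname{tr}\big(\mathbf F\mathbf Y^{-1/2}\mathbf F^{\top}\big)+\tfrac{e_{\mathrm{ref}}}{2}|\mathbf Y|^2,$$ $$\widetilde{e_{\mathrm s}}(\rho,\eta,\mathbf F,\mathbf Y,y):=e_{\mathrm s}\Big(\rho,\ \eta+\tfrac{\alpha}{2}\Big(K_1\operatorname{tr}\big(\mathbf F\mathbf Y^{-1/2}\mathbf F^{\top}\big)-k_{\mathrm B}\log\Big(\big(\tfrac{\rho_{\mathrm R}}{\rho}\big)^2y^{1/2}\Big)\Big)\Big),$$ is a mathematical entropy of the system of balance laws (S) given in the context, for the unknown $\mathbf u=(\rho,\rho\eta,\rho\mathbf j,\rho\mathbf v,\rho\mathbf F,\rho\mathbf Y,\rho y)$.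
   Context: Unknown fields on $\mathbb R^3\times[0,\infty)$: density $\rho>0$, specific entropy $\eta\in\mathbb R$, energy flux $\mathbf j\in\mathbb R^3$, velocity $\mathbf v\in\mathbb R^3$, deformation gradient $\mathbf F\in\mathbb R^{3\times3}$ (invertible), symmetric positive-definite $\mathbf Y\in\mathbb R^{3\times3}$, scalar $y>0$ (standing for $\det\mathbf Y^{-1}$ but treated as an independent variable). The numbers $\alpha,K_0,K_1,k_{\mathrm B},\tau_0,\kappa,\rho_{\mathrm R},e_{\mathrm{ref}}$ are positive constants; $\zeta>0$ is a drag coefficient, possibly a smooth function of the temperature; $\mathbf f$ is the specific body force, entering as part of source terms regarded as smooth functions of $\mathbf u$. $|\cdot|$ is the Euclidean or Frobenius norm, $\mathbf I$ the identity. Derived quantities, as functions of the unknowns: $\mathbf C:=\mathbf F\mathbf Y^{-1/2}\mathbf F^\top$; $\hat\eta:=\eta+\frac{\alpha}{2}\big(K_1\operatorname{tr}\mathbf C-k_{\mathrm B}\log((\rho_{\mathrm R}/\rho)^2y^{1/2})\big)$; temperature $\theta:=\frac{\partial e_{\mathrm s}}{\partial\eta}(\rho,\hat\eta)$; pressure $p:=\rho^2\frac{\partial e_{\mathrm s}}{\partial\rho}(\rho,\hat\eta)$; $K(\theta):=K_0+K_1\theta$; Cauchy stress $\mathbf T:=-p\,\mathbf I+\alpha\rho\,(K(\theta)\mathbf C-k_{\mathrm B}\theta\,\mathbf I)$; entropy production $\xi:=\frac{|\mathbf j|^2}{\kappa\theta^2}+\frac{2\alpha\rho}{\zeta\theta}\big|K(\theta)\mathbf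 C^{1/2}-k_{\mathrm B}\theta\,\mathbf C^{-1/2}\big|^2$; with $\mathbf G:=\mathbf F^{-1}\mathbf F^{-\top}$, $$\mathfrak f:=\frac{8K(\theta)}{\zeta}\mathbf Y-\frac{4k_{\mathrm B}\theta}{\zeta}\mathbf Y\big(\mathbf G\mathbf Y^{-1/2}+\mathbf Y^{-1/2}\mathbf G\big)\mathbf Y,$$ $$h:=\frac{4}{\zeta}\,y\,\operatorname{tr}\Big(k_{\mathrm B}\theta\big(\mathbf G\mathbf Y^{-1/2}+\mathbf Y^{-1/2}\mathbf G\big)\mathbf Y-2K(\theta)\mathbf I\Big).$$ System (S) (divergence taken with respect to the last index): $$\partial_t\rho+\operatorname{div}(\rho\mathbf v)=0,\qquad \partial_t(\rho\eta)+\operatorname{div}\big(\rho\eta\mathbf v+\mathbf j/\theta\big)=\xi,$$ $$\partial_t(\rho\mathbf j)+\operatorname{div}\Big(\rho\,\mathbf j\otimes\mathbf v+\frac{\kappa\log\theta}{\tau_0}\mathbf I\Big)=-\frac{\mathbf j}{\tau_0\theta},\qquad \partial_t(\rho\mathbf v)+\operatorname{div}(\rho\,\mathbf v\otimes\mathbf v-\mathbf T)=\rho\mathbf f,$$ $$\partial_t(\rho F^i_\alpha)+\sum_k\partial_{x^k}\big(\rho(F^i_\alpha v^k-v^iF^k_\alpha)\big)=0,\qquad \partial_t(\rho\mathbf Y)+\operatorname{div}(\rho\,\mathbf Y\otimes\mathbf v)=\rho\,\mathfrak f,\qquad \partial_t(\rho y)+\operatorname{div}(\rho y\mathbf v)=\rho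 h.$$ Standing assumptions under which the conservation law for $\rho\mathbf F$ is written: the material is homogeneous, $\rho\det\mathbf F=\rho_{\mathrm R}$ is constant, and the Piola identity $\operatorname{div}(\mathbf F^\top/\det\mathbf F)=0$ (i.e. $\sum_i\partial_{x^i}(F^i_\alpha/\det\mathbf F)=0$ for each $\alpha$) holds. A scalar function $s(\mathbf u)$ is a mathematical entropy of a system of balance laws $\partial_t\mathbf u+\sum_j\partial_{x^j}\mathbf f^j(\mathbf u)=\mathbf c(\mathbf u)$ if $s$ is smooth and strictly convex in $\mathbf u$ and if the system implies (for smooth solutions) an additional balance law $\partial_ts(\mathbf u)+\sum_j\partial_{x^j}F^j(\mathbf u)=b(\mathbf u)$ with smooth functions $F^j,b$. *)

theory Defs
  imports "HOL-Analysis.Analysis"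
begin

primrec Ck_on :: "nat \<Rightarrow> 'a::euclidean_space set \<Rightarrow> ('a \<Rightarrow> 'b::real_normed_vector) \<Rightarrow> bool" where
  "Ck_on 0 U f = continuous_on U f"
| "Ck_on (Suc k) U f = ((\<forall>x\<in>U. f differentiable (at x)) \<and>
     (\<forall>v. Ck_on k U (\<lambda>x. frechet_derivative f (at x) v)))"

text \<open>The set need not be open: smooth means locally the restriction of a function that is
  \<open>C\<^sup>\<infinity>\<close> on an open set of the ambient space. This is needed for states with a symmetric matrix
  component (an open subset of a proper subspace) and for fields up to and including time \<open>0\<close>;
  in both cases it agrees with the usual notion.\<close>

definition smooth_on :: "'a::euclidean_space set \<Rightarrow> ('a \<Rightarrow> 'b::real_normed_vector) \<Rightarrow> bool" where
  "smooth_on S f \<longleftrightarrow> (\<forall>x\<in>S. \<exists>U g. open U \<and> x \<in> U \<and> (\<forall>k. Ck_on k U g) \<and> (\<forall>z\<in>S \<inter> U. g z = f z))"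

definition strictly_convex_on :: "'a::real_vector set \<Rightarrow> ('a \<Rightarrow> real) \<Rightarrow> bool" where
  "strictly_convex_on S f \<longleftrightarrow> convex S \<and>
     (\<forall>x\<in>S. \<forall>y\<in>S. \<forall>t. x \<noteq> y \<and> 0 < t \<and> t < 1 \<longrightarrow>
        f ((1 - t) *\<^sub>R x + t *\<^sub>R y) < (1 - t) * f x + t * f y)"

text \<open>Fields are functions of \<open>(x, t)\<close> with \<open>t \<ge> 0\<close>; at \<open>t = 0\<close> the time derivative is one-sided.\<close>

definition time_deriv :: "((real^3) \<times> real \<Rightarrow> 'b::real_normed_vector) \<Rightarrow> (real^3) \<times> real \<Rightarrow> 'b" where
  "time_deriv w z = vector_derivative (\<lambda>s. w (fst z, s)) (at (snd z) within {0..})"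

definition space_deriv :: "3 \<Rightarrow> ((real^3) \<times> real \<Rightarrow> 'b::real_normed_vector) \<Rightarrow> (real^3) \<times> real \<Rightarrow> 'b" where
  "space_deriv k w z = vector_derivative (\<lambda>h. w (fst z + h *\<^sub>R axis k 1, snd z)) (at 0)"

definition balance_law_on ::
    "((real^3) \<times> real) set \<Rightarrow> ('u \<Rightarrow> 'b::real_normed_vector) \<Rightarrow> (3 \<Rightarrow> 'u \<Rightarrow> 'b) \<Rightarrow> ('u \<Rightarrow> 'b) \<Rightarrow>
     ((real^3) \<times> real \<Rightarrow> 'u) \<Rightarrow> bool" where
  "balance_law_on \<Omega> q \<Phi> c u \<longleftrightarrow>
     (\<forall>z\<in>\<Omega>. time_deriv (\<lambda>z. q (u z)) z + (\<Sum>k\<in>UNIV. space_deriv k (\<lambda>z. \<Phi> k (u z)) z) = c (u z))"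

definition smooth_solution ::
    "'u::euclidean_space set \<Rightarrow> (3 \<Rightarrow> 'u \<Rightarrow> 'u) \<Rightarrow> ('u \<Rightarrow> 'u) \<Rightarrow>
     ((real^3) \<times> real) set \<Rightarrow> ((real^3) \<times> real \<Rightarrow> 'u) \<Rightarrow> bool" where
  "smooth_solution D \<Phi> c \<Omega> u \<longleftrightarrow>
     openin (top_of_set (UNIV \<times> {0..})) \<Omega> \<and> smooth_on \<Omega> u \<and> u ` \<Omega> \<subseteq> D \<and>
     balance_law_on \<Omega> (\<lambda>w. w) \<Phi> c u"

text \<open>\<open>D\<close> is the set of admissible states and \<open>P\<close> collects side conditions imposed on the solutions
  (differential constraints under which the system is posed). Since \<open>D\<close> may fail to be convex,
  strict convexity is required on its convex hull; the entropy must therefore be given by an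
  expression that is meaningful there. Solutions on every relatively open part of
  \<open>\<real>\<^sup>3 \<times> [0, \<infinity>)\<close> are considered, including solutions on all of it.\<close>

definition mathematical_entropy ::
    "'u::euclidean_space set \<Rightarrow> (3 \<Rightarrow> 'u \<Rightarrow> 'u) \<Rightarrow> ('u \<Rightarrow> 'u) \<Rightarrow>
     (((real^3) \<times> real) set \<Rightarrow> ((real^3) \<times> real \<Rightarrow> 'u) \<Rightarrow> bool) \<Rightarrow> ('u \<Rightarrow> real) \<Rightarrow> bool" where
  "mathematical_entropy D \<Phi> c P s \<longleftrightarrow>
     smooth_on D s \<and> strictly_convex_on (convex hull D) s \<and>
     (\<exists>(\<Psi> :: 3 \<Rightarrow> 'u \<Rightarrow> real) (b :: 'u \<Rightarrow> real).
        (\<forall>k. smooth_on D (\<Psi> k)) \<and> smooth_on D b \<and>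
        (\<forall>\<Omega> u. smooth_solution D \<Phi> c \<Omega> u \<and> P \<Omega> u \<longrightarrow> balance_law_on \<Omega> s \<Psi> b u))"

definition spd :: "real^'n^'n \<Rightarrow> bool" where
  "spd A \<longleftrightarrow> transpose A = A \<and> (\<forall>x. x \<noteq> 0 \<longrightarrow> 0 < x \<bullet> (A *v x))"

text \<open>The principal square root, meaningful for positive definite arguments.\<close>

definition mat_sqrt :: "real^'n^'n \<Rightarrow> real^'n^'n" where
  "mat_sqrt A = (THE B. spd B \<and> B ** B = A)"

definition mat_inv_sqrt :: "real^'n^'n \<Rightarrow> real^'n^'n" where
  "mat_inv_sqrt A = matrix_inv (mat_sqrt A)"

text \<open>Material data. The drag coefficient \<open>zeta\<close> is a function of temperature; \<open>es\<close> is the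
  volumetric energy as a function of density and entropy.\<close>

record material =
  alpha :: real
  K0 :: real
  K1 :: real
  kB :: real
  tau0 :: real
  kappa :: real
  rhoR :: real
  eref :: real
  zeta :: "real \<Rightarrow> real"
  es :: "real \<Rightarrow> real \<Rightarrow> real"

definition polytropic :: "real \<Rightarrow> real \<Rightarrow> real \<Rightarrow> real \<Rightarrow> real \<Rightarrow> real \<Rightarrow> real" where
  "polytropic cV \<theta>ref \<rho>ref \<gamma> \<rho> \<eta> = cV * \<theta>ref * (\<rho> / \<rho>ref) powr (\<gamma> - 1) * exp (\<eta> / cV)"

text \<open>A state holds the conserved variables
  \<open>(\<rho>, \<rho> \<eta>, \<rho> j, \<rho> v, \<rho> F, \<rho> Y, \<rho> y)\<close>; the primitive fields are recovered by dividing by \<open>\<rho>\<close>.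
  The entry \<open>F $ i $ a\<close> has spatial index \<open>i\<close> and referential index \<open>a\<close>.\<close>

type_synonym state = "real \<times> real \<times> (real^3) \<times> (real^3) \<times> (real^3^3) \<times> (real^3^3) \<times> real"

fun \<rho>_of :: "state \<Rightarrow> real" where "\<rho>_of (r, e, J, V, FF, YY, w) = r"
fun \<eta>_of :: "state \<Rightarrow> real" where "\<eta>_of (r, e, J, V, FF, YY, w) = e / r"
fun j_of :: "state \<Rightarrow> real^3" where "j_of (r, e, J, V, FF, YY, w) = J /\<^sub>R r"
fun v_of :: "state \<Rightarrow> real^3" where "v_of (r, e, J, V, FF, YY, w) = V /\<^sub>R r"
fun F_of :: "state \<Rightarrow> real^3^3" where "F_of (r, e, J, V, FF, YY, w) = FF /\<^sub>R r"
fun Y_of :: "state \<Rightarrow> real^3^3" where "Y_of (r, e, J, V, FF, YY, w) = YY /\<^sub>R r"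
fun y_of :: "state \<Rightarrow> real" where "y_of (r, e, J, V, FF, YY, w) = w / r"

definition admissible_states :: "state set" where
  "admissible_states = {u. 0 < \<rho>_of u \<and> invertible (F_of u) \<and> spd (Y_of u) \<and> 0 < y_of u}"

definition C_of :: "state \<Rightarrow> real^3^3" where
  "C_of u = F_of u ** mat_inv_sqrt (Y_of u) ** transpose (F_of u)"

definition \<eta>hat :: "material \<Rightarrow> state \<Rightarrow> real" where
  "\<eta>hat m u = \<eta>_of u + alpha m / 2 *
     (K1 m * trace (C_of u) - kB m * ln ((rhoR m / \<rho>_of u)\<^sup>2 * sqrt (y_of u)))"

definition temp :: "material \<Rightarrow> state \<Rightarrow> real" where
  "temp m u = deriv (\<lambda>h. es m (\<rho>_of u) h) (\<eta>hat m u)"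

text \<open>The density derivative is taken at fixed second argument of \<open>es\<close>, although \<open>\<eta>hat\<close> depends
  on the density too.\<close>

definition pressure :: "material \<Rightarrow> state \<Rightarrow> real" where
  "pressure m u = (\<rho>_of u)\<^sup>2 * deriv (\<lambda>r. es m r (\<eta>hat m u)) (\<rho>_of u)"

definition Ktemp :: "material \<Rightarrow> state \<Rightarrow> real" where
  "Ktemp m u = K0 m + K1 m * temp m u"

definition drag :: "material \<Rightarrow> state \<Rightarrow> real" where
  "drag m u = zeta m (temp m u)"

definition stress :: "material \<Rightarrow> state \<Rightarrow> real^3^3" where
  "stress m u = - (pressure m u *\<^sub>R mat 1) +
     (alpha m * \<rho>_of u) *\<^sub>R (Ktemp m u *\<^sub>R C_of u - (kB m * temp m u) *\<^sub>R mat 1)"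

text \<open>\<open>norm\<close> on \<open>real^3^3\<close> is the Frobenius norm.\<close>

definition entropy_production :: "material \<Rightarrow> state \<Rightarrow> real" where
  "entropy_production m u =
     (norm (j_of u))\<^sup>2 / (kappa m * (temp m u)\<^sup>2) +
     2 * alpha m * \<rho>_of u / (drag m u * temp m u) *
       (norm (Ktemp m u *\<^sub>R mat_sqrt (C_of u) - (kB m * temp m u) *\<^sub>R mat_inv_sqrt (C_of u)))\<^sup>2"

definition G_of :: "state \<Rightarrow> real^3^3" where
  "G_of u = matrix_inv (F_of u) ** transpose (matrix_inv (F_of u))"

definition Y_rate :: "material \<Rightarrow> state \<Rightarrow> real^3^3" where
  "Y_rate m u =
     (let Y = Y_of u; W = mat_inv_sqrt Y; G = G_of u in
      (8 * Ktemp m u / drag m u) *\<^sub>R Y -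
      (4 * kB m * temp m u / drag m u) *\<^sub>R (Y ** (G ** W + W ** G) ** Y))"

definition y_rate :: "material \<Rightarrow> state \<Rightarrow> real" where
  "y_rate m u =
     (let Y = Y_of u; W = mat_inv_sqrt Y; G = G_of u in
      4 / drag m u * y_of u *
        trace ((kB m * temp m u) *\<^sub>R ((G ** W + W ** G) ** Y) - (2 * Ktemp m u) *\<^sub>R mat 1))"

definition flux :: "material \<Rightarrow> 3 \<Rightarrow> state \<Rightarrow> state" where
  "flux m k u =
     (let \<rho> = \<rho>_of u; \<eta> = \<eta>_of u; j = j_of u; v = v_of u; F = F_of u; Y = Y_of u; y = y_of u;
          \<theta> = temp m u; T = stress m u in
      (\<rho> * v $ k,
       \<rho> * \<eta> * v $ k + j $ k / \<theta>,
       (\<chi> i. \<rho> * j $ i * v $ k + (kappa m * ln \<theta> / tau0 m) * (mat 1 :: real^3^3) $ i $ k),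
       (\<chi> i. \<rho> * v $ i * v $ k - T $ i $ k),
       (\<chi> i a. \<rho> * (F $ i $ a * v $ k - v $ i * F $ k $ a)),
       (\<rho> * v $ k) *\<^sub>R Y,
       \<rho> * y * v $ k))"

definition source :: "material \<Rightarrow> (state \<Rightarrow> real^3) \<Rightarrow> state \<Rightarrow> state" where
  "source m f u =
     (0,
      entropy_production m u,
      - ((1 / (tau0 m * temp m u)) *\<^sub>R j_of u),
      \<rho>_of u *\<^sub>R f u,
      0,
      \<rho>_of u *\<^sub>R Y_rate m u,
      \<rho>_of u * y_rate m u)"

text \<open>The conservation law for \<open>\<rho> F\<close> is posed for a homogeneous material, under the Piola
  identity.\<close>

definition kinematic_constraints ::
    "material \<Rightarrow> ((real^3) \<times> real) set \<Rightarrow> ((real^3) \<times> real \<Rightarrow> state) \<Rightarrow> bool" where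
  "kinematic_constraints m \<Omega> u \<longleftrightarrow>
     (\<forall>z\<in>\<Omega>. \<rho>_of (u z) * det (F_of (u z)) = rhoR m) \<and>
     (\<forall>z\<in>\<Omega>. \<forall>a. (\<Sum>i\<in>UNIV. space_deriv i (\<lambda>z. F_of (u z) $ i $ a / det (F_of (u z))) z) = 0)"

definition es_tilde :: "material \<Rightarrow> state \<Rightarrow> real" where
  "es_tilde m u = es m (\<rho>_of u)
     (\<eta>_of u + alpha m / 2 *
       (K1 m * trace (F_of u ** mat_inv_sqrt (Y_of u) ** transpose (F_of u))
        - kB m * ln ((rhoR m / \<rho>_of u)\<^sup>2 * sqrt (y_of u))))"

text \<open>No invertibility of \<open>F\<close> is needed here, so the energy is also defined on the convex hull of
  \<open>admissible_states\<close>, where \<open>F\<close> may be singular.\<close>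

definition E_tilde :: "material \<Rightarrow> state \<Rightarrow> real" where
  "E_tilde m u =
     (norm (v_of u))\<^sup>2 / 2 + es_tilde m u + tau0 m / (2 * kappa m) * (norm (j_of u))\<^sup>2 +
     alpha m / 2 * K0 m * trace (F_of u ** mat_inv_sqrt (Y_of u) ** transpose (F_of u)) +
     eref m / 2 * (norm (Y_of u))\<^sup>2"

end

theory Submission
  imports Defs
begin

text \<open>
  The total energy \<open>\<rho> E\<close> has to be strictly convex in the conserved variables and has to satisfy
  a balance law along smooth solutions.

  Convexity. In conserved variables, \<open>\<rho> E\<close> is the perspective of the specific energy \<open>E\<close> as a
  function of \<open>1 / \<rho>\<close> and the primitive fields \<open>\<eta>, j, v, F, Y, y\<close>: on a segment of states these
  quantities also move on a segment, with reweighted coefficients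
  (\<open>primitive_convex_combination\<close>). It therefore suffices that \<open>E\<close> is strictly convex in them.
  The quadratic terms take care of \<open>v\<close>, \<open>j\<close> and \<open>Y\<close>. For the polytropic law the volumetric term
  is the exponential of an expression that is affine in \<open>\<eta>\<close>, contains \<open>- ln (1 / \<rho>)\<close> and
  \<open>- ln y\<close> with positive factors, and is increasing in \<open>tr C = tr (F Y\<^sup>-\<^sup>1\<^sup>/\<^sup>2 F\<^sup>\<top>)\<close>. This trace
  is jointly convex in \<open>(F, Y)\<close> (\<open>conformation_trace_convex\<close>), because the matrix square root is
  operator concave and \<open>(f, S) \<mapsto> f \<bullet> S\<^sup>-\<^sup>1 f\<close> is convex and decreasing in \<open>S\<close>; at fixed \<open>Y\<close> it
  is strictly convex in \<open>F\<close>.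

  Balance law. Let \<open>D\<close> be the derivative of \<open>\<rho> E\<close> at the state \<open>u\<close>, and let the system be
  \<open>\<partial>\<^sub>t u + \<Sum>\<^sub>k \<partial>\<^sub>k \<Phi>\<^sub>k(u) = c(u)\<close>. The chain rule gives
  \<open>\<partial>\<^sub>t (\<rho> E) + D [\<Sum>\<^sub>k \<partial>\<^sub>k \<Phi>\<^sub>k(u)] = D [c(u)]\<close>, and the right-hand side is a smooth function of
  \<open>u\<close> that serves as the source. What remains is that \<open>D [\<Sum>\<^sub>k \<partial>\<^sub>k \<Phi>\<^sub>k(u)]\<close> is the divergence of
  \<open>\<rho> E v + j - T\<^sup>\<top> v\<close> (\<open>energy_gradient_flux_divergence\<close>). The flux is \<open>\<Phi>\<^sub>k = v\<^sub>k u + X\<^sub>k\<close>,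
  where \<open>X\<^sub>k\<close> has no \<open>\<rho>\<close>, \<open>Y\<close> and \<open>y\<close> components. Hence the dependence of the energy on \<open>Y\<close>
  through \<open>Y\<^sup>-\<^sup>1\<^sup>/\<^sup>2\<close> is never differentiated explicitly; only \<open>D [u]\<close>
  (\<open>energy_gradient_scaling\<close>) and the partial derivatives with respect to \<open>\<rho> \<eta>\<close>, \<open>\<rho> j\<close>, \<open>\<rho> v\<close>
  and \<open>\<rho> F\<close> (\<open>energy_gradient_partial\<close>) enter. The Piola identity removes the derivatives of
  \<open>\<rho> F\<close>.

  Smoothness. The delicate ingredient is the square root of positive definite matrices, which
  form an open subset of the symmetric ones only. It is extended to an open set of matrices by
  taking the symmetric part first. Its derivative \<open>X\<close> in direction \<open>V\<close> solves the Sylvester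
  equation \<open>S X + X S = V\<close>, where \<open>S\<close> is the root and \<open>V\<close> is symmetric; by Cramer's rule the
  solution depends smoothly on \<open>S\<close>, so the regularity of the root improves by one order at a
  time (\<open>smooth_on_mat_sqrt_sym_part\<close>).
\<close>

section \<open>Calculus of smooth functions on arbitrary sets\<close>

lemma Ck_on_subset: "V \<subseteq> U \<Longrightarrow> Ck_on k U f \<Longrightarrow> Ck_on k V f"
  by (induction k arbitrary: f) (auto intro: continuous_on_subset)

lemma Ck_on_SucD: "Ck_on (Suc k) U f \<Longrightarrow> Ck_on k U f"
proof (induction k arbitrary: f)
  case 0
  then show ?case
    by (auto intro!: continuous_at_imp_continuous_on differentiable_imp_continuous_within)
next
  case (Suc k)
  then show ?case by (metis Ck_on.simps(2))
qed

lemma Ck_on_cong: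
  assumes "open U" "\<And>x. x \<in> U \<Longrightarrow> f x = g x" "Ck_on k U f"
  shows "Ck_on k U g"
  using assms(2,3)
proof (induction k arbitrary: f g)
  case 0
  then show ?case by (metis Ck_on.simps(1) continuous_on_cong)
next
  case (Suc k)
  have d: "(g has_derivative frechet_derivative f (at x)) (at x)" if "x \<in> U" for x
  proof -
    have "(f has_derivative frechet_derivative f (at x)) (at x)"
      using Suc.prems that by (auto simp: frechet_derivative_works[symmetric])
    then show ?thesis
      using has_derivative_transform_within_open[OF _ \<open>open U\<close> that] Suc.prems(1) by metis
  qed
  have e: "frechet_derivative g (at x) = frechet_derivative f (at x)" if "x \<in> U" for x
    using d[OF that] by (metis frechet_derivative_at)
  have "Ck_on k U (\<lambda>x. frechet_derivative g (at x) v)" for v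
    using Suc.IH[of "\<lambda>x. frechet_derivative f (at x) v"
        "\<lambda>x. frechet_derivative g (at x) v"] e Suc.prems(2)
    by (metis (mono_tags, lifting) Ck_on.simps(2))
  then show ?case using d by (auto simp: differentiable_def)
qed

text \<open>
  \<open>Ck_on\<close> refers to the derivative selected by \<open>frechet_derivative\<close>; uniqueness of derivatives
  on an open set allows any explicitly given family of derivatives instead.
\<close>

lemma Ck_on_SucI:
  assumes "open U" "\<And>x. x \<in> U \<Longrightarrow> (f has_derivative f' x) (at x)"
    and "\<And>v. Ck_on k U (\<lambda>x. f' x v)"
  shows "Ck_on (Suc k) U f"
proof -
  have "f' x = frechet_derivative f (at x)" if "x \<in> U" for x
    by (rule frechet_derivative_at[OF assms(2)[OF that]])
  then have "Ck_on k U (\<lambda>x. frechet_derivative f (at x) v)" for v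
    by (intro Ck_on_cong[OF assms(1) _ assms(3)[of v]]) simp
  then show ?thesis using assms(2) by (auto simp: differentiable_def)
qed

lemma Ck_on_has_derivative:
  assumes "Ck_on (Suc k) U f" "x \<in> U"
  shows "(f has_derivative frechet_derivative f (at x)) (at x)"
  using assms by (auto simp: frechet_derivative_works[symmetric])

lemma Ck_on_zero: "open U \<Longrightarrow> Ck_on k U (\<lambda>x. 0)"
  by (induction k) auto

lemma Ck_on_const: "open U \<Longrightarrow> Ck_on k U (\<lambda>x. c)"
  by (cases k) (auto simp: Ck_on_zero)

lemma Ck_on_add:
  assumes "open U"
  shows "Ck_on k U f \<Longrightarrow> Ck_on k U g \<Longrightarrow> Ck_on k U (\<lambda>x. f x + g x)"
proof (induction k arbitrary: f g)
  case 0
  then show ?case by (simp add: continuous_on_add)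
next
  case (Suc k)
  show ?case
  proof (rule Ck_on_SucI[OF assms])
    show "((\<lambda>x. f x + g x) has_derivative
        (\<lambda>v. frechet_derivative f (at x) v + frechet_derivative g (at x) v)) (at x)" if "x \<in>
            U" for x
      using Suc.prems that by (intro has_derivative_add Ck_on_has_derivative)
    show "Ck_on k U (\<lambda>x. frechet_derivative f (at x) v + frechet_derivative g (at x) v)" for v
      using Suc.prems by (intro Suc.IH) simp_all
  qed
qed

lemma Ck_on_sum:
  assumes "open U" "\<And>i. i \<in> I \<Longrightarrow> Ck_on k U (f i)"
  shows "Ck_on k U (\<lambda>x. \<Sum>i\<in>I. f i x)"
  using assms(2)
proof (induction I rule: infinite_finite_induct)
  case (insert i I)
  then have "Ck_on k U (\<lambda>x. f i x + (\<Sum>i\<in>I. f i x))" by (intro Ck_on_add[OF assms(1)]) simp_all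
  then show ?case using insert by simp
qed (simp_all add: Ck_on_zero assms(1))

lemma Ck_on_bounded_linear:
  assumes "open U" "bounded_linear L"
  shows "Ck_on k U f \<Longrightarrow> Ck_on k U (\<lambda>x. L (f x))"
proof (induction k arbitrary: f)
  case 0
  then show ?case using bounded_linear.continuous_on[OF assms(2)] by auto
next
  case (Suc k)
  show ?case
  proof (rule Ck_on_SucI[OF assms(1)])
    show "((\<lambda>x. L (f x)) has_derivative (\<lambda>v. L (frechet_derivative f (at x) v))) (at x)"
      if "x \<in> U" for x
      using Suc.prems that by (intro bounded_linear.has_derivative[OF assms(2)]
          Ck_on_has_derivative)
    show "Ck_on k U (\<lambda>x. L (frechet_derivative f (at x) v))" for v
      using Suc.prems by (intro Suc.IH) simp
  qed
qed

lemma Ck_on_bounded_bilinear: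
  assumes "open U" "bounded_bilinear B"
  shows "Ck_on k U f \<Longrightarrow> Ck_on k U g \<Longrightarrow> Ck_on k U (\<lambda>x. B (f x) (g x))"
proof (induction k arbitrary: f g)
  case 0
  then show ?case using bounded_bilinear.continuous_on[OF assms(2)] by auto
next
  case (Suc k)
  have fg: "Ck_on k U f" "Ck_on k U g" using Suc.prems Ck_on_SucD by blast+
  show ?case
  proof (rule Ck_on_SucI[OF assms(1)])
    show "((\<lambda>x. B (f x) (g x)) has_derivative
        (\<lambda>v. B (f x) (frechet_derivative g (at x) v) + B (frechet_derivative f (at x) v) (g x)))
            (at x)"
      if "x \<in> U" for x
      using Suc.prems that by (intro bounded_bilinear.FDERIV[OF assms(2)] Ck_on_has_derivative)
    show "Ck_on k U (\<lambda>x. B (f x) (frechet_derivative g (at x) v) +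
        B (frechet_derivative f (at x) v) (g x))" for v
    proof (rule Ck_on_add[OF assms(1)])
      show "Ck_on k U (\<lambda>x. B (f x) (frechet_derivative g (at x) v))"
        by (rule Suc.IH) (use fg Suc.prems in simp_all)
      show "Ck_on k U (\<lambda>x. B (frechet_derivative f (at x) v) (g x))"
        by (rule Suc.IH) (use fg Suc.prems in simp_all)
    qed
  qed
qed

lemma linear_euclidean_expansion:
  fixes L :: "'a::euclidean_space \<Rightarrow> 'b::real_vector"
  assumes "linear L" shows "(\<Sum>b\<in>Basis. (w \<bullet> b) *\<^sub>R L b) = L w"
proof -
  have "(\<Sum>b\<in>Basis. (w \<bullet> b) *\<^sub>R L b) = L (\<Sum>b\<in>Basis. (w \<bullet> b) *\<^sub>R b)"
    by (simp add: linear_sum[OF assms] linear_scale[OF assms])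
  then show ?thesis by (simp add: euclidean_representation)
qed

text \<open>
  The chain rule expands \<open>g'(f x) (f'(x) v)\<close> in the basis of the intermediate space, because the
  induction hypothesis applies to derivatives of \<open>g\<close> in fixed directions only.
\<close>

lemma Ck_on_compose:
  fixes f :: "'a::euclidean_space \<Rightarrow> 'b::euclidean_space" and g :: "'b \<Rightarrow> 'c::real_normed_vector"
  assumes "open U" "open V" "f ` U \<subseteq> V"
  shows "Ck_on k V g \<Longrightarrow> Ck_on k U f \<Longrightarrow> Ck_on k U (\<lambda>x. g (f x))"
  using assms(3)
proof (induction k arbitrary: g f)
  case 0
  then show ?case by (auto intro: continuous_on_compose2)
next
  case (Suc k)
  let ?g = "\<lambda>y. frechet_derivative g (at y)" and ?f = "\<lambda>x. frechet_derivative f (at x)"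
  have d: "((\<lambda>x. g (f x)) has_derivative (\<lambda>v. \<Sum>b\<in>Basis. (?f x v \<bullet> b) *\<^sub>R ?g (f x) b)) (at x)"
    if "x \<in> U" for x
  proof -
    have f: "(f has_derivative ?f x) (at x)" using Ck_on_has_derivative[OF Suc.prems(2) that] .
    have g: "(g has_derivative ?g (f x)) (at (f x))"
      using Ck_on_has_derivative[OF Suc.prems(1)] that Suc.prems by blast
    have l: "linear (?g (f x))" using g has_derivative_linear by blast
    show ?thesis
      using has_derivative_compose[OF f g] by (simp add: linear_euclidean_expansion[OF l])
  qed
  have fk: "Ck_on k U f" using Suc.prems Ck_on_SucD by blast
  have c: "Ck_on k U (\<lambda>x. (?f x v \<bullet> b) *\<^sub>R ?g (f x) b)" for v b
  proof (rule Ck_on_bounded_bilinear[OF assms(1) bounded_bilinear_scaleR])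
    show "Ck_on k U (\<lambda>x. ?f x v \<bullet> b)"
      using Suc.prems by (intro Ck_on_bounded_linear[OF assms(1) bounded_linear_inner_left]) simp
    show "Ck_on k U (\<lambda>x. ?g (f x) b)"
      using Suc.IH[of "\<lambda>y. ?g y b" f] Suc.prems fk by auto
  qed
  show ?case
    by (rule Ck_on_SucI[OF assms(1) d Ck_on_sum[OF assms(1) c]])
qed

lemma Ck_on_local:
  "(\<And>x. x \<in> U \<Longrightarrow> \<exists>V. open V \<and> x \<in> V \<and> Ck_on k V f) \<Longrightarrow> Ck_on k U f"
proof (induction k arbitrary: f)
  case 0
  then show ?case
    by (fastforce intro!: continuous_at_imp_continuous_on simp: continuous_on_eq_continuous_at)
next
  case (Suc k)
  have "f differentiable at x" if "x \<in> U" for x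
    using Suc.prems[OF that] by auto
  moreover have "Ck_on k U (\<lambda>x. frechet_derivative f (at x) v)" for v
    by (rule Suc.IH) (use Suc.prems in fastforce)
  ultimately show ?case by simp
qed

lemma smooth_on_extension:
  assumes "smooth_on S f" "x \<in> S"
  obtains U g where "open U" "x \<in> U" "\<And>k. Ck_on k U g" "\<And>z. z \<in> S \<Longrightarrow> z \<in> U \<Longrightarrow> g z = f z"
proof -
  from assms have "\<exists>U g. open U \<and> x \<in> U \<and> (\<forall>k. Ck_on k U g) \<and> (\<forall>z\<in>S \<inter> U. g z = f z)"
    by (simp add: smooth_on_def)
  then obtain U g where "open U" "x \<in> U" "\<forall>k. Ck_on k U g" "\<forall>z\<in>S \<inter> U. g z = f z" by blast
  then show ?thesis by (intro that[of U g]) simp_all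
qed

lemma smooth_onI:
  assumes "\<And>x. x \<in> S \<Longrightarrow> \<exists>U g. open U \<and> x \<in> U \<and> (\<forall>k. Ck_on k U g) \<and> (\<forall>z\<in>S \<inter> U. g z = f z)"
  shows "smooth_on S f"
  using assms by (simp add: smooth_on_def)

text \<open>
  A local extension on a neighbourhood inside an open set is the function itself, and being
  \<open>C\<^sup>k\<close> is a local property.
\<close>

lemma smooth_on_open_iff:
  assumes "open U" shows "smooth_on U f \<longleftrightarrow> (\<forall>k. Ck_on k U f)"
proof
  assume s: "smooth_on U f"
  show "\<forall>k. Ck_on k U f"
  proof (intro allI Ck_on_local)
    fix k x assume "x \<in> U"
    with s obtain V g where V: "open V" "x \<in> V" "\<And>k. Ck_on k V g" "\<And>z. z \<in> U \<Longrightarrow> z \<in> V \<Longrightarrow> g z = f z"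
      by (rule smooth_on_extension) blast
    have "Ck_on k (U \<inter> V) f"
      using V by (intro Ck_on_cong[of "U \<inter> V" g f] Ck_on_subset[OF _ V(3)]) (auto intro: assms)
    then show "\<exists>V. open V \<and> x \<in> V \<and> Ck_on k V f"
      using V \<open>x \<in> U\<close> assms by blast
  qed
qed (use assms in \<open>auto simp: smooth_on_def\<close>)

lemma smooth_on_subset:
  assumes "smooth_on T f" "S \<subseteq> T" shows "smooth_on S f"
proof (rule smooth_onI)
  fix x assume "x \<in> S"
  then have "x \<in> T" using assms(2) by auto
  then obtain U g where "open U" "x \<in> U" "\<And>k. Ck_on k U g" "\<And>z. z \<in> T \<Longrightarrow> z \<in> U \<Longrightarrow> g z = f z"
    by (rule smooth_on_extension[OF assms(1)]) blast
  then show "\<exists>U g. open U \<and> x \<in> U \<and> (\<forall>k. Ck_on k U g) \<and> (\<forall>z\<in>S \<inter> U. g z = f z)"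
    using assms(2) by (intro exI[of _ U] exI[of _ g]) auto
qed

lemma smooth_on_cong:
  assumes "smooth_on S f" "\<And>x. x \<in> S \<Longrightarrow> f x = g x" shows "smooth_on S g"
  using assms by (simp add: smooth_on_def)

text \<open>
  Closure properties of \<open>C\<^sup>k\<close> functions on open sets pass to arbitrary sets: two local
  extensions are both available on the intersection of their domains.
\<close>

lemma smooth_on_combine:
  fixes f :: "'a::euclidean_space \<Rightarrow> 'b::real_normed_vector"
    and g :: "'a \<Rightarrow> 'c::real_normed_vector" and P :: "'b \<Rightarrow> 'c \<Rightarrow> 'd::real_normed_vector"
  assumes "smooth_on S f" "smooth_on S g"
    and "\<And>(U::'a set) k f' g'. open U \<Longrightarrow> Ck_on k U f' \<Longrightarrow> Ck_on k U g'
        \<Longrightarrow> Ck_on k U (\<lambda>x. P (f' x) (g' x))"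
  shows "smooth_on S (\<lambda>x. P (f x) (g x))"
proof (rule smooth_onI)
  fix x assume x: "x \<in> S"
  obtain U f' where U: "open U" "x \<in> U" "\<And>k. Ck_on k U f'" "\<And>z. z \<in> S \<Longrightarrow> z \<in> U \<Longrightarrow> f' z = f z"
    by (rule smooth_on_extension[OF assms(1) x]) blast
  obtain V g' where V: "open V" "x \<in> V" "\<And>k. Ck_on k V g'" "\<And>z. z \<in> S \<Longrightarrow> z \<in> V \<Longrightarrow> g' z = g z"
    by (rule smooth_on_extension[OF assms(2) x]) blast
  have "Ck_on k (U \<inter> V) (\<lambda>x. P (f' x) (g' x))" for k
    by (rule assms(3)[of "U \<inter> V" k f' g'])
      (use U V in \<open>auto intro: Ck_on_subset[OF _ U(3)] Ck_on_subset[OF _ V(3)]\<close>)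
  then show "\<exists>U h. open U \<and> x \<in> U \<and> (\<forall>k. Ck_on k U h) \<and> (\<forall>z\<in>S \<inter> U. h z = P (f z) (g z))"
    using U V by (intro exI[of _ "U \<inter> V"] exI[of _ "\<lambda>x. P (f' x) (g' x)"]) auto
qed

lemma smooth_on_const: "smooth_on S (\<lambda>x. c)"
  by (rule smooth_onI, rule exI[of _ UNIV], rule exI[of _ "\<lambda>x. c"]) (simp add: Ck_on_const)

lemma smooth_on_ident: "smooth_on S (\<lambda>x. x)"
proof -
  have "Ck_on k UNIV (\<lambda>x::'a. x)" for k
    by (cases k) (auto intro: Ck_on_const)
  then show ?thesis by (intro smooth_onI exI[of _ UNIV] exI[of _ "\<lambda>x. x"]) simp
qed

lemma smooth_on_add:
  "smooth_on S f \<Longrightarrow> smooth_on S g \<Longrightarrow> smooth_on S (\<lambda>x. f x + g x)"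
  by (rule smooth_on_combine[of S f g "(+)"]) (auto intro: Ck_on_add)

lemma smooth_on_bounded_bilinear:
  "bounded_bilinear B \<Longrightarrow> smooth_on S f \<Longrightarrow> smooth_on S g \<Longrightarrow> smooth_on S (\<lambda>x. B (f x) (g x))"
  by (rule smooth_on_combine[of S f g B]) (auto intro: Ck_on_bounded_bilinear)

lemma smooth_on_bounded_linear:
  "bounded_linear L \<Longrightarrow> smooth_on S f \<Longrightarrow> smooth_on S (\<lambda>x. L (f x))"
  by (rule smooth_on_combine[of S f f "\<lambda>x y. L x"]) (auto intro: Ck_on_bounded_linear)

lemma smooth_on_sum:
  "(\<And>i. i \<in> I \<Longrightarrow> smooth_on S (f i)) \<Longrightarrow> smooth_on S (\<lambda>x. \<Sum>i\<in>I. f i x)"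
proof (induction I rule: infinite_finite_induct)
  case (insert i I)
  then have "smooth_on S (\<lambda>x. f i x + (\<Sum>i\<in>I. f i x))" by (intro smooth_on_add) simp_all
  then show ?case using insert by simp
qed (simp_all add: smooth_on_const)

lemma smooth_on_compose:
  fixes f :: "'a::euclidean_space \<Rightarrow> 'b::euclidean_space" and g :: "'b \<Rightarrow> 'c::real_normed_vector"
  assumes "smooth_on T g" "smooth_on S f" "f ` S \<subseteq> T"
  shows "smooth_on S (\<lambda>x. g (f x))"
proof (rule smooth_onI)
  fix x assume x: "x \<in> S"
  obtain U f' where U: "open U" "x \<in> U" "\<And>k. Ck_on k U f'" "\<And>z. z \<in> S \<Longrightarrow> z \<in> U \<Longrightarrow> f' z = f z"
    by (rule smooth_on_extension[OF assms(2) x]) blast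
  have fx: "f x \<in> T" using x assms by auto
  obtain V g' where V: "open V" "f x \<in> V" "\<And>k. Ck_on k V g'" "\<And>z. z \<in> T \<Longrightarrow> z \<in> V \<Longrightarrow> g' z = g z"
    by (rule smooth_on_extension[OF assms(1) fx]) blast
  have "continuous_on U f'" using U(3)[of 0] by simp
  then have o: "open (U \<inter> f' -` V)"
    using continuous_on_open_vimage[OF U(1), of f'] V(1) by (simp add: Int_commute)
  have "Ck_on k (U \<inter> f' -` V) (\<lambda>x. g' (f' x))" for k
    by (rule Ck_on_compose[OF o V(1) _ V(3)]) (auto intro: Ck_on_subset[OF _ U(3)])
  moreover have "f' x = f x" using x U by auto
  ultimately show "\<exists>U h. open U \<and> x \<in> U \<and> (\<forall>k. Ck_on k U h) \<and> (\<forall>z\<in>S \<inter> U. h z = g (f z))"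
    using U V o assms(3)
    by (intro exI[of _ "U \<inter> f' -` V"] exI[of _ "\<lambda>x. g' (f' x)"]) auto
qed

lemma smooth_on_minus: "smooth_on S f \<Longrightarrow> smooth_on S (\<lambda>x. - f x)"
  by (rule smooth_on_bounded_linear[OF bounded_linear_minus[OF bounded_linear_ident]])

lemma smooth_on_diff: "smooth_on S f \<Longrightarrow> smooth_on S g \<Longrightarrow> smooth_on S (\<lambda>x. f x - g x)"
  using smooth_on_add[OF _ smooth_on_minus, of S f g] by simp

lemmas smooth_on_scaleR = smooth_on_bounded_bilinear[OF bounded_bilinear_scaleR]
lemmas smooth_on_inner = smooth_on_bounded_bilinear[OF bounded_bilinear_inner]
lemmas smooth_on_mult = smooth_on_bounded_bilinear[OF bounded_bilinear_mult]
lemmas smooth_on_vec_nth = smooth_on_bounded_linear[OF bounded_linear_vec_nth]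
lemmas smooth_on_fst = smooth_on_bounded_linear[OF bounded_linear_fst]
lemmas smooth_on_snd = smooth_on_bounded_linear[OF bounded_linear_snd]

lemma smooth_on_power:
  fixes f :: "'a::euclidean_space \<Rightarrow> real"
  shows "smooth_on S f \<Longrightarrow> smooth_on S (\<lambda>x. f x ^ n)"
  by (induction n) (simp_all add: smooth_on_const smooth_on_mult)

lemma smooth_on_norm_power2:
  fixes f :: "'a::euclidean_space \<Rightarrow> 'b::real_inner"
  shows "smooth_on S f \<Longrightarrow> smooth_on S (\<lambda>x. (norm (f x))\<^sup>2)"
  unfolding power2_norm_eq_inner by (intro smooth_on_inner)

lemma smooth_on_Pair:
  assumes "smooth_on S f" "smooth_on S g" shows "smooth_on S (\<lambda>x. (f x, g x))"
proof -
  have "smooth_on S (\<lambda>x. (f x, 0) + (0, g x))"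
    by (intro smooth_on_add smooth_on_bounded_linear[OF _ assms(1)]
        smooth_on_bounded_linear[OF _ assms(2)] bounded_linear_Pair bounded_linear_ident
        bounded_linear_zero)
  then show ?thesis by simp
qed

lemma bounded_linear_axis: "bounded_linear (\<lambda>b :: 'b::euclidean_space. axis i b :: 'b^'n)"
  by (intro linear_conv_bounded_linear[THEN iffD1] linearI) (auto simp: axis_def vec_eq_iff)

lemma vec_lambda_eq_sum_axis:
  fixes g :: "'n::finite \<Rightarrow> 'b::euclidean_space"
  shows "(\<chi> i. g i) = (\<Sum>i\<in>UNIV. axis i (g i))"
  by (simp add: vec_eq_iff axis_def)

lemma smooth_on_vec_lambda:
  fixes f :: "'a::euclidean_space \<Rightarrow> 'n::finite \<Rightarrow> 'b::euclidean_space"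
  assumes "\<And>i. smooth_on S (\<lambda>x. f x i)" shows "smooth_on S (\<lambda>x. \<chi> i. f x i)"
  unfolding vec_lambda_eq_sum_axis
  by (intro smooth_on_sum smooth_on_bounded_linear[OF bounded_linear_axis] assms)

lemma smooth_on_prod:
  fixes f :: "'i \<Rightarrow> 'a::euclidean_space \<Rightarrow> real"
  shows "(\<And>i. i \<in> I \<Longrightarrow> smooth_on S (f i)) \<Longrightarrow> smooth_on S (\<lambda>x. \<Prod>i\<in>I. f i x)"
proof (induction I rule: infinite_finite_induct)
  case (insert i I)
  then have "smooth_on S (\<lambda>x. f i x * (\<Prod>i\<in>I. f i x))" by (intro smooth_on_mult) simp_all
  then show ?case using insert by simp
qed (simp_all add: smooth_on_const)

lemma smooth_on_matrix_mult:
  fixes A :: "'a::euclidean_space \<Rightarrow> real^'n^'m" and B :: "'a \<Rightarrow> real^'p^'n"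
  shows "smooth_on S A \<Longrightarrow> smooth_on S B \<Longrightarrow> smooth_on S (\<lambda>x. A x ** B x)"
  unfolding matrix_matrix_mult_def
  by (intro smooth_on_vec_lambda smooth_on_sum smooth_on_mult smooth_on_vec_nth)

lemma smooth_on_transpose:
  fixes A :: "'a::euclidean_space \<Rightarrow> real^'n^'m"
  shows "smooth_on S A \<Longrightarrow> smooth_on S (\<lambda>x. transpose (A x))"
  unfolding transpose_def by (intro smooth_on_vec_lambda smooth_on_vec_nth)

lemma smooth_on_trace:
  fixes A :: "'a::euclidean_space \<Rightarrow> real^'n^'n"
  shows "smooth_on S A \<Longrightarrow> smooth_on S (\<lambda>x. trace (A x))"
  unfolding trace_def by (intro smooth_on_sum smooth_on_vec_nth)

lemma smooth_on_det:
  fixes A :: "'a::euclidean_space \<Rightarrow> real^'n^'n"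
  shows "smooth_on S A \<Longrightarrow> smooth_on S (\<lambda>x. det (A x))"
  unfolding det_def by (intro smooth_on_sum smooth_on_mult smooth_on_const smooth_on_prod
      smooth_on_vec_nth)

lemma smooth_on_exp_real: "smooth_on UNIV (exp :: real \<Rightarrow> real)"
proof -
  have "Ck_on k UNIV (exp :: real \<Rightarrow> real)" for k
  proof (induction k)
    case (Suc k)
    show ?case
      by (rule Ck_on_SucI[where f' = "\<lambda>x v. exp x * v"])
        (use Suc in \<open>auto intro!: derivative_eq_intros Ck_on_const
            Ck_on_bounded_bilinear[OF _ bounded_bilinear_mult]\<close>)
  qed (auto intro: continuous_intros)
  then show ?thesis by (simp add: smooth_on_open_iff)
qed

lemma smooth_on_inverse_real: "smooth_on (- {0}) (inverse :: real \<Rightarrow> real)"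
proof -
  have o: "open (- {0::real})" by auto
  have "Ck_on k (- {0}) (inverse :: real \<Rightarrow> real)" for k
  proof (induction k)
    case (Suc k)
    show ?case
    proof (rule Ck_on_SucI[OF o])
      show "(inverse has_derivative (\<lambda>v. (- v) * (inverse x * inverse x))) (at x)"
          if "x \<in> - {0}" for x :: real
        using that by (auto intro!: derivative_eq_intros)
      show "Ck_on k (- {0}) (\<lambda>x::real. (- v) * (inverse x * inverse x))" for v
        by (intro Ck_on_bounded_bilinear[OF o bounded_bilinear_mult] Suc Ck_on_const o)
    qed
  qed (auto intro!: continuous_intros)
  then show ?thesis by (simp add: smooth_on_open_iff o)
qed

lemma smooth_on_ln_real: "smooth_on {0<..} (ln :: real \<Rightarrow> real)"
proof -
  have o: "open {0::real<..}" by auto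
  have i: "Ck_on k {0<..} (inverse :: real \<Rightarrow> real)" for k
    using smooth_on_subset[OF smooth_on_inverse_real, of "{0<..}"] smooth_on_open_iff[OF o] by auto
  have "Ck_on k {0<..} (ln :: real \<Rightarrow> real)" for k
  proof (cases k)
    case (Suc l)
    show ?thesis unfolding Suc
    proof (rule Ck_on_SucI[OF o])
      show "(ln has_derivative (\<lambda>v. v * inverse x)) (at x)" if "x \<in> {0<..}" for x :: real
        using that by (auto intro!: derivative_eq_intros)
      show "Ck_on l {0<..} (\<lambda>x::real. v * inverse x)" for v
        by (intro Ck_on_bounded_bilinear[OF o bounded_bilinear_mult] i Ck_on_const o)
    qed
  qed (auto intro!: continuous_intros)
  then show ?thesis by (simp add: smooth_on_open_iff o)
qed

lemma smooth_on_exp: "smooth_on S f \<Longrightarrow> smooth_on S (\<lambda>x. exp (f x :: real))"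
  by (rule smooth_on_compose[OF smooth_on_exp_real]) auto

lemma smooth_on_ln: "smooth_on S f \<Longrightarrow> (\<And>x. x \<in> S \<Longrightarrow> f x > 0) \<Longrightarrow> smooth_on S (\<lambda>x. ln (f x :: real))"
  by (rule smooth_on_compose[OF smooth_on_ln_real]) auto

lemma smooth_on_divide:
  assumes "smooth_on S f" "smooth_on S g" "\<And>x. x \<in> S \<Longrightarrow> g x \<noteq> (0::real)"
  shows "smooth_on S (\<lambda>x. f x / g x)"
  unfolding divide_inverse
  by (intro smooth_on_mult assms smooth_on_compose[OF smooth_on_inverse_real]) (use assms in auto)

text \<open>
  Cramer's rule writes the solution as a quotient of determinants, which are polynomials in the
  data.
\<close>

lemma smooth_on_linear_solution:
  fixes A :: "'a::euclidean_space \<Rightarrow> real^'n^'n"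
  assumes "smooth_on S A" "smooth_on S b" "\<And>x. x \<in> S \<Longrightarrow> det (A x) \<noteq> 0"
    and "\<And>x. x \<in> S \<Longrightarrow> A x *v X x = b x"
  shows "smooth_on S X"
proof (rule smooth_on_cong)
  show "smooth_on S (\<lambda>x. \<chi> k. det (\<chi> i j. if j = k then b x $ i else A x $ i $ j) / det (A x))"
  proof (intro smooth_on_vec_lambda smooth_on_divide smooth_on_det assms)
    fix k i j show "smooth_on S (\<lambda>x. if j = k then b x $ i else A x $ i $ j)"
      by (cases "j = k") (simp_all add: smooth_on_vec_nth assms(1,2))
  qed
  show "(\<chi> k. det (\<chi> i j. if j = k then b x $ i else A x $ i $ j) / det (A x)) = X x"
    if "x \<in> S" for x
    using cramer[OF assms(3)[OF that], of "X x" "b x"] assms(4)[OF that] by metis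
qed

lemma smooth_on_matrix_inv:
  fixes A :: "'a::euclidean_space \<Rightarrow> real^'n^'n"
  assumes "smooth_on S A" "\<And>x. x \<in> S \<Longrightarrow> invertible (A x)"
  shows "smooth_on S (\<lambda>x. matrix_inv (A x))"
proof -
  have "smooth_on S (\<lambda>x. matrix_inv (A x) *v axis j 1)" for j
  proof (rule smooth_on_linear_solution[OF assms(1) smooth_on_const])
    fix x assume "x \<in> S"
    then have i: "invertible (A x)" using assms by auto
    show "det (A x) \<noteq> 0" using i invertible_det_nz by auto
    have "A x ** matrix_inv (A x) = mat 1"
      using i unfolding invertible_def matrix_inv_def by (rule someI2_ex) auto
    then show "A x *v (matrix_inv (A x) *v axis j 1) = axis j 1"
      by (simp add: matrix_vector_mul_assoc)
  qed
  then have "smooth_on S (\<lambda>x. \<chi> i j. (matrix_inv (A x) *v axis j 1) $ i)"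
    by (intro smooth_on_vec_lambda smooth_on_vec_nth)
  moreover have "(\<chi> i j. (M *v axis j 1) $ i) = (M :: real^'n^'n)" for M
    by (simp add: vec_eq_iff matrix_vector_mult_basis column_def)
  ultimately show ?thesis by simp
qed

text \<open>
  The direction may depend on the point: the derivative is linear in it, so the basis directions
  suffice.
\<close>

lemma smooth_on_frechet_derivative:
  fixes g :: "'a::euclidean_space \<Rightarrow> 'b::real_normed_vector"
  assumes "open U" "smooth_on U g" "S \<subseteq> U" "smooth_on S c"
  shows "smooth_on S (\<lambda>x. frechet_derivative g (at x) (c x))"
proof -
  have C: "Ck_on k U g" for k using assms(1,2) smooth_on_open_iff by auto
  have "smooth_on U (\<lambda>x. frechet_derivative g (at x) v)" for v
    using C[of "Suc _"] by (simp add: smooth_on_open_iff[OF assms(1)])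
  then have "smooth_on S (\<lambda>x. \<Sum>b\<in>Basis. (c x \<bullet> b) *\<^sub>R frechet_derivative g (at x) b)"
    by (intro smooth_on_sum smooth_on_scaleR smooth_on_inner smooth_on_const assms(4)
        smooth_on_subset[OF _ assms(3)])
  moreover have "(\<Sum>b\<in>Basis. (c x \<bullet> b) *\<^sub>R frechet_derivative g (at x) b)
      = frechet_derivative g (at x) (c x)"
    if "x \<in> S" for x
  proof -
    have "linear (frechet_derivative g (at x))"
      using Ck_on_has_derivative[OF C] that assms(3) has_derivative_linear by blast
    then show ?thesis by (rule linear_euclidean_expansion)
  qed
  ultimately show ?thesis by (rule smooth_on_cong)
qed

lemma smooth_on_has_derivative:
  assumes "open U" "smooth_on U g" "x \<in> U"
  shows "(g has_derivative frechet_derivative g (at x)) (at x)"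
  using assms Ck_on_has_derivative smooth_on_open_iff by blast

section \<open>Positive definite matrices and their square roots\<close>

lemma symmetric_inner:
  fixes A :: "real^'n^'n"
  assumes "transpose A = A"
  shows "(A *v x) \<bullet> y = x \<bullet> (A *v y)"
proof -
  have "x v* A = A *v x" using assms transpose_matrix_vector[of A x] by simp
  then show ?thesis using dot_lmul_matrix[of x A y] by simp
qed

lemma symmetricI:
  fixes A :: "real^'n^'n"
  assumes "\<And>x y. x \<bullet> (A *v y) = (A *v x) \<bullet> y"
  shows "transpose A = A"
proof -
  have "A $ i $ j = axis i 1 \<bullet> (A *v axis j 1)" for i j
    by (simp add: matrix_vector_mult_basis column_def inner_axis')
  then have "A $ i $ j = A $ j $ i" for i j
    using assms[of "axis i 1" "axis j 1"] by (simp add: inner_commute)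
  then show ?thesis by (simp add: vec_eq_iff transpose_def)
qed

lemma linear_matrix_vector:
  fixes A :: "real^'n^'m"
  shows "A *v (x + y) = A *v x + A *v y" "A *v (x - y) = A *v x - A *v y"
      "A *v (c *\<^sub>R x) = c *\<^sub>R (A *v x)"
    and "(A + B) *v x = A *v x + B *v x" "(A - B) *v x = A *v x - B *v x"
        "(c *\<^sub>R A) *v x = c *\<^sub>R (A *v x)"
    and "A *v (\<Sum>i\<in>I. f i) = (\<Sum>i\<in>I. A *v f i)"
proof -
  have l: "linear ((*v) A)" by (rule matrix_vector_mul_linear)
  show "A *v (x + y) = A *v x + A *v y" "A *v (x - y) = A *v x - A *v y"
      "A *v (c *\<^sub>R x) = c *\<^sub>R (A *v x)"
    "A *v (\<Sum>i\<in>I. f i) = (\<Sum>i\<in>I. A *v f i)"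
    by (simp_all add: linear_add[OF l] linear_diff[OF l] linear_scale[OF l] linear_sum[OF l])
  show "(A + B) *v x = A *v x + B *v x" "(A - B) *v x = A *v x - B *v x"
      "(c *\<^sub>R A) *v x = c *\<^sub>R (A *v x)"
    by (simp_all add: vec_eq_iff matrix_vector_mult_def sum.distrib sum_subtractf algebra_simps
        sum_distrib_left)
qed

text \<open>
  The first-order condition at a maximum, extracted from the second-order expansion of a
  quadratic form.
\<close>

lemma quadratic_inequality_slope_zero:
  fixes a c :: real
  assumes "\<And>t. 2 * t * a \<le> t\<^sup>2 * c" shows "a = 0"
proof (rule ccontr)
  assume a: "a \<noteq> 0"
  define d where "d = \<bar>c\<bar> + 1"
  have d: "d > 0" "c \<le> d" by (auto simp: d_def)
  have "2 * (a / d) * a \<le> (a / d)\<^sup>2 * c" by (rule assms)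
  also have "\<dots> \<le> (a / d)\<^sup>2 * d" using d by (intro mult_left_mono) auto
  also have "\<dots> = (a / d) * a" using d by (simp add: power2_eq_square)
  finally have "a * a / d \<le> 0" by simp
  moreover have "a * a / d > 0" using a d by (intro divide_pos_pos) (auto simp: zero_less_mult_iff)
  ultimately show False by simp
qed

text \<open>
  The maximizer \<open>e\<close> of the quadratic form on the unit sphere of \<open>V\<close> is an eigenvector: at \<open>e\<close>
  the first variation vanishes in all directions of \<open>V\<close> orthogonal to \<open>e\<close>, and \<open>A e - \<mu> e\<close> is
  such a direction.
\<close>

lemma symmetric_eigenvector_in_invariant_subspace:
  fixes A :: "real^'n^'n"
  assumes sym: "transpose A = A" and V: "subspace V" "\<And>x. x \<in> V \<Longrightarrow> A *v x \<in> V" "V \<noteq> {0}"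
  obtains e \<mu> where "e \<in> V" "norm e = 1" "A *v e = \<mu> *\<^sub>R e"
proof -
  have "compact (sphere 0 1 \<inter> V)" using closed_subspace[OF V(1)] by (intro compact_Int_closed) auto
  moreover have "sphere 0 1 \<inter> V \<noteq> {}"
  proof -
    obtain x where "x \<in> V" "x \<noteq> 0" using V(1,3) subspace_0 by blast
    then have "x /\<^sub>R norm x \<in> sphere 0 1 \<inter> V" using subspace_scale[OF V(1)] by simp
    then show ?thesis by blast
  qed
  moreover have "continuous_on (sphere 0 1 \<inter> V) (\<lambda>x. x \<bullet> (A *v x))"
    by (intro continuous_intros linear_continuous_on linear_conv_bounded_linear[THEN iffD1]
        matrix_vector_mul_linear)
  ultimately obtain e where e: "e \<in> sphere 0 1 \<inter> V"
    and max: "\<And>x. x \<in> sphere 0 1 \<inter> V \<Longrightarrow> x \<bullet> (A *v x) \<le> e \<bullet> (A *v e)"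
    using continuous_attains_sup[of "sphere 0 1 \<inter> V" "\<lambda>x. x \<bullet> (A *v x)"] by blast
  define \<mu> where "\<mu> = e \<bullet> (A *v e)"
  have ee: "e \<bullet> e = 1" and eV: "e \<in> V" using e by (auto simp: dot_square_norm)
  have le: "x \<bullet> (A *v x) \<le> \<mu> * (x \<bullet> x)" if "x \<in> V" for x
  proof (cases "x = 0")
    case False
    have "(x /\<^sub>R norm x) \<bullet> (A *v (x /\<^sub>R norm x)) \<le> \<mu>"
      unfolding \<mu>_def using that False by (intro max) (auto simp: subspace_scale[OF V(1)])
    then have "(x \<bullet> (A *v x)) / (norm x * norm x) \<le> \<mu>"
      by (simp add: linear_matrix_vector divide_inverse mult_ac)
    then show ?thesis using False by (simp add: dot_square_norm field_simps power2_eq_square)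
  qed (simp add: linear_matrix_vector)
  have crit: "y \<bullet> (A *v e) = 0" if y: "y \<in> V" "y \<bullet> e = 0" for y
  proof (rule quadratic_inequality_slope_zero)
    fix t :: real
    have "e + t *\<^sub>R y \<in> V" using eV y V(1) by (simp add: subspace_add subspace_scale)
    from le[OF this] have "\<mu> + t * (e \<bullet> (A *v y)) + t * (y \<bullet> (A *v e)) + t\<^sup>2 * (y \<bullet> (A *v y))
        \<le> \<mu> * (1 + t\<^sup>2 * (y \<bullet> y))"
      using y ee by (simp add: linear_matrix_vector inner_simps inner_commute[of e y] \<mu>_def
          power2_eq_square algebra_simps)
    moreover have "e \<bullet> (A *v y) = y \<bullet> (A *v e)" using symmetric_inner[OF sym, of e y]
        by (simp add: inner_commute)
    ultimately show "2 * t * (y \<bullet> (A *v e)) \<le> t\<^sup>2 * (\<mu> * (y \<bullet> y) - y \<bullet> (A *v y))"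
      by (simp add: algebra_simps)
  qed
  define y where "y = A *v e - \<mu> *\<^sub>R e"
  have yV: "y \<in> V" unfolding y_def using eV V by (intro subspace_diff subspace_scale) auto
  have ye: "y \<bullet> e = 0" unfolding y_def using ee
      by (simp add: inner_diff_left \<mu>_def inner_commute[of "A *v e" e])
  have "y \<bullet> y = y \<bullet> (A *v e) - \<mu> * (y \<bullet> e)" by (subst (2) y_def) (simp add: inner_diff_right)
  then have "y = 0" using crit[OF yV ye] ye by simp
  then have "A *v e = \<mu> *\<^sub>R e" by (simp add: y_def)
  then show ?thesis using that e by auto
qed

text \<open>
  Induction on the dimension: by symmetry of \<open>A\<close>, the orthogonal complement of an eigenvector
  inside an invariant subspace is invariant again.
\<close>

lemma symmetric_eigenbasis_of_invariant_subspace: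
  fixes A :: "real^'n^'n"
  assumes sym: "transpose A = A"
  shows "subspace V \<Longrightarrow> (\<And>x. x \<in> V \<Longrightarrow> A *v x \<in> V) \<Longrightarrow>
    \<exists>B. finite B \<and> B \<subseteq> V \<and> pairwise orthogonal B \<and> V \<subseteq> span B \<and>
      (\<forall>b\<in>B. norm b = 1 \<and> (\<exists>\<mu>. A *v b = \<mu> *\<^sub>R b))"
proof (induction "dim V" arbitrary: V rule: less_induct)
  case less
  show ?case
  proof (cases "V = {0}")
    case True
    then show ?thesis by (intro exI[of _ "{}"]) auto
  next
    case False
    obtain e \<mu> where e: "e \<in> V" "norm e = 1" "A *v e = \<mu> *\<^sub>R e"
      using symmetric_eigenvector_in_invariant_subspace[OF sym less.prems False] by blast
    have ee: "e \<bullet> e = 1" using e by (simp add: dot_square_norm)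
    define W where "W = V \<inter> {x. e \<bullet> x = 0}"
    have W: "subspace W" unfolding W_def by (intro subspace_inter less.prems subspace_hyperplane)
    have inv: "A *v x \<in> W" if "x \<in> W" for x
      using that less.prems(2) symmetric_inner[OF sym, of e x] e by (auto simp: W_def)
    have "e \<notin> W" using ee by (simp add: W_def)
    moreover have "W \<subseteq> V" by (auto simp: W_def)
    ultimately have "W \<subset> V" using e by blast
    then have "dim W < dim V"
      using dim_psubset[of W V] W less.prems(1) by (metis span_eq_iff)
    from less.hyps[OF this W inv] obtain B where B: "finite B" "B \<subseteq> W" "pairwise orthogonal B"
      "W \<subseteq> span B" "\<forall>b\<in>B. norm b = 1 \<and> (\<exists>\<mu>. A *v b = \<mu> *\<^sub>R b)" by blast
    have "V \<subseteq> span (insert e B)"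
    proof
      fix x assume x: "x \<in> V"
      have "x - (e \<bullet> x) *\<^sub>R e \<in> W"
        using x e ee less.prems(1)
            by (auto simp: W_def inner_diff_right intro!: subspace_diff subspace_scale)
      then have "x - (e \<bullet> x) *\<^sub>R e \<in> span (insert e B)" using B(4) span_mono[of B "insert e B"]
          by blast
      then have "x - (e \<bullet> x) *\<^sub>R e + (e \<bullet> x) *\<^sub>R e \<in> span (insert e B)"
        by (intro span_add span_scale) (auto intro: span_base)
      then show "x \<in> span (insert e B)" by simp
    qed
    moreover have "pairwise orthogonal (insert e B)"
      using B(2,3) by (auto simp: pairwise_insert orthogonal_def W_def inner_commute)
    ultimately show ?thesis
      using B e by (intro exI[of _ "insert e B"]) (auto simp: W_def)
  qed
qed

theorem symmetric_eigenbasis: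
  fixes A :: "real^'n^'n"
  assumes sym: "transpose A = A"
  obtains B \<mu> where "finite B" "\<And>b. b \<in> B \<Longrightarrow> norm b = 1" "\<And>b. b \<in> B \<Longrightarrow> A *v b = \<mu> b *\<^sub>R b"
    "\<And>b c. b \<in> B \<Longrightarrow> c \<in> B \<Longrightarrow> b \<bullet> c = (if b = c then 1 else 0)"
    "\<And>x. (\<Sum>b\<in>B. (x \<bullet> b) *\<^sub>R b) = x"
proof -
  obtain B where B: "finite B" "pairwise orthogonal B" "UNIV \<subseteq> span B"
    "\<forall>b\<in>B. norm b = 1 \<and> (\<exists>\<mu>. A *v b = \<mu> *\<^sub>R b)"
    using symmetric_eigenbasis_of_invariant_subspace[OF sym, of UNIV] by auto
  then obtain \<mu> where "\<And>b. b \<in> B \<Longrightarrow> A *v b = \<mu> b *\<^sub>R b" by metis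
  moreover have "b \<bullet> c = (if b = c then 1 else 0)" if "b \<in> B" "c \<in> B" for b c
    using B(2,4) that by (auto simp: pairwise_def orthogonal_def dot_square_norm)
  moreover have "(\<Sum>b\<in>B. (x \<bullet> b) *\<^sub>R b) = x" for x
    by (rule orthonormal_basis_expand) (use B in auto)
  ultimately show ?thesis using that[of B \<mu>] B by blast
qed

lemma quadratic_form_eigenbasis:
  fixes A :: "real^'n^'n"
  assumes "\<And>b. b \<in> B \<Longrightarrow> A *v b = \<mu> b *\<^sub>R b" "\<And>x. (\<Sum>b\<in>B. (x \<bullet> b) *\<^sub>R b) = x"
  shows "x \<bullet> (A *v x) = (\<Sum>b\<in>B. \<mu> b * (x \<bullet> b)\<^sup>2)"
proof -
  have "A *v x = A *v (\<Sum>b\<in>B. (x \<bullet> b) *\<^sub>R b)" using assms(2) by simp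
  also have "\<dots> = (\<Sum>b\<in>B. ((x \<bullet> b) * \<mu> b) *\<^sub>R b)"
    unfolding linear_matrix_vector by (intro sum.cong) (auto simp: assms(1))
  finally show ?thesis by (simp add: inner_sum_right power2_eq_square mult_ac)
qed

lemma spdD:
  assumes "spd A"
  shows "transpose A = A" "x \<noteq> 0 \<Longrightarrow> 0 < x \<bullet> (A *v x)" "0 \<le> x \<bullet> (A *v x)"
proof -
  show "transpose A = A" "x \<noteq> 0 \<Longrightarrow> 0 < x \<bullet> (A *v x)" using assms by (auto simp: spd_def)
  then show "0 \<le> x \<bullet> (A *v x)" by (cases "x = 0") (auto simp: less_imp_le)
qed

text \<open>The root has the same eigenvectors as \<open>A\<close>, with the square roots of the eigenvalues.\<close>

lemma spd_sqrt_exists: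
  fixes A :: "real^'n^'n"
  assumes A: "spd A"
  shows "\<exists>S. spd S \<and> S ** S = A"
proof -
  obtain B \<mu> where B: "finite B" "\<And>b. b \<in> B \<Longrightarrow> norm b = 1" "\<And>b. b \<in> B \<Longrightarrow> A *v b = \<mu> b *\<^sub>R b"
    and orth: "\<And>b c. b \<in> B \<Longrightarrow> c \<in> B \<Longrightarrow> b \<bullet> c = (if b = c then 1 else 0)"
    and ex: "\<And>x. (\<Sum>b\<in>B. (x \<bullet> b) *\<^sub>R b) = x"
    using symmetric_eigenbasis[OF spdD(1)[OF A]] by blast
  have pos: "\<mu> b > 0" if b: "b \<in> B" for b
  proof -
    have "b \<bullet> b = 1" using orth[OF b b] by simp
    moreover from this have "b \<noteq> 0" by auto
    ultimately show ?thesis using spdD(2)[OF A, of b] B(3)[OF b] by simp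
  qed
  define T where "T x = (\<Sum>b\<in>B. (sqrt (\<mu> b) * (x \<bullet> b)) *\<^sub>R b)" for x
  have "linear T"
    by (rule linearI) (auto simp: T_def inner_simps algebra_simps sum.distrib scaleR_sum_right)
  define S where "S = matrix T"
  have S: "S *v x = T x" for x unfolding S_def using \<open>linear T\<close>
      by (simp add: matrix_works linear_matrix_vector_mul_eq)
  have Tb: "T b = sqrt (\<mu> b) *\<^sub>R b" if b: "b \<in> B" for b
  proof -
    have "T b = (\<Sum>c\<in>B. if c = b then sqrt (\<mu> b) *\<^sub>R b else 0)"
      unfolding T_def by (rule sum.cong) (auto simp: orth[OF b])
    then show ?thesis using B(1) b by simp
  qed
  have TT: "T (T x) = A *v x" for x
  proof -
    have "T (T x) = (\<Sum>b\<in>B. (sqrt (\<mu> b) * (x \<bullet> b)) *\<^sub>R T b)"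
      by (subst (2) T_def) (simp add: linear_sum[OF \<open>linear T\<close>] linear_scale[OF \<open>linear T\<close>])
    also have "\<dots> = (\<Sum>b\<in>B. (x \<bullet> b) *\<^sub>R (A *v b))"
      by (rule sum.cong) (use pos in \<open>auto simp: Tb B(3) less_imp_le mult_ac\<close>)
    also have "\<dots> = A *v (\<Sum>b\<in>B. (x \<bullet> b) *\<^sub>R b)" by (simp add: linear_matrix_vector)
    finally show ?thesis by (simp add: ex)
  qed
  have "S ** S = A" by (simp add: matrix_eq matrix_vector_mul_assoc[symmetric] S TT)
  moreover have "spd S"
    unfolding spd_def
  proof (intro conjI allI impI)
    have sym: "x \<bullet> (S *v y) = (S *v x) \<bullet> y" for x y
      by (simp add: S T_def inner_sum_right inner_sum_left inner_commute mult_ac)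
    show "transpose S = S" using sym by (rule symmetricI)
    fix x :: "real^'n" assume x: "x \<noteq> 0"
    have "x \<bullet> (S *v x) = (\<Sum>b\<in>B. sqrt (\<mu> b) * (x \<bullet> b)\<^sup>2)"
      by (simp add: S T_def inner_sum_right power2_eq_square mult_ac)
    also have "\<dots> > 0"
    proof -
      have "\<exists>b\<in>B. x \<bullet> b \<noteq> 0"
      proof (rule ccontr)
        assume "\<not> ?thesis"
        then have "(\<Sum>b\<in>B. (x \<bullet> b) *\<^sub>R b) = 0" by (intro sum.neutral) auto
        then show False using ex x by simp
      qed
      then obtain b where "b \<in> B" "x \<bullet> b \<noteq> 0" by blast
      then show ?thesis using pos
        by (intro sum_pos2[OF B(1), of b]) (auto simp: less_imp_le)
    qed
    finally show "0 < x \<bullet> (S *v x)" .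
  qed
  ultimately show ?thesis by blast
qed

lemma spd_lower_bound:
  fixes A :: "real^'n^'n"
  assumes A: "spd A"
  obtains c where "c > 0" "\<And>x. c * (norm x)\<^sup>2 \<le> x \<bullet> (A *v x)"
proof -
  have cont: "continuous_on (sphere 0 1) (\<lambda>x. x \<bullet> (A *v x))"
    by (intro continuous_intros linear_continuous_on linear_conv_bounded_linear[THEN iffD1]
        matrix_vector_mul_linear)
  have ne: "sphere (0::real^'n) 1 \<noteq> {}" by simp
  from continuous_attains_inf[OF compact_sphere ne cont]
  obtain e where e: "e \<in> sphere 0 1" and min: "\<forall>x\<in>sphere 0 1. e \<bullet> (A *v e) \<le> x \<bullet> (A *v x)" ..
  have "e \<bullet> (A *v e) * (norm x)\<^sup>2 \<le> x \<bullet> (A *v x)" for x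
  proof (cases "x = 0")
    case False
    then have "e \<bullet> (A *v e) \<le> (x /\<^sub>R norm x) \<bullet> (A *v (x /\<^sub>R norm x))"
        by (intro min[rule_format]) auto
    then have "e \<bullet> (A *v e) \<le> (x \<bullet> (A *v x)) / (norm x * norm x)"
      by (simp add: linear_matrix_vector divide_inverse mult_ac)
    then show ?thesis using False by (simp add: field_simps power2_eq_square)
  qed (simp add: linear_matrix_vector)
  moreover have "e \<noteq> 0" using e by force
  then have "e \<bullet> (A *v e) > 0" using spdD(2)[OF A] by blast
  ultimately show ?thesis using that by blast
qed

lemma inner_matrix_columns:
  fixes X Y :: "real^'n^'m"
  shows "X \<bullet> Y = (\<Sum>j\<in>UNIV. column j X \<bullet> column j Y)"
  unfolding inner_vec_def column_def by (subst sum.swap) simp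

lemma column_matrix_matrix_mult: "column j (A ** X) = A *v column j X"
  by (simp add: column_def matrix_matrix_mult_def matrix_vector_mult_def vec_eq_iff)

lemma inner_transpose:
  fixes X Y :: "real^'n^'m" shows "transpose X \<bullet> transpose Y = X \<bullet> Y"
  unfolding inner_vec_def transpose_def by (subst sum.swap) simp

lemma inner_mult_left_lower_bound:
  fixes A :: "real^'n^'n" and X :: "real^'m^'n"
  assumes "\<And>x. c * (norm x)\<^sup>2 \<le> x \<bullet> (A *v x)"
  shows "c * (norm X)\<^sup>2 \<le> X \<bullet> (A ** X)"
proof -
  have "c * (norm X)\<^sup>2 = (\<Sum>j\<in>UNIV. c * (norm (column j X))\<^sup>2)"
    by (simp add: power2_norm_eq_inner inner_matrix_columns[of X] sum_distrib_left)
  also have "\<dots> \<le> X \<bullet> (A ** X)"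
    unfolding inner_matrix_columns column_matrix_matrix_mult by (intro sum_mono assms)
  finally show ?thesis .
qed

lemma inner_mult_right_lower_bound:
  fixes A :: "real^'n^'n" and X :: "real^'n^'m"
  assumes "\<And>x. c * (norm x)\<^sup>2 \<le> x \<bullet> (A *v x)" "transpose A = A"
  shows "c * (norm X)\<^sup>2 \<le> X \<bullet> (X ** A)"
proof -
  have "c * (norm (transpose X))\<^sup>2 \<le> transpose X \<bullet> (A ** transpose X)"
    by (rule inner_mult_left_lower_bound[OF assms(1)])
  also have "A ** transpose X = transpose (X ** A)" by (simp add: matrix_transpose_mul assms(2))
  finally show ?thesis by (simp add: inner_transpose power2_norm_eq_inner)
qed

text \<open>
  The Sylvester operator \<open>X \<mapsto> A X + X B\<close> is coercive for the Frobenius product, since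
  \<open>X \<bullet> (A X)\<close> sums the quadratic form of \<open>A\<close> over the columns of \<open>X\<close> and \<open>X \<bullet> (X B)\<close> that of \<open>B\<close>
  over its rows. A difference of two squares is a Sylvester operator applied to the difference
  of the roots, so this estimate yields uniqueness of the root as well as its continuity and
  differentiability.
\<close>

lemma sylvester_coercive:
  fixes A B X :: "real^'n^'n"
  assumes "\<And>x. c * (norm x)\<^sup>2 \<le> x \<bullet> (A *v x)" "spd B"
  shows "c * norm X \<le> norm (A ** X + X ** B)"
proof (cases "X = 0")
  case False
  have "c * (norm X)\<^sup>2 \<le> X \<bullet> (A ** X)" by (rule inner_mult_left_lower_bound[OF assms(1)])
  moreover have "0 * (norm X)\<^sup>2 \<le> X \<bullet> (X ** B)"
    by (rule inner_mult_right_lower_bound) (use spdD[OF assms(2)] in auto)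
  ultimately have "c * (norm X)\<^sup>2 \<le> X \<bullet> (A ** X + X ** B)" by (simp add: inner_add_right)
  also have "\<dots> \<le> norm X * norm (A ** X + X ** B)" by (rule norm_cauchy_schwarz)
  finally show ?thesis using False by (simp add: power2_eq_square)
qed simp

lemma sylvester_eq_zero:
  fixes A B X :: "real^'n^'n"
  assumes "spd A" "spd B" "A ** X + X ** B = 0" shows "X = 0"
proof -
  obtain c where "c > 0" "\<And>x. c * (norm x)\<^sup>2 \<le> x \<bullet> (A *v x)" using spd_lower_bound[OF assms(1)]
      by blast
  then show ?thesis using sylvester_coercive[of c A B X] assms by (simp add: mult_le_0_iff)
qed

lemma matrix_mult_diff_distrib:
  fixes A :: "real^'n^'m"
  shows "A ** (B - C) = A ** B - A ** C" "(D - E) ** A = D ** A - E ** A"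
  by (simp_all add: vec_eq_iff matrix_matrix_mult_def sum_subtractf algebra_simps)

lemma square_diff_eq_sylvester:
  fixes S T :: "real^'n^'n"
  shows "S ** S - T ** T = T ** (S - T) + (S - T) ** S"
  by (simp add: matrix_mult_diff_distrib)

lemma spd_sqrt_unique:
  fixes S T :: "real^'n^'n"
  assumes "spd S" "spd T" "S ** S = T ** T" shows "S = T"
  using sylvester_eq_zero[OF assms(2,1), of "S - T"] square_diff_eq_sylvester[of S T] assms(3)
      by simp

lemma mat_sqrt:
  fixes A :: "real^'n^'n"
  assumes "spd A" shows spd_mat_sqrt: "spd (mat_sqrt A)"
      and mat_sqrt_square: "mat_sqrt A ** mat_sqrt A = A"
proof -
  have "\<exists>!B. spd B \<and> B ** B = A" using spd_sqrt_exists[OF assms] spd_sqrt_unique by metis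
  from theI'[OF this] show "spd (mat_sqrt A)" "mat_sqrt A ** mat_sqrt A = A"
      by (simp_all add: mat_sqrt_def)
qed

lemma spd_invertible:
  fixes A :: "real^'n^'n" assumes "spd A" shows "invertible A"
  unfolding invertible_left_inverse matrix_left_invertible_ker
  using spdD(2)[OF assms] by (metis inner_zero_right less_irrefl)

lemma matrix_inv_mult:
  fixes A :: "real^'n^'n" assumes "invertible A"
  shows matrix_inv_mult_right: "A ** matrix_inv A = mat 1"
      and matrix_inv_mult_left: "matrix_inv A ** A = mat 1"
proof -
  have "A ** matrix_inv A = mat 1 \<and> matrix_inv A ** A = mat 1"
    using assms unfolding invertible_def matrix_inv_def by (rule someI_ex)
  then show "A ** matrix_inv A = mat 1" "matrix_inv A ** A = mat 1" by auto
qed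

lemma spd_matrix_inv:
  fixes A :: "real^'n^'n" assumes A: "spd A" shows "spd (matrix_inv A)"
  unfolding spd_def
proof (intro conjI allI impI)
  let ?B = "matrix_inv A"
  note inv = matrix_inv_mult[OF spd_invertible[OF A]]
  have "transpose ?B ** A = mat 1"
    using arg_cong[OF inv(1), of transpose] by (simp add: matrix_transpose_mul spdD(1)[OF A])
  then have "transpose ?B ** (A ** ?B) = ?B" by (simp add: matrix_mul_assoc)
  then show "transpose ?B = ?B" by (simp add: inv)
  fix x :: "real^'n" assume x: "x \<noteq> 0"
  have x': "A *v (?B *v x) = x" by (simp add: matrix_vector_mul_assoc inv)
  then have "?B *v x \<noteq> 0" using x by auto
  from spdD(2)[OF A this] show "0 < x \<bullet> (?B *v x)" by (simp add: x' inner_commute)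
qed

lemma spd_mat_inv_sqrt: "spd A \<Longrightarrow> spd (mat_inv_sqrt A)"
  unfolding mat_inv_sqrt_def by (intro spd_matrix_inv spd_mat_sqrt)

lemma spd_congruence:
  fixes A F :: "real^'n^'n" assumes "spd A" "invertible F"
  shows "spd (F ** A ** transpose F)"
  unfolding spd_def
proof (intro conjI allI impI)
  show "transpose (F ** A ** transpose F) = F ** A ** transpose F"
    by (simp add: matrix_transpose_mul spdD(1)[OF assms(1)] matrix_mul_assoc)
  fix x :: "real^'n" assume x: "x \<noteq> 0"
  have "invertible (transpose F)" using assms(2) by (simp add: invertible_det_nz)
  then have "transpose F *v x \<noteq> 0"
    using x unfolding invertible_left_inverse matrix_left_invertible_ker by blast
  from spdD(2)[OF assms(1) this] show "0 < x \<bullet> (F ** A ** transpose F *v x)"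
    by (simp add: matrix_vector_mul_assoc[symmetric] dot_lmul_matrix[symmetric])
qed

lemma spd_scaleR: "spd A \<Longrightarrow> 0 < c \<Longrightarrow> spd (c *\<^sub>R A)"
  by (simp add: spd_def transpose_scalar linear_matrix_vector)

lemma spd_add: "spd A \<Longrightarrow> spd B \<Longrightarrow> spd (A + B)"
  by (simp add: spd_def linear_matrix_vector inner_add_right add_pos_pos)
    (simp add: transpose_def vec_eq_iff)

lemma norm_convex_combination_square:
  fixes a b :: "'a::real_inner"
  shows "(norm ((1 - t) *\<^sub>R a + t *\<^sub>R b))\<^sup>2 =
    (1 - t) * (norm a)\<^sup>2 + t * (norm b)\<^sup>2 - t * (1 - t) * (norm (a - b))\<^sup>2"
  by (simp only: power2_norm_eq_inner inner_add_left inner_add_right inner_diff_left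
      inner_diff_right
      inner_scaleR_left inner_scaleR_right inner_commute[of b a]) algebra

text \<open>
  It suffices to test an eigenvector \<open>b\<close> of \<open>N - M\<close>. If \<open>\<mu>\<close> is its eigenvalue, then
  \<open>|N b|\<^sup>2 - |M b|\<^sup>2 = \<mu> (b \<bullet> N b + b \<bullet> M b)\<close>, so that \<open>\<mu> \<ge> 0\<close>.
\<close>

lemma sqrt_operator_monotone:
  fixes M N :: "real^'n^'n"
  assumes M: "spd M" and N: "spd N" and le: "\<And>x. norm (M *v x) \<le> norm (N *v x)"
  shows "x \<bullet> (M *v x) \<le> x \<bullet> (N *v x)"
proof -
  have sym: "transpose (N - M) = N - M"
    using spdD(1)[OF M] spdD(1)[OF N] by (simp add: transpose_def vec_eq_iff)
  obtain B \<mu> where B: "finite B" "\<And>b. b \<in> B \<Longrightarrow> norm b = 1" "\<And>b. b \<in> B \<Longrightarrow> (N - M) *v b = \<mu> b *\<^sub>R b"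
    and "\<And>b c. b \<in> B \<Longrightarrow> c \<in> B \<Longrightarrow> b \<bullet> c = (if b = c then 1 else 0)"
    and ex: "\<And>x. (\<Sum>b\<in>B. (x \<bullet> b) *\<^sub>R b) = x"
    by (rule symmetric_eigenbasis[OF sym]) blast
  have "0 \<le> \<mu> b" if b: "b \<in> B" for b
  proof -
    have "b \<noteq> 0" using B(2)[OF b] by auto
    then have p: "0 < b \<bullet> (N *v b) + b \<bullet> (M *v b)" by (intro add_pos_pos spdD(2) M N)
    have "0 \<le> (N *v b) \<bullet> (N *v b) - (M *v b) \<bullet> (M *v b)"
      using power_mono[OF le norm_ge_zero, of b 2] by (simp add: power2_norm_eq_inner)
    also have "\<dots> = ((N - M) *v b) \<bullet> (N *v b + M *v b)"
      by (simp add: linear_matrix_vector inner_simps inner_commute)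
    also have "\<dots> = \<mu> b * (b \<bullet> (N *v b) + b \<bullet> (M *v b))"
      by (simp add: B(3)[OF b] inner_add_right distrib_left)
    finally show ?thesis using p by (simp add: zero_le_mult_iff)
  qed
  then have "0 \<le> x \<bullet> ((N - M) *v x)"
    by (simp add: quadratic_form_eigenbasis[OF B(3) ex] sum_nonneg)
  then show ?thesis by (simp add: linear_matrix_vector inner_diff_right)
qed

text \<open>
  The squared norm is convex, hence the square of the mixed roots lies below the mixture of \<open>Y\<close>
  and \<open>Z\<close>; operator monotonicity transfers this comparison to the roots.
\<close>

lemma mat_sqrt_operator_concave:
  fixes Y Z :: "real^'n^'n"
  assumes Y: "spd Y" and Z: "spd Z" and t: "0 < t" "t < 1"
  shows "(1 - t) * (x \<bullet> (mat_sqrt Y *v x)) + t * (x \<bullet> (mat_sqrt Z *v x))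
    \<le> x \<bullet> (mat_sqrt ((1 - t) *\<^sub>R Y + t *\<^sub>R Z) *v x)"
proof -
  let ?S = "mat_sqrt Y" and ?T = "mat_sqrt Z" and ?A = "(1 - t) *\<^sub>R Y + t *\<^sub>R Z"
  let ?M = "(1 - t) *\<^sub>R ?S + t *\<^sub>R ?T"
  have A: "spd ?A" using assms by (intro spd_add spd_scaleR) auto
  have M: "spd ?M" using assms by (intro spd_add spd_scaleR spd_mat_sqrt) auto
  have sq: "(norm (mat_sqrt C *v w))\<^sup>2 = w \<bullet> (C *v w)" if "spd C" for C :: "real^'n^'n" and w
    using symmetric_inner[OF spdD(1)[OF spd_mat_sqrt[OF that]], of w "mat_sqrt C *v w"]
    by (simp add: power2_norm_eq_inner matrix_vector_mul_assoc mat_sqrt_square[OF that])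
  have "norm (?M *v w) \<le> norm (mat_sqrt ?A *v w)" for w
  proof (rule power2_le_imp_le)
    have "(norm (?M *v w))\<^sup>2 \<le> (1 - t) * (norm (?S *v w))\<^sup>2 + t * (norm (?T *v w))\<^sup>2"
      using t by (simp add: linear_matrix_vector norm_convex_combination_square)
    then show "(norm (?M *v w))\<^sup>2 \<le> (norm (mat_sqrt ?A *v w))\<^sup>2"
      by (simp add: sq A Y Z linear_matrix_vector inner_add_right)
  qed simp
  from sqrt_operator_monotone[OF M spd_mat_sqrt[OF A] this, of x]
  show ?thesis by (simp add: linear_matrix_vector inner_add_right)
qed

section \<open>Smoothness of the matrix square root\<close>

definition sym_part :: "real^'n^'n \<Rightarrow> real^'n^'n" where
  "sym_part A = (1/2) *\<^sub>R (A + transpose A)"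

lemma transpose_sym_part: "transpose (sym_part A) = sym_part A"
  by (simp add: sym_part_def transpose_def vec_eq_iff)

lemma sym_part_symmetric: "transpose A = A \<Longrightarrow> sym_part A = A"
  by (simp add: sym_part_def scaleR_2[symmetric])

lemma linear_sym_part: "linear sym_part"
  by (rule linearI) (simp_all add: sym_part_def transpose_def vec_eq_iff algebra_simps)

lemma norm_sym_part_le: fixes A :: "real^'n^'n" shows "norm (sym_part A) \<le> norm A"
proof -
  have "norm (transpose A) = norm A" by (simp add: norm_eq_sqrt_inner inner_transpose)
  then show ?thesis using norm_triangle_ineq[of A "transpose A"] by (simp add: sym_part_def)
qed

lemma quadratic_form_sym_part:
  fixes A :: "real^'n^'n" shows "x \<bullet> (sym_part A *v x) = x \<bullet> (A *v x)"
proof -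
  have "x \<bullet> (transpose A *v x) = x \<bullet> (A *v x)" using dot_lmul_matrix[of x A x]
      by (simp add: inner_commute)
  then show ?thesis by (simp add: sym_part_def linear_matrix_vector inner_add_right)
qed

lemma quadratic_form_le_norm:
  fixes A :: "real^'n^'n" shows "\<bar>x \<bullet> (A *v x)\<bar> \<le> norm A * (norm x)\<^sup>2"
proof -
  let ?X = "(\<chi> i j. x $ i * x $ j) :: real^'n^'n"
  have "x \<bullet> (A *v x) = A \<bullet> ?X"
    by (simp add: inner_vec_def matrix_vector_mult_def sum_distrib_left mult_ac)
  moreover have "norm ?X = (norm x)\<^sup>2"
  proof -
    have "?X \<bullet> ?X = (x \<bullet> x) * (x \<bullet> x)"
      by (simp add: inner_vec_def sum_product mult_ac)
    then show ?thesis by (simp add: norm_eq_sqrt_inner)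
  qed
  ultimately show ?thesis using Cauchy_Schwarz_ineq2[of A ?X] by simp
qed

lemma open_spd_sym_part: "open {A :: real^'n^'n. spd (sym_part A)}"
  unfolding open_dist
proof (intro ballI)
  fix A :: "real^'n^'n" assume "A \<in> {A. spd (sym_part A)}"
  then obtain c where c: "c > 0" "\<And>x. c * (norm x)\<^sup>2 \<le> x \<bullet> (sym_part A *v x)"
    using spd_lower_bound[of "sym_part A"] by blast
  have "spd (sym_part B)" if "dist B A < c" for B
    unfolding spd_def
  proof (intro conjI allI impI transpose_sym_part)
    fix x :: "real^'n" assume "x \<noteq> 0"
    then have "norm (B - A) * (norm x)\<^sup>2 < c * (norm x)\<^sup>2" using that by (simp add: dist_norm)
    moreover have "x \<bullet> (B *v x) = x \<bullet> (A *v x) + x \<bullet> ((B - A) *v x)"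
      by (simp add: linear_matrix_vector inner_diff_right)
    ultimately show "0 < x \<bullet> (sym_part B *v x)"
      using quadratic_form_le_norm[of x "B - A"] c(2)[of x] by (simp add: quadratic_form_sym_part)
  qed
  then show "\<exists>e>0. \<forall>B. dist B A < e \<longrightarrow> B \<in> {A. spd (sym_part A)}" using c by blast
qed

text \<open>
  Matrices are read as coordinate vectors indexed by pairs, so that the Sylvester operator
  becomes a matrix and the inverse matrix describes how its solutions depend on the coefficient.
\<close>

definition flatten :: "real^'n^'n \<Rightarrow> real^('n \<times> 'n)" where
  "flatten X = (\<chi> p. X $ fst p $ snd p)"

definition unflatten :: "real^('n \<times> 'n) \<Rightarrow> real^'n^'n" where
  "unflatten x = (\<chi> i j. x $ (i, j))"

definition sylvester_matrix :: "real^'n^'n \<Rightarrow> real^('n \<times> 'n)^('n \<times> 'n)" where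
  "sylvester_matrix S = (\<chi> p q. (if snd p = snd q then S $ fst p $ fst q else 0) +
     (if fst p = fst q then S $ snd q $ snd p else 0))"

definition sylvester_solution :: "real^'n^'n \<Rightarrow> real^'n^'n \<Rightarrow> real^'n^'n" where
  "sylvester_solution S V = unflatten (matrix_inv (sylvester_matrix S) *v flatten V)"

lemma flatten_unflatten: "flatten (unflatten x) = x" "unflatten (flatten X) = X"
  by (simp_all add: flatten_def unflatten_def vec_eq_iff)

lemma flatten_nth: "flatten X $ (i, j) = X $ i $ j"
  by (simp add: flatten_def)

lemma sylvester_matrix_flatten:
  fixes S X :: "real^'n^'n"
  shows "sylvester_matrix S *v flatten X = flatten (S ** X + X ** S)"
proof -
  have "(\<Sum>q\<in>UNIV. sylvester_matrix S $ (i, j) $ q * flatten X $ q) =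
      (\<Sum>k\<in>UNIV. S $ i $ k * X $ k $ j) + (\<Sum>l\<in>UNIV. X $ i $ l * S $ l $ j)" for i j
  proof -
    have "(\<Sum>q\<in>UNIV. sylvester_matrix S $ (i, j) $ q * flatten X $ q) =
      (\<Sum>k\<in>UNIV. \<Sum>l\<in>UNIV. ((if j = l then S $ i $ k else 0) + (if i = k then S $ l $ j else 0)) *
          X $ k $ l)"
      unfolding UNIV_Times_UNIV[symmetric] sum.cartesian_product[symmetric]
      by (auto simp: sylvester_matrix_def flatten_def sum.cartesian_product intro!: sum.cong)
    also have "\<dots> = (\<Sum>k\<in>UNIV. \<Sum>l\<in>UNIV. if j = l then S $ i $ k * X $ k $ l else 0) +
        (\<Sum>k\<in>UNIV. \<Sum>l\<in>UNIV. if i = k then S $ l $ j * X $ k $ l else 0)"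
      unfolding sum.distrib[symmetric] by (intro sum.cong) (auto simp: algebra_simps)
    also have "(\<Sum>k\<in>UNIV. \<Sum>l\<in>UNIV. if i = k then S $ l $ j * X $ k $ l else 0) =
        (\<Sum>l\<in>UNIV. \<Sum>k\<in>UNIV. if i = k then S $ l $ j * X $ k $ l else 0)"
      by (rule sum.swap)
    finally show ?thesis by (simp add: mult.commute)
  qed
  then show ?thesis
    by (simp add: vec_eq_iff flatten_nth matrix_vector_mult_def matrix_matrix_mult_def
        split_paired_all)
qed

lemma invertible_sylvester_matrix:
  fixes S :: "real^'n^'n" assumes "spd S" shows "invertible (sylvester_matrix S)"
  unfolding invertible_left_inverse matrix_left_invertible_ker
proof (intro allI impI)
  fix x assume x: "sylvester_matrix S *v x = 0"
  have "flatten (S ** unflatten x + unflatten x ** S) = 0"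
    using sylvester_matrix_flatten[of S "unflatten x"] x by (simp add: flatten_unflatten)
  then have "S ** unflatten x + unflatten x ** S = 0"
    by (simp add: flatten_def vec_eq_iff split_paired_all)
  then have "unflatten x = 0" using sylvester_eq_zero[OF assms assms] by blast
  then show "x = 0" by (simp add: unflatten_def vec_eq_iff split_paired_all)
qed

lemma sylvester_solution:
  fixes S V :: "real^'n^'n" assumes "spd S"
  shows "S ** sylvester_solution S V + sylvester_solution S V ** S = V"
proof -
  have "flatten (S ** sylvester_solution S V + sylvester_solution S V ** S) = flatten V"
    using matrix_inv_mult(1)[OF invertible_sylvester_matrix[OF assms]]
    by (simp add: sylvester_matrix_flatten[symmetric] sylvester_solution_def flatten_unflatten
        matrix_vector_mul_assoc)
  then show ?thesis by (metis flatten_unflatten(2))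
qed

lemma linear_sylvester_solution: "linear (sylvester_solution S)"
  by (rule linearI)
    (simp_all add: sylvester_solution_def flatten_def unflatten_def vec_eq_iff
        matrix_vector_mult_def
      sum.distrib algebra_simps sum_distrib_left)

lemma smooth_on_sylvester_matrix:
  "smooth_on S (sylvester_matrix :: real^'n^'n \<Rightarrow> real^('n \<times> 'n)^('n \<times> 'n))"
proof -
  have entry: "smooth_on S (\<lambda>A :: real^'n^'n. if P then A $ i $ j else 0)" for P i j
    by (cases P) (simp_all add: smooth_on_const smooth_on_vec_nth smooth_on_ident)
  show ?thesis
    unfolding sylvester_matrix_def[abs_def] by (intro smooth_on_vec_lambda smooth_on_add entry)
qed

lemma smooth_on_sylvester_solution:
  "smooth_on {S. invertible (sylvester_matrix S)} (\<lambda>S :: real^'n^'n. sylvester_solution S V)"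
proof -
  have "smooth_on {S. invertible (sylvester_matrix S)}
      (\<lambda>S :: real^'n^'n. matrix_inv (sylvester_matrix S))"
    using smooth_on_sylvester_matrix by (rule smooth_on_matrix_inv) auto
  then show ?thesis
    unfolding sylvester_solution_def unflatten_def matrix_vector_mult_def
    by (simp, intro smooth_on_vec_lambda smooth_on_sum smooth_on_mult smooth_on_const
        smooth_on_vec_nth)
qed

lemma open_invertible_sylvester: "open {S :: real^'n^'n. invertible (sylvester_matrix S)}"
proof -
  have "smooth_on UNIV (\<lambda>S :: real^'n^'n. det (sylvester_matrix S))"
    using smooth_on_sylvester_matrix by (rule smooth_on_det)
  then have "continuous_on UNIV (\<lambda>S :: real^'n^'n. det (sylvester_matrix S))"
    unfolding smooth_on_open_iff[OF open_UNIV] by (metis Ck_on.simps(1))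
  from open_Collect_neq[OF this continuous_on_const[of _ 0]] show ?thesis
    by (simp add: invertible_det_nz)
qed

lemma matrix_product_bound:
  obtains K where "K > 0" "\<And>(A :: real^'n^'n) (B :: real^'n^'n). norm (A ** B)
      \<le> norm A * norm B * K"
proof -
  have "bilinear ((**) :: real^'n^'n \<Rightarrow> real^'n^'n \<Rightarrow> _)"
    unfolding bilinear_def
    by (intro conjI allI linearI)
        (simp_all add: matrix_matrix_mult_def vec_eq_iff sum.distrib algebra_simps sum_distrib_left)
  then have "bounded_bilinear ((**) :: real^'n^'n \<Rightarrow> real^'n^'n \<Rightarrow> _)"
      by (simp add: bilinear_conv_bounded_bilinear)
  from bounded_bilinear.pos_bounded[OF this]
  obtain K where K: "K > 0 \<and> (\<forall>(A :: real^'n^'n) (B :: real^'n^'n). norm (A ** B)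
      \<le> norm A * norm B * K)" ..
  show ?thesis by (rule that[OF conjunct1[OF K] conjunct2[OF K, rule_format]])
qed

text \<open>
  Let \<open>S\<close> and \<open>T\<close> be the roots at \<open>A\<close> and \<open>B\<close>, \<open>D = T - S\<close>, and \<open>X\<close> the proposed first-order
  term. From \<open>S D + D T = H = S X + X S\<close>, where \<open>H\<close> is the symmetric part of \<open>B - A\<close>, one gets
  \<open>S (D - X) + (D - X) S = - D D\<close>. Coercivity bounds \<open>D\<close> by the first equation to first order in
  \<open>B - A\<close>, and then \<open>D - X\<close> by the second one to second order.
\<close>

lemma mat_sqrt_sym_part_has_derivative:
  fixes A :: "real^'n^'n"
  assumes A: "spd (sym_part A)"
  shows "((\<lambda>A. mat_sqrt (sym_part A)) has_derivative
    (\<lambda>V. sylvester_solution (mat_sqrt (sym_part A)) (sym_part V))) (at A)"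
  unfolding has_derivative_at_alt
proof (intro conjI allI impI)
  define S where "S = mat_sqrt (sym_part A)"
  have S: "spd S" "S ** S = sym_part A" unfolding S_def using mat_sqrt[OF A] by auto
  have l: "linear (\<lambda>V. sylvester_solution S (sym_part V))"
    using linear_compose[OF linear_sym_part linear_sylvester_solution, of S] by (simp add: o_def)
  then show "bounded_linear (\<lambda>V. sylvester_solution (mat_sqrt (sym_part A)) (sym_part V))"
    by (simp add: linear_conv_bounded_linear S_def)
  obtain c where c: "c > 0" "\<And>x. c * (norm x)\<^sup>2 \<le> x \<bullet> (S *v x)" using spd_lower_bound[OF S(1)]
      by blast
  obtain K where K: "K > 0" "\<And>(A :: real^'n^'n) (B :: real^'n^'n). norm (A ** B)
      \<le> norm A * norm B * K"
    by (rule matrix_product_bound) blast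
  obtain d where d: "d > 0" "\<forall>B. dist B A < d \<longrightarrow> spd (sym_part B)"
    using open_spd_sym_part[where 'n = 'n] A unfolding open_dist by auto
  fix e :: real assume e: "e > 0"
  show "\<exists>d>0. \<forall>B. norm (B - A) < d \<longrightarrow>
    norm (mat_sqrt (sym_part B) - mat_sqrt (sym_part A)
      - sylvester_solution (mat_sqrt (sym_part A)) (sym_part (B - A))) \<le> e * norm (B - A)"
    \<comment> \<open>The estimate below is \<open>|D - X| \<le> K |B - A|\<^sup>2 / c\<^sup>3\<close>; the radius makes this
      at most \<open>e |B - A|\<close>.\<close>
  proof (intro exI[of _ "min d (e * c ^ 3 / K)"] conjI allI impI)
    show "0 < min d (e * c ^ 3 / K)" using d e c K by simp
    fix B assume B: "norm (B - A) < min d (e * c ^ 3 / K)"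
    then have spB: "spd (sym_part B)" using d(2)[rule_format, of B] by (simp add: dist_norm)
    define T where "T = mat_sqrt (sym_part B)"
    have T: "spd T" "T ** T = sym_part B" unfolding T_def using mat_sqrt[OF spB] by auto
    define H where "H = sym_part (B - A)"
    define D where "D = T - S"
    define X where "X = sylvester_solution S H"
    have H: "H = T ** T - S ** S" unfolding H_def T S by (rule linear_diff[OF linear_sym_part])
    have "H = S ** D + D ** T" unfolding H D_def by (rule square_diff_eq_sylvester)
    then have "c * norm D \<le> norm H" using sylvester_coercive[OF c(2) T(1), of D] by simp
    also have "\<dots> \<le> norm (B - A)" unfolding H_def by (rule norm_sym_part_le)
    finally have nD: "norm D \<le> norm (B - A) / c" using c by (simp add: field_simps)
    have "S ** (D - X) + (D - X) ** S = - (D ** D)"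
    proof -
      have "S ** (D - X) + (D - X) ** S = (S ** D + D ** S) - (S ** X + X ** S)"
        by (simp add: matrix_mult_diff_distrib)
      also have "S ** X + X ** S = H" unfolding X_def by (rule sylvester_solution[OF S(1)])
      finally show ?thesis by (simp add: H D_def matrix_mult_diff_distrib)
    qed
    then have "c * norm (D - X) \<le> norm (D ** D)"
      using sylvester_coercive[OF c(2) S(1), of "D - X"] by simp
    also have "\<dots> \<le> norm D * norm D * K" by (rule K)
    also have "\<dots> \<le> (norm (B - A) / c) * (norm (B - A) / c) * K"
      using nD K c by (intro mult_right_mono mult_mono) auto
    finally have "norm (D - X) \<le> norm (B - A) * (norm (B - A) * K / c ^ 3)"
      using c by (simp add: field_simps power3_eq_cube)
    also have "\<dots> \<le> norm (B - A) * e"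
      using B c K by (intro mult_left_mono) (auto simp: field_simps)
    finally show "norm (mat_sqrt (sym_part B) - mat_sqrt (sym_part A)
      - sylvester_solution (mat_sqrt (sym_part A)) (sym_part (B - A))) \<le> e * norm (B - A)"
      by (simp add: D_def X_def H_def T_def S_def mult.commute)
  qed
qed

text \<open>
  Taking the symmetric part first extends the root to an open set of matrices. There the
  directional derivative is a smooth function of the root itself, so a \<open>C\<^sup>k\<close> root has \<open>C\<^sup>k\<close>
  derivatives and is \<open>C\<^sup>k\<^sup>+\<^sup>1\<close>.
\<close>

lemma smooth_on_mat_sqrt_sym_part:
  "smooth_on {A :: real^'n^'n. spd (sym_part A)} (\<lambda>A. mat_sqrt (sym_part A))"
proof -
  let ?O = "{A :: real^'n^'n. spd (sym_part A)}" and ?I =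
      "{S :: real^'n^'n. invertible (sylvester_matrix S)}"
  have sol: "Ck_on k ?I (\<lambda>S. sylvester_solution S V)" for k and V
    using smooth_on_sylvester_solution open_invertible_sylvester smooth_on_open_iff by blast
  have sub: "(\<lambda>A. mat_sqrt (sym_part A)) ` ?O \<subseteq> ?I"
    by (auto intro: invertible_sylvester_matrix spd_mat_sqrt)
  have "Ck_on k ?O (\<lambda>A. mat_sqrt (sym_part A))" for k
  proof (induction k)
    case 0
    have "continuous_on ?O (\<lambda>A. mat_sqrt (sym_part A))"
      using mat_sqrt_sym_part_has_derivative
      by (intro continuous_at_imp_continuous_on ballI has_derivative_continuous) blast
    then show ?case by simp
  next
    case (Suc k)
    show ?case
      by (rule Ck_on_SucI[OF open_spd_sym_part mat_sqrt_sym_part_has_derivative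
            Ck_on_compose[OF open_spd_sym_part open_invertible_sylvester sub sol Suc]]) simp
  qed
  then show ?thesis using smooth_on_open_iff[OF open_spd_sym_part] by blast
qed

lemma smooth_on_mat_sqrt:
  assumes "smooth_on S A" "\<And>x. x \<in> S \<Longrightarrow> spd (A x :: real^'n^'n)"
  shows "smooth_on S (\<lambda>x. mat_sqrt (A x))"
proof (rule smooth_on_cong)
  have sp: "sym_part (A x) = A x" if "x \<in> S" for x using spdD(1)[OF assms(2)[OF that]]
      by (rule sym_part_symmetric)
  show "smooth_on S (\<lambda>x. mat_sqrt (sym_part (A x)))"
    by (rule smooth_on_compose[OF smooth_on_mat_sqrt_sym_part assms(1)]) (use assms sp in auto)
  show "mat_sqrt (sym_part (A x)) = mat_sqrt (A x)" if "x \<in> S" for x using sp[OF that] by simp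
qed

lemma smooth_on_mat_inv_sqrt:
  assumes "smooth_on S A" "\<And>x. x \<in> S \<Longrightarrow> spd (A x :: real^'n^'n)"
  shows "smooth_on S (\<lambda>x. mat_inv_sqrt (A x))"
  unfolding mat_inv_sqrt_def
  by (intro smooth_on_matrix_inv smooth_on_mat_sqrt assms spd_invertible spd_mat_sqrt)

section \<open>Strict convexity of the energy\<close>

lemma trace_congruence:
  fixes F :: "real^'n^'m" and W :: "real^'n^'n"
  shows "trace (F ** W ** transpose F) = (\<Sum>i\<in>UNIV. F $ i \<bullet> (W *v F $ i))"
proof -
  have "(F ** W ** transpose F) $ i $ i = F $ i \<bullet> (W *v F $ i)" for i
    unfolding matrix_mul_assoc[symmetric]
    by (simp add: matrix_matrix_mult_def inner_vec_def matrix_vector_mult_def transpose_def)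
  then show ?thesis by (simp add: trace_def)
qed

lemma quadratic_form_convex_combination:
  fixes W :: "real^'n^'n"
  assumes "transpose W = W"
  shows "((1 - s) *\<^sub>R a + s *\<^sub>R b) \<bullet> (W *v ((1 - s) *\<^sub>R a + s *\<^sub>R b)) =
    (1 - s) * (a \<bullet> (W *v a)) + s * (b \<bullet> (W *v b)) - s * (1 - s) * ((a - b) \<bullet> (W *v (a - b)))"
proof -
  have e: "b \<bullet> (W *v a) = a \<bullet> (W *v b)"
    using symmetric_inner[OF assms, of a b] by (simp add: inner_commute)
  show ?thesis
    by (simp only: linear_matrix_vector inner_add_left inner_add_right inner_diff_left
        inner_diff_right
      inner_scaleR_left inner_scaleR_right e) algebra
qed

text \<open>
  The two sides differ by the quadratic form of \<open>W\<close> at \<open>f - S z\<close>. Equality holds for \<open>z = W f\<close>,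
  so the right-hand side is a supremum over \<open>z\<close> of functions affine in \<open>(f, S)\<close>; this is the
  source of its joint convexity.
\<close>

lemma inverse_quadratic_form_dual:
  fixes S W :: "real^'n^'n"
  assumes S: "spd S" and W: "spd W" and inv: "W ** S = mat 1"
  shows "2 * (z \<bullet> f) - z \<bullet> (S *v z) \<le> f \<bullet> (W *v f)"
proof -
  have WS: "W *v (S *v z) = z" by (simp add: matrix_vector_mul_assoc inv)
  have c: "(S *v z) \<bullet> (W *v f) = z \<bullet> f"
    using symmetric_inner[OF spdD(1)[OF W], of "S *v z" f] WS by simp
  have "0 \<le> (f - S *v z) \<bullet> (W *v (f - S *v z))" by (rule spdD(3)[OF W])
  also have "\<dots> = f \<bullet> (W *v f) - 2 * (z \<bullet> f) + z \<bullet> (S *v z)"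
    by (simp add: linear_matrix_vector inner_diff_left inner_diff_right WS c
        inner_commute[of f z] inner_commute[of "S *v z" z])
  finally show ?thesis by simp
qed

text \<open>
  The affine bound that is sharp for the mixed pair is compared with the values at the two given
  pairs; replacing \<open>S\<close> by the mixture of \<open>S1\<close> and \<open>S2\<close> can only increase it.
\<close>

lemma inverse_quadratic_form_convex:
  fixes S S1 S2 :: "real^'n^'n"
  assumes spd: "spd S" "spd S1" "spd S2" and s: "0 < s" "s < 1"
    and concave: "\<And>x. (1 - s) * (x \<bullet> (S1 *v x)) + s * (x \<bullet> (S2 *v x)) \<le> x \<bullet> (S *v x)"
  shows "((1 - s) *\<^sub>R f + s *\<^sub>R g) \<bullet> (matrix_inv S *v ((1 - s) *\<^sub>R f + s *\<^sub>R g)) \<le>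
    (1 - s) * (f \<bullet> (matrix_inv S1 *v f)) + s * (g \<bullet> (matrix_inv S2 *v g))"
proof -
  note inv = matrix_inv_mult[OF spd_invertible]
  let ?h = "(1 - s) *\<^sub>R f + s *\<^sub>R g"
  define z where "z = matrix_inv S *v ?h"
  have Sz: "S *v z = ?h" unfolding z_def by (simp add: matrix_vector_mul_assoc inv(1)[OF spd(1)])
  have "?h \<bullet> (matrix_inv S *v ?h) = 2 * (z \<bullet> ?h) - z \<bullet> (S *v z)"
    unfolding Sz by (simp add: z_def[symmetric] inner_commute[of ?h z])
  also have "\<dots> \<le> (1 - s) * (2 * (z \<bullet> f) - z \<bullet> (S1 *v z)) + s * (2 * (z \<bullet> g) - z \<bullet> (S2 *v z))"
    using concave[of z] by (simp add: inner_add_right algebra_simps)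
  also have "\<dots> \<le> (1 - s) * (f \<bullet> (matrix_inv S1 *v f)) + s * (g \<bullet> (matrix_inv S2 *v g))"
    using s by (intro add_mono mult_left_mono inverse_quadratic_form_dual spd spd_matrix_inv
        inv(2)) auto
  finally show ?thesis .
qed

text \<open>For the deformation gradient and the tensor \<open>Y\<close> of a state this is the trace of \<open>C\<close>.\<close>

definition conformation_trace :: "real^'n^'n \<Rightarrow> real^'n^'n \<Rightarrow> real" where
  "conformation_trace F Y = trace (F ** mat_inv_sqrt Y ** transpose F)"

lemma conformation_trace_rows:
  "conformation_trace F Y = (\<Sum>i\<in>UNIV. F $ i \<bullet> (mat_inv_sqrt Y *v F $ i))"
  unfolding conformation_trace_def by (rule trace_congruence)

lemma conformation_trace_convex:
  fixes F G Y Z :: "real^'n^'n"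
  assumes "spd Y" "spd Z" and s: "0 < s" "s < 1"
  shows "conformation_trace ((1 - s) *\<^sub>R F + s *\<^sub>R G) ((1 - s) *\<^sub>R Y + s *\<^sub>R Z) \<le>
    (1 - s) * conformation_trace F Y + s * conformation_trace G Z"
proof -
  have spd: "spd ((1 - s) *\<^sub>R Y + s *\<^sub>R Z)" using assms by (intro spd_add spd_scaleR) auto
  show ?thesis
    unfolding conformation_trace_rows sum_distrib_left sum.distrib[symmetric] mat_inv_sqrt_def
      vector_add_component vector_scaleR_component
    by (intro sum_mono inverse_quadratic_form_convex spd_mat_sqrt spd assms
        mat_sqrt_operator_concave)
qed

text \<open>For fixed \<open>Y\<close> this is a positive definite quadratic form in \<open>F\<close>.\<close>

lemma conformation_trace_strictly_convex:
  fixes F G Y :: "real^'n^'n"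
  assumes Y: "spd Y" and s: "0 < s" "s < 1" and "F \<noteq> G"
  shows "conformation_trace ((1 - s) *\<^sub>R F + s *\<^sub>R G) Y <
    (1 - s) * conformation_trace F Y + s * conformation_trace G Y"
proof -
  let ?W = "mat_inv_sqrt Y"
  note W = spd_mat_inv_sqrt[OF Y]
  have "conformation_trace ((1 - s) *\<^sub>R F + s *\<^sub>R G) Y =
    (1 - s) * conformation_trace F Y + s * conformation_trace G Y
    - s * (1 - s) * (\<Sum>i\<in>UNIV. (F $ i - G $ i) \<bullet> (?W *v (F $ i - G $ i)))"
    by (simp only: conformation_trace_rows vector_add_component vector_scaleR_component
      quadratic_form_convex_combination[OF spdD(1)[OF W]] sum.distrib sum_subtractf
          sum_distrib_left)
  moreover have "(\<Sum>i\<in>UNIV. (F $ i - G $ i) \<bullet> (?W *v (F $ i - G $ i))) > 0"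
  proof -
    obtain i where "F $ i \<noteq> G $ i" using \<open>F \<noteq> G\<close> by (auto simp: vec_eq_iff)
    then show ?thesis
      by (intro sum_pos2[of _ i]) (auto intro: spdD(2)[OF W] spdD(3)[OF W])
  qed
  ultimately show ?thesis using s by simp
qed

lemma norm_square_convex:
  fixes a b :: "'a::real_inner"
  assumes "0 < s" "s < 1"
  shows "(norm ((1 - s) *\<^sub>R a + s *\<^sub>R b))\<^sup>2 \<le> (1 - s) * (norm a)\<^sup>2 + s * (norm b)\<^sup>2"
    and "a \<noteq> b \<Longrightarrow> (norm ((1 - s) *\<^sub>R a + s *\<^sub>R b))\<^sup>2 < (1 - s) * (norm a)\<^sup>2 + s * (norm b)\<^sup>2"
  using assms by (simp_all add: norm_convex_combination_square)

text \<open>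
  Both parts compare \<open>ln\<close> with its tangent at the mean \<open>z\<close>, in the form
  \<open>ln (x / z) \<le> x / z - 1\<close>.
\<close>

lemma ln_concave:
  fixes x y :: real
  assumes "x > 0" "y > 0" "0 < s" "s < 1"
  shows "(1 - s) * ln x + s * ln y \<le> ln ((1 - s) * x + s * y)" (is ?le)
    and "x \<noteq> y \<Longrightarrow> (1 - s) * ln x + s * ln y < ln ((1 - s) * x + s * y)"
proof -
  define z where "z = (1 - s) * x + s * y"
  have z: "z > 0" unfolding z_def using assms by (intro add_pos_pos mult_pos_pos) auto
  have "ln (x / z) \<le> x / z - 1" "ln (y / z) \<le> y / z - 1"
    using assms z by (auto intro!: ln_le_minus_one)
  then have le: "ln x - ln z \<le> x / z - 1" "ln y - ln z \<le> y / z - 1" using assms z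
      by (simp_all add: ln_div)
  have sum: "(1 - s) * (x / z - 1) + s * (y / z - 1) = 0"
  proof -
    have "(1 - s) * (x / z - 1) + s * (y / z - 1) = ((1 - s) * x + s * y) / z - 1"
      using z by (simp add: field_simps)
    then show ?thesis using z by (simp add: z_def[symmetric])
  qed
  have "(1 - s) * (ln x - ln z) + s * (ln y - ln z) \<le> 0"
    unfolding sum[symmetric] using le assms by (intro add_mono mult_left_mono) auto
  then show ?le unfolding z_def[symmetric] by (simp add: algebra_simps)
  show "(1 - s) * ln x + s * ln y < ln ((1 - s) * x + s * y)" if "x \<noteq> y"
  proof -
    have "x \<noteq> z"
    proof
      assume "x = z"
      moreover have "s * (y - x) = z - x" by (simp add: z_def algebra_simps)
      ultimately have "s * (y - x) = 0" by simp
      then show False using that assms by auto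
    qed
    then have "ln (x / z) \<noteq> x / z - 1" using ln_eq_minus_one[of "x / z"] assms z by auto
    then have "ln x - ln z < x / z - 1" using le(1) assms z by (simp add: ln_div)
    then have "(1 - s) * (ln x - ln z) + s * (ln y - ln z) < 0"
      unfolding sum[symmetric] using le assms
          by (intro add_less_le_mono mult_left_mono mult_strict_left_mono) auto
    then show ?thesis unfolding z_def[symmetric] by (simp add: algebra_simps)
  qed
qed

lemma exp_convex:
  fixes a b :: real
  assumes "0 < s" "s < 1"
  shows "exp ((1 - s) * a + s * b) \<le> (1 - s) * exp a + s * exp b"
    and "a \<noteq> b \<Longrightarrow> exp ((1 - s) * a + s * b) < (1 - s) * exp a + s * exp b"
proof -
  have p: "(1 - s) * exp a + s * exp b > 0" using assms by (intro add_pos_pos mult_pos_pos) auto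
  show "exp ((1 - s) * a + s * b) \<le> (1 - s) * exp a + s * exp b"
    using ln_concave(1)[of "exp a" "exp b" s] assms p by (simp add: ln_ge_iff)
  show "a \<noteq> b \<Longrightarrow> exp ((1 - s) * a + s * b) < (1 - s) * exp a + s * exp b"
    using ln_concave(2)[of "exp a" "exp b" s] assms p
        by (metis exp_inj_iff exp_ln exp_less_cancel_iff exp_gt_zero ln_exp)
qed

lemma state_projections:
  "\<rho>_of u = fst u" "\<eta>_of u = fst (snd u) / fst u" "j_of u = fst (snd (snd u)) /\<^sub>R fst u"
  "v_of u = fst (snd (snd (snd u))) /\<^sub>R fst u" "F_of u = fst (snd (snd (snd (snd u)))) /\<^sub>R fst u"
  "Y_of u = fst (snd (snd (snd (snd (snd u))))) /\<^sub>R fst u"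
      "y_of u = snd (snd (snd (snd (snd (snd u))))) / fst u"
  by (cases u rule: \<rho>_of.cases; simp)+

text \<open>
  The perspective trick. When conserved quantities are mixed with weight \<open>t\<close>, the quantities per
  unit mass are mixed with the mass fraction \<open>s\<close>, and so is the specific volume \<open>1 / r\<close>.
\<close>

lemma perspective_weight:
  fixes a b :: "'a::real_vector" and r1 r2 t :: real
  assumes "0 < r1" "0 < r2" "0 < t" "t < 1"
  defines "r \<equiv> (1 - t) * r1 + t * r2"
  defines "s \<equiv> t * r2 / r"
  shows "0 < r" "0 < s" "s < 1" "r * (1 - s) = (1 - t) * r1" "r * s = t * r2"
    and "((1 - t) *\<^sub>R a + t *\<^sub>R b) /\<^sub>R r = (1 - s) *\<^sub>R (a /\<^sub>R r1) + s *\<^sub>R (b /\<^sub>R r2)"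
    and "inverse r = (1 - s) * inverse r1 + s * inverse r2"
proof -
  show r: "0 < r" unfolding r_def using assms by (intro add_pos_pos mult_pos_pos) auto
  show rs: "r * s = t * r2" using r by (simp add: s_def)
  then show rs': "r * (1 - s) = (1 - t) * r1" by (simp add: r_def algebra_simps)
  show "0 < s" using r assms by (simp add: s_def)
  have "0 < r * (1 - s)" unfolding rs' using assms by simp
  then show "s < 1" using r by (simp add: zero_less_mult_iff)
  have s: "s = t * r2 * inverse r" "1 - s = (1 - t) * r1 * inverse r"
    using rs rs' r by (simp_all add: field_simps)
  have c: "(1 - s) * inverse r1 = (1 - t) * inverse r" "s * inverse r2 = t * inverse r"
    using assms(1,2) by (simp_all add: s(2), simp add: s(1))
  then show "((1 - t) *\<^sub>R a + t *\<^sub>R b) /\<^sub>R r = (1 - s) *\<^sub>R (a /\<^sub>R r1) + s *\<^sub>R (b /\<^sub>R r2)"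
    by (simp add: scaleR_add_right mult.commute)
  show "inverse r = (1 - s) * inverse r1 + s * inverse r2"
    unfolding c by (simp add: algebra_simps)
qed

text \<open>
  A convex set that contains the convex hull of the admissible states: invertibility of \<open>F\<close> is
  the only admissibility condition that is lost under convex combinations.
\<close>

definition relaxed_states :: "state set" where
  "relaxed_states = {u. 0 < \<rho>_of u \<and> spd (Y_of u) \<and> 0 < y_of u}"

lemma admissible_imp_relaxed: "admissible_states \<subseteq> relaxed_states"
  by (auto simp: admissible_states_def relaxed_states_def)

lemma primitive_convex_combination:
  fixes u w :: state
  assumes u: "u \<in> relaxed_states" and w: "w \<in> relaxed_states" and t: "0 < t" "t < 1"
  defines "z \<equiv> (1 - t) *\<^sub>R u + t *\<^sub>R w"
  obtains s where "0 < s" "s < 1" "\<rho>_of z > 0"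
    "\<rho>_of z * (1 - s) = (1 - t) * \<rho>_of u" "\<rho>_of z * s = t * \<rho>_of w"
    "inverse (\<rho>_of z) = (1 - s) * inverse (\<rho>_of u) + s * inverse (\<rho>_of w)"
    "\<eta>_of z = (1 - s) * \<eta>_of u + s * \<eta>_of w"
    "j_of z = (1 - s) *\<^sub>R j_of u + s *\<^sub>R j_of w"
    "v_of z = (1 - s) *\<^sub>R v_of u + s *\<^sub>R v_of w"
    "F_of z = (1 - s) *\<^sub>R F_of u + s *\<^sub>R F_of w"
    "Y_of z = (1 - s) *\<^sub>R Y_of u + s *\<^sub>R Y_of w"
    "y_of z = (1 - s) * y_of u + s * y_of w"
proof -
  have r: "0 < fst u" "0 < fst w" using u w by (auto simp: relaxed_states_def state_projections)
  have zr: "fst z = (1 - t) * fst u + t * fst w" by (simp add: z_def)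
  note p = perspective_weight[OF r t, folded zr]
  have sc: "((1 - t) * a + t * b) / fst z = (1 - t * fst w / fst z) * (a / fst u)
      + t * fst w / fst z * (b / fst w)" for a b :: real
    using p(6)[of a b] by (simp add: divide_inverse mult_ac)
  show ?thesis
    by (rule that[of "t * fst w / fst z"])
      (use p in \<open>simp_all only: state_projections z_def fst_add snd_add fst_scaleR snd_scaleR
        real_scaleR_def sc[unfolded z_def fst_add snd_add fst_scaleR snd_scaleR real_scaleR_def]\<close>)
qed

lemma convex_relaxed_states: "convex relaxed_states"
  unfolding convex_alt
proof (intro ballI allI impI)
  fix u w :: state and t :: real
  assume uw: "u \<in> relaxed_states" "w \<in> relaxed_states" and t: "0 \<le> t \<and> t \<le> 1"
  show "(1 - t) *\<^sub>R u + t *\<^sub>R w \<in> relaxed_states"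
  proof (cases "t = 0 \<or> t = 1")
    case False
    then have t: "0 < t" "t < 1" using t by auto
    let ?z = "(1 - t) *\<^sub>R u + t *\<^sub>R w"
    obtain s where s: "0 < s" "s < 1" "\<rho>_of ?z > 0" "Y_of ?z = (1 - s) *\<^sub>R Y_of u + s *\<^sub>R Y_of w"
      "y_of ?z = (1 - s) * y_of u + s * y_of w"
      by (rule primitive_convex_combination[OF uw t]) blast
    then show ?thesis using uw
      by (auto simp: relaxed_states_def intro!: spd_add spd_scaleR add_pos_pos)
  qed (use uw in auto)
qed

locale polytropic_material =
  fixes m :: material and cV \<theta>ref \<rho>ref \<gamma> :: real
  assumes pos: "0 < alpha m" "0 < K0 m" "0 < K1 m" "0 < kB m" "0 < tau0 m" "0 < kappa m"
    "0 < rhoR m" "0 < eref m" "1 < \<gamma>" "0 < cV" "0 < \<theta>ref" "0 < \<rho>ref"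
    and es_polytropic: "es m = polytropic cV \<theta>ref \<rho>ref \<gamma>"
begin

abbreviation tr_C :: "state \<Rightarrow> real" where
  "tr_C u \<equiv> conformation_trace (F_of u) (Y_of u)"

text \<open>
  The logarithm of the volumetric energy. Written in terms of \<open>1 / \<rho>\<close>, \<open>\<eta>\<close>, \<open>F\<close>, \<open>Y\<close> and \<open>y\<close> it
  is a sum of convex functions, which is where the polytropic law enters.
\<close>

definition log_energy :: "state \<Rightarrow> real" where
  "log_energy u = (ln (cV * \<theta>ref) - (\<gamma> - 1) * ln \<rho>ref - alpha m * kB m / cV * ln (rhoR m)) +
    (\<gamma> - 1 + alpha m * kB m / cV) * ln (\<rho>_of u) + \<eta>_of u / cV +
    alpha m * K1 m / (2 * cV) * tr_C u - alpha m * kB m / (4 * cV) * ln (y_of u)"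

lemma es_tilde_eq_exp:
  assumes "0 < \<rho>_of u" "0 < y_of u"
  shows "es_tilde m u = exp (log_energy u)"
proof -
  have "ln ((rhoR m / \<rho>_of u)\<^sup>2 * sqrt (y_of u)) = 2 * (ln (rhoR m) - ln (\<rho>_of u))
      + ln (y_of u) / 2"
    using assms pos by (simp add: ln_mult ln_realpow ln_div ln_sqrt)
  moreover have "(\<rho>_of u / \<rho>ref) powr (\<gamma> - 1) = exp ((\<gamma> - 1) * (ln (\<rho>_of u) - ln \<rho>ref))"
    using assms pos by (simp add: powr_def ln_div)
  moreover have "cV * \<theta>ref = exp (ln (cV * \<theta>ref))" using pos by simp
  ultimately have "es_tilde m u = exp (ln (cV * \<theta>ref) + (\<gamma> - 1) * (ln (\<rho>_of u) - ln \<rho>ref) +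
    (\<eta>_of u + alpha m / 2 *
        (K1 m * tr_C u - kB m * (2 * (ln (rhoR m) - ln (\<rho>_of u)) + ln (y_of u) / 2))) / cV)"
    unfolding es_tilde_def es_polytropic polytropic_def conformation_trace_def exp_add by metis
  also have "\<dots> = exp (log_energy u)"
    unfolding log_energy_def using pos by (intro arg_cong[of _ _ exp]) (simp add: field_simps)
  finally show ?thesis .
qed

text \<open>
  By the perspective trick it suffices that the specific energy is strictly convex in \<open>1 / \<rho>\<close>
  and the primitive fields. Each summand is convex, and for two different states at least one of
  them is strictly convex between them: the quadratic terms if \<open>v\<close>, \<open>j\<close> or \<open>Y\<close> differ, the
  elastic term if \<open>F\<close> differs at equal \<open>Y\<close>, and the exponential of \<open>log_energy\<close> otherwise. In
  the last case either the exponent is strictly convex, because \<open>\<rho>\<close> or \<open>y\<close> differs, or the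
  exponents at the two states differ, because only \<open>\<eta>\<close> does.
\<close>

lemma energy_strictly_convex:
  "strictly_convex_on relaxed_states (\<lambda>u. \<rho>_of u * E_tilde m u)"
  unfolding strictly_convex_on_def
proof (intro conjI convex_relaxed_states ballI allI impI)
  fix u w :: state and t :: real
  assume u: "u \<in> relaxed_states" and w: "w \<in> relaxed_states" and "u \<noteq> w \<and> 0 < t \<and> t < 1"
  then have uw: "u \<noteq> w" and t: "0 < t" "t < 1" by auto
  define z where "z = (1 - t) *\<^sub>R u + t *\<^sub>R w"
  have z: "z \<in> relaxed_states"
    unfolding z_def using convex_relaxed_states u w t by (simp add: convex_alt)
  obtain s where s: "0 < s" "s < 1" and zr: "\<rho>_of z > 0"
    and weights: "\<rho>_of z * (1 - s) = (1 - t) * \<rho>_of u" "\<rho>_of z * s = t * \<rho>_of w"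
    and \<tau>: "inverse (\<rho>_of z) = (1 - s) * inverse (\<rho>_of u) + s * inverse (\<rho>_of w)"
    and \<eta>: "\<eta>_of z = (1 - s) * \<eta>_of u + s * \<eta>_of w"
    and j: "j_of z = (1 - s) *\<^sub>R j_of u + s *\<^sub>R j_of w"
    and v: "v_of z = (1 - s) *\<^sub>R v_of u + s *\<^sub>R v_of w"
    and F: "F_of z = (1 - s) *\<^sub>R F_of u + s *\<^sub>R F_of w"
    and Y: "Y_of z = (1 - s) *\<^sub>R Y_of u + s *\<^sub>R Y_of w"
    and y: "y_of z = (1 - s) * y_of u + s * y_of w"
    by (rule primitive_convex_combination[OF u w t, folded z_def]) blast
  have uP: "\<rho>_of u > 0" "spd (Y_of u)" "y_of u > 0" and wP: "\<rho>_of w > 0" "spd (Y_of w)" "y_of w > 0"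
    and zP: "y_of z > 0"
    using u w z by (auto simp: relaxed_states_def)
  define mix where "mix a b = (1 - s) * a + s * b" for a b :: real
  note sq = norm_square_convex[OF s, folded mix_def]
  have tr: "tr_C z \<le> mix (tr_C u) (tr_C w)"
    unfolding F Y mix_def by (rule conformation_trace_convex[OF uP(2) wP(2) s])
  have tr_strict: "tr_C z < mix (tr_C u) (tr_C w)" if "Y_of u = Y_of w" "F_of u \<noteq> F_of w"
  proof -
    have "Y_of z = Y_of u" using that(1) by (simp add: Y algebra_simps)
    then show ?thesis unfolding F mix_def
      using conformation_trace_strictly_convex[OF uP(2) s that(2)] that(1) by simp
  qed
  have ln_r: "ln (\<rho>_of z) \<le> mix (ln (\<rho>_of u)) (ln (\<rho>_of w))"
    using ln_concave(1)[of "inverse (\<rho>_of u)" "inverse (\<rho>_of w)" s] uP wP s zr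
    by (simp add: \<tau>[symmetric] ln_inverse mix_def)
  have ln_r_strict: "ln (\<rho>_of z) < mix (ln (\<rho>_of u)) (ln (\<rho>_of w))" if "\<rho>_of u \<noteq> \<rho>_of w"
    using ln_concave(2)[of "inverse (\<rho>_of u)" "inverse (\<rho>_of w)" s] uP wP s zr that
    by (simp add: \<tau>[symmetric] ln_inverse mix_def)
  have ln_y: "mix (ln (y_of u)) (ln (y_of w)) \<le> ln (y_of z)"
    unfolding y mix_def by (rule ln_concave(1)[OF uP(3) wP(3) s])
  have ln_y_strict: "mix (ln (y_of u)) (ln (y_of w)) < ln (y_of z)" if "y_of u \<noteq> y_of w"
    unfolding y mix_def by (rule ln_concave(2)[OF uP(3) wP(3) s that])
  define c0 where "c0 = ln (cV * \<theta>ref) - (\<gamma> - 1) * ln \<rho>ref - alpha m * kB m / cV * ln (rhoR m)"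
  define a where "a = \<gamma> - 1 + alpha m * kB m / cV"
  define b where "b = alpha m * K1 m / (2 * cV)"
  define c where "c = alpha m * kB m / (4 * cV)"
  have abc: "a > 0" "b > 0" "c > 0" unfolding a_def b_def c_def using pos
      by (auto intro: add_pos_pos)
  have log: "log_energy q = c0 + a * ln (\<rho>_of q) + \<eta>_of q / cV + b * tr_C q - c * ln (y_of q)" for q
    by (simp add: log_energy_def a_def b_def c_def c0_def)
  define L where "L = mix (log_energy u) (log_energy w)"
  have L: "L - log_energy z = a * (mix (ln (\<rho>_of u)) (ln (\<rho>_of w)) - ln (\<rho>_of z)) +
      b * (mix (tr_C u) (tr_C w) - tr_C z) + c * (ln (y_of z) - mix (ln (y_of u)) (ln (y_of w)))"
    by (simp add: L_def log \<eta> mix_def algebra_simps add_divide_distrib diff_divide_distrib)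
  have d: "0 \<le> a * (mix (ln (\<rho>_of u)) (ln (\<rho>_of w)) - ln (\<rho>_of z))"
    "0 \<le> b * (mix (tr_C u) (tr_C w) - tr_C z)"
        "0 \<le> c * (ln (y_of z) - mix (ln (y_of u)) (ln (y_of w)))"
    using ln_r ln_y tr abc by simp_all
  have es: "es_tilde m u = exp (log_energy u)" "es_tilde m w = exp (log_energy w)"
      "es_tilde m z = exp (log_energy z)"
    using uP wP zP zr by (simp_all add: es_tilde_eq_exp)
  have exp_L: "exp L \<le> mix (es_tilde m u) (es_tilde m w)"
    "log_energy u \<noteq> log_energy w \<Longrightarrow> exp L < mix (es_tilde m u) (es_tilde m w)"
    unfolding es L_def mix_def using exp_convex[OF s] by auto
  have zL: "es_tilde m z \<le> exp L" using L d by (simp add: es)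
  have es_le: "es_tilde m z \<le> mix (es_tilde m u) (es_tilde m w)" using zL exp_L(1) by linarith
  have es_strict_L: "es_tilde m z < mix (es_tilde m u) (es_tilde m w)" if "log_energy z < L"
    using that exp_L(1) unfolding es by (metis exp_less_cancel_iff order_less_le_trans)
  have es_strict: "es_tilde m z < mix (es_tilde m u) (es_tilde m w)"
    if ne: "\<rho>_of u \<noteq> \<rho>_of w \<or> y_of u \<noteq> y_of w
        \<or> (\<eta>_of u \<noteq> \<eta>_of w \<and> Y_of u = Y_of w \<and> F_of u = F_of w)"
  proof -
    consider "\<rho>_of u \<noteq> \<rho>_of w" | "y_of u \<noteq> y_of w"
      | "\<rho>_of u = \<rho>_of w" "y_of u = y_of w" "\<eta>_of u \<noteq> \<eta>_of w" "Y_of u = Y_of w" "F_of u = F_of w"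
      using ne by blast
    then show ?thesis
    proof cases
      case 1
      then have "0 < a * (mix (ln (\<rho>_of u)) (ln (\<rho>_of w)) - ln (\<rho>_of z))" using ln_r_strict abc
          by simp
      then show ?thesis using L d by (intro es_strict_L) linarith
    next
      case 2
      then have "0 < c * (ln (y_of z) - mix (ln (y_of u)) (ln (y_of w)))" using ln_y_strict abc
          by simp
      then show ?thesis using L d by (intro es_strict_L) linarith
    next
      case 3
      then have "log_energy u \<noteq> log_energy w" using pos by (simp add: log)
      then show ?thesis using zL exp_L(2) by linarith
    qed
  qed
  define kj kt ke where "kj = tau0 m / (2 * kappa m)" and "kt = alpha m / 2 * K0 m"
      and "ke = eref m / 2"
  have k: "kj > 0" "kt > 0" "ke > 0" unfolding kj_def kt_def ke_def using pos by auto
  have E: "E_tilde m q = (norm (v_of q))\<^sup>2 / 2 + es_tilde m q + kj * (norm (j_of q))\<^sup>2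
      + kt * tr_C q + ke * (norm (Y_of q))\<^sup>2" for q
    by (simp add: E_tilde_def conformation_trace_def kj_def kt_def ke_def)
  define gv ge gj gt gY where "gv
      = (mix ((norm (v_of u))\<^sup>2) ((norm (v_of w))\<^sup>2) - (norm (v_of z))\<^sup>2) / 2"
    and "ge = mix (es_tilde m u) (es_tilde m w) - es_tilde m z"
    and "gj = kj * (mix ((norm (j_of u))\<^sup>2) ((norm (j_of w))\<^sup>2) - (norm (j_of z))\<^sup>2)"
    and "gt = kt * (mix (tr_C u) (tr_C w) - tr_C z)"
    and "gY = ke * (mix ((norm (Y_of u))\<^sup>2) ((norm (Y_of w))\<^sup>2) - (norm (Y_of z))\<^sup>2)"
  note g_defs = gv_def ge_def gj_def gt_def gY_def
  have gap: "mix (E_tilde m u) (E_tilde m w) - E_tilde m z = gv + ge + gj + gt + gY"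
    by (simp add: E mix_def g_defs field_simps)
  have g: "0 \<le> gv" "0 \<le> ge" "0 \<le> gj" "0 \<le> gt" "0 \<le> gY"
    using sq(1)[of "v_of u" "v_of w"] sq(1)[of "j_of u" "j_of w"] sq(1)[of "Y_of u"
        "Y_of w"] tr k es_le
    by (simp_all add: g_defs v[symmetric] j[symmetric] Y[symmetric])
  have "E_tilde m z < mix (E_tilde m u) (E_tilde m w)"
  proof -
    consider "v_of u \<noteq> v_of w" | "j_of u \<noteq> j_of w" | "Y_of u \<noteq> Y_of w" | "Y_of u = Y_of w"
        "F_of u \<noteq> F_of w"
      | "\<rho>_of u \<noteq> \<rho>_of w \<or> y_of u \<noteq> y_of w \<or> (\<eta>_of u \<noteq> \<eta>_of w \<and> Y_of u = Y_of w \<and> F_of u = F_of w)"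
    proof -
      have "v_of u \<noteq> v_of w \<or> j_of u \<noteq> j_of w \<or> Y_of u \<noteq> Y_of w \<or> F_of u \<noteq> F_of w \<or>
        \<rho>_of u \<noteq> \<rho>_of w \<or> y_of u \<noteq> y_of w \<or> \<eta>_of u \<noteq> \<eta>_of w"
      proof (rule ccontr)
        assume "\<not> ?thesis"
        then have "u = w" using uP(1)
          by (cases u rule: \<rho>_of.cases; cases w rule: \<rho>_of.cases) simp
        then show False using uw by blast
      qed
      then show ?thesis using that by blast
    qed
    then show ?thesis
    proof cases
      case 1
      then have "0 < gv" using sq(2)[of "v_of u" "v_of w"] by (simp add: v gv_def)
      then show ?thesis using gap g by linarith
    next
      case 2
      then have "0 < gj" using sq(2)[of "j_of u" "j_of w"] k by (simp add: j gj_def)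
      then show ?thesis using gap g by linarith
    next
      case 3
      then have "0 < gY" using sq(2)[of "Y_of u" "Y_of w"] k by (simp add: Y gY_def)
      then show ?thesis using gap g by linarith
    next
      case 4
      then have "0 < gt" using tr_strict k by (simp add: gt_def)
      then show ?thesis using gap g by linarith
    next
      case 5
      then have "0 < ge" using es_strict by (simp add: ge_def)
      then show ?thesis using gap g by linarith
    qed
  qed
  then have "\<rho>_of z * E_tilde m z < \<rho>_of z * mix (E_tilde m u) (E_tilde m w)" using zr by simp
  also have "\<dots> = (\<rho>_of z * (1 - s)) * E_tilde m u + (\<rho>_of z * s) * E_tilde m w"
    by (simp add: mix_def algebra_simps)
  also have "\<dots> = ((1 - t) * \<rho>_of u) * E_tilde m u + (t * \<rho>_of w) * E_tilde m w"
      by (simp only: weights)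
  finally show "\<rho>_of z * E_tilde m z < (1 - t) * (\<rho>_of u * E_tilde m u)
      + t * (\<rho>_of w * E_tilde m w)"
    by (simp add: mult.assoc)
qed

end

lemma strictly_convex_on_subset:
  "strictly_convex_on T f \<Longrightarrow> S \<subseteq> T \<Longrightarrow> convex S \<Longrightarrow> strictly_convex_on S f"
  unfolding strictly_convex_on_def by blast

section \<open>Smooth dependence on the state\<close>

lemma smooth_on_primitive_fields:
  "smooth_on relaxed_states \<rho>_of" "smooth_on relaxed_states \<eta>_of" "smooth_on relaxed_states j_of"
  "smooth_on relaxed_states v_of" "smooth_on relaxed_states F_of" "smooth_on relaxed_states Y_of"
  "smooth_on relaxed_states y_of"
proof -
  note l = smooth_on_fst smooth_on_snd smooth_on_ident
  have i: "smooth_on relaxed_states (\<lambda>u :: state. inverse (fst u))"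
    by (rule smooth_on_compose[OF smooth_on_inverse_real])
      (auto intro!: l simp: relaxed_states_def state_projections)
  show "smooth_on relaxed_states \<rho>_of" "smooth_on relaxed_states \<eta>_of"
      "smooth_on relaxed_states j_of"
    "smooth_on relaxed_states v_of" "smooth_on relaxed_states F_of" "smooth_on relaxed_states Y_of"
    "smooth_on relaxed_states y_of"
    unfolding state_projections[abs_def] divide_inverse
    by (intro smooth_on_mult smooth_on_scaleR i l)+
qed

lemma smooth_on_conformation_trace:
    "smooth_on relaxed_states (\<lambda>u. conformation_trace (F_of u) (Y_of u))"
  unfolding conformation_trace_def
  by (intro smooth_on_trace smooth_on_matrix_mult smooth_on_transpose smooth_on_mat_inv_sqrt
      smooth_on_primitive_fields) (auto simp: relaxed_states_def)

text \<open>
  States with symmetric \<open>Y\<close> have no interior. Symmetrizing \<open>Y\<close> first extends the energy to an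
  open set, where it can be differentiated in every direction.
\<close>

definition symmetrize :: "state \<Rightarrow> state" where
  "symmetrize u = (fst u, fst (snd u), fst (snd (snd u)), fst (snd (snd (snd u))),
     fst (snd (snd (snd (snd u)))), sym_part (fst (snd (snd (snd (snd (snd u)))))),
     snd (snd (snd (snd (snd (snd u))))))"

lemma smooth_on_symmetrize: "smooth_on S symmetrize"
proof -
  have "bounded_linear (sym_part :: real^3^3 \<Rightarrow> _)"
    using linear_sym_part linear_conv_bounded_linear by blast
  note sp = smooth_on_bounded_linear[OF this]
  show ?thesis
    unfolding symmetrize_def[abs_def]
    by (intro smooth_on_Pair smooth_on_fst smooth_on_snd smooth_on_ident sp)
qed

lemma symmetrize_relaxed: "u \<in> relaxed_states \<Longrightarrow> symmetrize u = u"
proof -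
  assume u: "u \<in> relaxed_states"
  let ?Y = "fst (snd (snd (snd (snd (snd u)))))"
  have "transpose ?Y = ?Y"
    using u by (auto simp: relaxed_states_def state_projections spd_def transpose_def vec_eq_iff)
  then show ?thesis by (simp add: symmetrize_def sym_part_symmetric)
qed

definition symmetrizable_states :: "state set" where
  "symmetrizable_states = {u. symmetrize u \<in> relaxed_states}"

lemma open_symmetrizable_states: "open symmetrizable_states"
proof -
  let ?Y = "\<lambda>u :: state. fst (snd (snd (snd (snd (snd u)))))" and ?y =
      "\<lambda>u :: state. snd (snd (snd (snd (snd (snd u)))))"
  have spd: "spd (A /\<^sub>R r) \<longleftrightarrow> spd A" if "r > 0" for A :: "real^3^3" and r
    using spd_scaleR[of A "inverse r"] spd_scaleR[of "A /\<^sub>R r" r] that by auto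
  have eq: "symmetrizable_states = {u. 0 < fst u} \<inter> ?Y -` {A. spd (sym_part A)} \<inter> {u. 0 < ?y u}"
    by (auto simp: symmetrizable_states_def relaxed_states_def symmetrize_def spd
        zero_less_divide_iff)
  have o: "open {u :: state. 0 < fst u}" "open {u :: state. 0 < ?y u}"
    by (intro open_Collect_less continuous_intros)+
  have oY: "open (?Y -` {A. spd (sym_part A)})"
    by (intro open_vimage open_spd_sym_part continuous_intros)
  show ?thesis unfolding eq by (intro open_Int o oY)
qed

lemma relaxed_symmetrizable: "relaxed_states \<subseteq> symmetrizable_states"
  using symmetrize_relaxed by (auto simp: symmetrizable_states_def)

context polytropic_material
begin

lemma smooth_on_es_tilde: "smooth_on relaxed_states (es_tilde m)"
proof (rule smooth_on_cong)
  show "smooth_on relaxed_states (\<lambda>u. exp (log_energy u))"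
    unfolding log_energy_def divide_inverse
    by (intro smooth_on_exp smooth_on_add smooth_on_diff smooth_on_mult smooth_on_const smooth_on_ln
        smooth_on_primitive_fields smooth_on_conformation_trace) (auto simp: relaxed_states_def)
  show "exp (log_energy u) = es_tilde m u" if "u \<in> relaxed_states" for u
    using that es_tilde_eq_exp by (simp add: relaxed_states_def)
qed

lemma smooth_on_energy: "smooth_on relaxed_states (\<lambda>u. \<rho>_of u * E_tilde m u)"
  unfolding E_tilde_def conformation_trace_def[symmetric] divide_inverse
  by (intro smooth_on_mult smooth_on_add smooth_on_const smooth_on_norm_power2
      smooth_on_primitive_fields
      smooth_on_es_tilde smooth_on_conformation_trace)

lemma es_tilde_pos: "u \<in> relaxed_states \<Longrightarrow> 0 < es_tilde m u"
  using es_tilde_eq_exp by (simp add: relaxed_states_def)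

lemma es_tilde_eq: "es_tilde m u = es m (\<rho>_of u) (\<eta>hat m u)"
  by (simp add: es_tilde_def \<eta>hat_def C_of_def)

text \<open>
  For the polytropic law the temperature is a constant multiple of the volumetric energy, which
  makes it smooth and positive.
\<close>

lemma temp_eq: "temp m u = es_tilde m u / cV"
proof -
  have "((\<lambda>h. polytropic cV \<theta>ref \<rho>ref \<gamma> r h) has_real_derivative polytropic cV \<theta>ref \<rho>ref \<gamma> r h /
      cV) (at h)" for r h
    unfolding polytropic_def using pos by (auto intro!: derivative_eq_intros)
  then show ?thesis unfolding temp_def es_tilde_eq es_polytropic by (rule DERIV_imp_deriv)
qed

lemma temp_pos: "u \<in> relaxed_states \<Longrightarrow> 0 < temp m u"
  using es_tilde_pos pos by (simp add: temp_eq)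

lemma pressure_eq:
  assumes "0 < \<rho>_of u" shows "pressure m u = (\<gamma> - 1) * \<rho>_of u * es_tilde m u"
proof -
  have "((\<lambda>r. polytropic cV \<theta>ref \<rho>ref \<gamma> r h) has_real_derivative
    (\<gamma> - 1) / r * polytropic cV \<theta>ref \<rho>ref \<gamma> r h) (at r)" if "r > 0" for r h
  proof -
    have "((\<lambda>r. (r / \<rho>ref) powr (\<gamma> - 1)) has_real_derivative (\<gamma> - 1) / r * (r / \<rho>ref) powr (\<gamma>
        - 1)) (at r)"
    proof -
      have "((\<lambda>r. r / \<rho>ref) has_real_derivative 1 / \<rho>ref) (at r)"
        using pos by (auto intro!: derivative_eq_intros)
      then have d: "((\<lambda>r. (r / \<rho>ref) powr (\<gamma> - 1)) has_real_derivative
          (\<gamma> - 1) * (r / \<rho>ref) powr (\<gamma> - 1 - of_nat 1) * (1 / \<rho>ref)) (at r)"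
        by (rule DERIV_fun_powr) (use that pos in simp)
      have pw: "(r / \<rho>ref) powr (\<gamma> - 1 - of_nat 1) = (r / \<rho>ref) powr (\<gamma> - 1) / (r / \<rho>ref)"
        using that pos by (subst powr_diff) simp
      show ?thesis
        by (rule DERIV_cong[OF d], unfold pw) (use that pos in simp)
    qed
    then have "((\<lambda>r. cV * \<theta>ref * exp (h / cV) * (r / \<rho>ref) powr (\<gamma> - 1)) has_real_derivative
        cV * \<theta>ref * exp (h / cV) * ((\<gamma> - 1) / r * (r / \<rho>ref) powr (\<gamma> - 1))) (at r)"
      by (rule DERIV_cmult)
    then show ?thesis by (simp add: polytropic_def mult_ac)
  qed
  from DERIV_imp_deriv[OF this[OF assms]]
  show ?thesis using assms by (simp add: pressure_def es_tilde_eq es_polytropic power2_eq_square)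
qed

lemma smooth_on_temp: "smooth_on relaxed_states (temp m)"
  unfolding temp_eq[abs_def] divide_inverse
  by (intro smooth_on_mult smooth_on_const smooth_on_es_tilde)

lemma smooth_on_Ktemp: "smooth_on relaxed_states (Ktemp m)"
  unfolding Ktemp_def[abs_def]
  by (intro smooth_on_add smooth_on_mult smooth_on_const smooth_on_temp)

lemma smooth_on_pressure: "smooth_on relaxed_states (pressure m)"
proof (rule smooth_on_cong)
  show "smooth_on relaxed_states (\<lambda>u. (\<gamma> - 1) * \<rho>_of u * es_tilde m u)"
    by (intro smooth_on_mult smooth_on_const smooth_on_primitive_fields smooth_on_es_tilde)
qed (simp add: pressure_eq relaxed_states_def)

lemma smooth_on_C_of: "smooth_on relaxed_states C_of"
  unfolding C_of_def[abs_def]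
  by (intro smooth_on_matrix_mult smooth_on_transpose smooth_on_mat_inv_sqrt
      smooth_on_primitive_fields)
    (auto simp: relaxed_states_def)

lemma smooth_on_stress: "smooth_on relaxed_states (stress m)"
  unfolding stress_def[abs_def]
  by (intro smooth_on_add smooth_on_minus smooth_on_diff smooth_on_scaleR smooth_on_mult
      smooth_on_const
      smooth_on_pressure smooth_on_C_of smooth_on_temp smooth_on_Ktemp smooth_on_primitive_fields)

lemma spd_C_of: "u \<in> admissible_states \<Longrightarrow> spd (C_of u)"
  unfolding C_of_def admissible_states_def by (auto intro!: spd_congruence spd_mat_inv_sqrt)

lemma smooth_on_source:
  assumes zeta: "\<And>\<theta>. 0 < \<theta> \<Longrightarrow> 0 < zeta m \<theta>" "smooth_on {0<..} (zeta m)"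
    and f: "smooth_on admissible_states f"
  shows "smooth_on admissible_states (source m f)"
proof -
  note sub = smooth_on_subset[OF _ admissible_imp_relaxed]
  note prim = smooth_on_primitive_fields[THEN sub]
  note \<theta> = smooth_on_temp[THEN sub] and K = smooth_on_Ktemp[THEN sub]
      and C = smooth_on_C_of[THEN sub]
  have tpos: "0 < temp m u" if "u \<in> admissible_states" for u
    using temp_pos admissible_imp_relaxed that by blast
  have dpos: "0 < drag m u" if "u \<in> admissible_states" for u
    unfolding drag_def using zeta(1) tpos[OF that] by simp
  have drag: "smooth_on admissible_states (drag m)"
    unfolding drag_def[abs_def] by (rule smooth_on_compose[OF zeta(2) \<theta>]) (auto intro: tpos)
  have W: "smooth_on admissible_states (\<lambda>u. mat_inv_sqrt (Y_of u))"
    by (rule smooth_on_mat_inv_sqrt[OF prim(6)]) (simp add: admissible_states_def)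
  have G: "smooth_on admissible_states G_of"
    unfolding G_of_def[abs_def]
    by (intro smooth_on_matrix_mult smooth_on_transpose smooth_on_matrix_inv prim)
        (simp_all add: admissible_states_def)
  have CC: "smooth_on admissible_states (\<lambda>u. mat_sqrt (C_of u))"
      "smooth_on admissible_states (\<lambda>u. mat_inv_sqrt (C_of u))"
    by (rule smooth_on_mat_sqrt[OF C spd_C_of] smooth_on_mat_inv_sqrt[OF C spd_C_of], assumption)+
  note intros = smooth_on_add smooth_on_diff smooth_on_minus smooth_on_mult smooth_on_scaleR
      smooth_on_const
    smooth_on_matrix_mult smooth_on_trace smooth_on_norm_power2 smooth_on_power
    W G drag prim \<theta> K CC f
  have "smooth_on admissible_states (entropy_production m)"
    unfolding entropy_production_def[abs_def]
    by (intro smooth_on_add smooth_on_divide intros)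
        (use pos in \<open>auto simp: tpos[THEN less_imp_neq, symmetric]
        dpos[THEN less_imp_neq, symmetric]\<close>)
  moreover have "smooth_on admissible_states (Y_rate m)"
    unfolding Y_rate_def[abs_def] Let_def
    by (intro smooth_on_diff smooth_on_scaleR smooth_on_divide intros)
        (auto simp: dpos[THEN less_imp_neq, symmetric])
  moreover have "smooth_on admissible_states (y_rate m)"
    unfolding y_rate_def[abs_def] Let_def
    by (intro smooth_on_mult smooth_on_divide intros)
        (auto simp: dpos[THEN less_imp_neq, symmetric])
  moreover have "smooth_on admissible_states (\<lambda>u. 1 / (tau0 m * temp m u))"
    by (intro smooth_on_divide intros) (use pos in \<open>auto simp: tpos[THEN less_imp_neq, symmetric]\<close>)
  ultimately show ?thesis
    unfolding source_def[abs_def] by (intro smooth_on_Pair intros)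
qed

end

section \<open>Derivatives of fields and of the energy\<close>

text \<open>
  Partial derivatives in space and the possibly one-sided one in time are derivatives along
  lines that stay in the ambient set \<open>H\<close>, later the closed half space. A local extension of the
  field is differentiable there, and it agrees with the field at the points of the line near
  \<open>x\<close>.
\<close>

lemma smooth_on_has_vector_derivative_along:
  fixes w :: "'x::euclidean_space \<Rightarrow> 'b::real_normed_vector" and L :: "real \<Rightarrow> 'x"
  assumes w: "smooth_on \<Omega> w" and \<Omega>: "openin (top_of_set H) \<Omega>"
    and L: "(L has_vector_derivative d) (at x within S)"
    and x: "x \<in> S" "L x \<in> \<Omega>" and H: "\<And>s. s \<in> S \<Longrightarrow> L s \<in> H"
  shows "\<exists>D. ((\<lambda>s. w (L s)) has_vector_derivative D) (at x within S)"
proof -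
  obtain T where T: "open T" "\<Omega> = H \<inter> T" using \<Omega> by (auto simp: openin_open)
  obtain U g where U: "open U" "L x \<in> U" "\<And>k. Ck_on k U g" "\<And>z. z \<in> \<Omega> \<Longrightarrow> z \<in> U \<Longrightarrow> g z = w z"
    by (rule smooth_on_extension[OF w x(2)]) blast
  let ?g = "frechet_derivative g (at (L x))"
  have "(g has_derivative ?g) (at (L x) within L ` S)"
    using Ck_on_has_derivative[OF U(3) U(2)] by (rule has_derivative_at_withinI)
  from vector_derivative_diff_chain_within[OF L this]
  have comp: "((\<lambda>s. g (L s)) has_vector_derivative ?g d) (at x within S)" by (simp add: o_def)
  have "(L \<longlongrightarrow> L x) (at x within S)"
    using has_vector_derivative_continuous[OF L] by (simp add: continuous_within)
  then have "eventually (\<lambda>s. L s \<in> T \<inter> U) (at x within S)"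
    by (rule topological_tendstoD) (use T U x in auto)
  then obtain e where e: "e > 0" "\<And>s. s \<in> S \<Longrightarrow> s \<noteq> x \<Longrightarrow> dist s x < e \<Longrightarrow> L s \<in> T \<inter> U"
    unfolding eventually_at by blast
  have "((\<lambda>s. w (L s)) has_vector_derivative ?g d) (at x within S)"
  proof (rule has_vector_derivative_transform_within[OF comp e(1) x(1)])
    fix s assume s: "s \<in> S" "dist s x < e"
    then have "L s \<in> T \<inter> U" using e(2)[of s] x T U(2) by (cases "s = x") auto
    then show "g (L s) = w (L s)" using U(4) T H[OF s(1)] by auto
  qed
  then show ?thesis by blast
qed

abbreviation half_space_time :: "((real^3) \<times> real) set" where
  "half_space_time \<equiv> UNIV \<times> {0..}"

abbreviation space_line :: "3 \<Rightarrow> (real^3) \<times> real \<Rightarrow> real \<Rightarrow> (real^3) \<times> real" where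
  "space_line k z \<equiv> \<lambda>h. (fst z + h *\<^sub>R axis k 1, snd z)"

lemma has_vector_derivative_space_line:
  "(space_line k z has_vector_derivative (axis k 1, 0)) (at h)"
  by (intro has_vector_derivative_Pair) (auto intro!: derivative_eq_intros)

lemma has_vector_derivative_time_line:
  "((\<lambda>s. (x, s)) has_vector_derivative (0, 1)) (at t within S)"
  by (intro has_vector_derivative_Pair) (auto intro!: derivative_eq_intros)

lemma at_within_Ici_neq_bot: "0 \<le> (t::real) \<Longrightarrow> at t within {0..} \<noteq> bot"
proof -
  assume "0 \<le> t"
  then have "at_right t \<le> at t within {0..}" by (intro at_le) auto
  then show ?thesis using trivial_limit_at_right_real[of t]
      by (metis bot.extremum_unique trivial_limit_def)
qed

lemma space_derivI:
  "((\<lambda>h. w (space_line k z h)) has_vector_derivative D) (at 0) \<Longrightarrow> space_deriv k w z = D"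
  unfolding space_deriv_def by (rule vector_derivative_at)

lemma time_derivI:
  "0 \<le> snd z \<Longrightarrow> ((\<lambda>s. w (fst z, s)) has_vector_derivative D) (at (snd z) within {0..})
      \<Longrightarrow> time_deriv w z = D"
  unfolding time_deriv_def by (rule vector_derivative_within[OF at_within_Ici_neq_bot])

lemma has_space_deriv:
  assumes "openin (top_of_set half_space_time) \<Omega>" "smooth_on \<Omega> w" "z \<in> \<Omega>"
  shows "((\<lambda>h. w (space_line k z h)) has_vector_derivative space_deriv k w z) (at 0)"
proof -
  have "z \<in> half_space_time" using openin_imp_subset[OF assms(1)] assms(3) by blast
  then have "\<exists>D. ((\<lambda>h. w (space_line k z h)) has_vector_derivative D) (at 0)"
    using assms by (intro smooth_on_has_vector_derivative_along[OF assms(2,1)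
        has_vector_derivative_space_line]) (auto simp: mem_Times_iff)
  then show ?thesis using space_derivI by blast
qed

lemma has_time_deriv:
  assumes "openin (top_of_set half_space_time) \<Omega>" "smooth_on \<Omega> w" "z \<in> \<Omega>"
  shows "((\<lambda>s. w (fst z, s)) has_vector_derivative time_deriv w z) (at (snd z) within {0..})"
proof -
  have z: "z \<in> half_space_time" using openin_imp_subset[OF assms(1)] assms(3) by blast
  then have t: "0 \<le> snd z" by (simp add: mem_Times_iff)
  then have "\<exists>D. ((\<lambda>s. w (fst z, s)) has_vector_derivative D) (at (snd z) within {0..})"
    using assms by (intro smooth_on_has_vector_derivative_along[OF assms(2,1)
        has_vector_derivative_time_line]) (auto simp: mem_Times_iff)
  then obtain D where D: "((\<lambda>s. w (fst z, s)) has_vector_derivative D) (at (snd z) within {0..})" ..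
  then show ?thesis by (simp only: time_derivI[OF t D])
qed

lemma space_deriv_cong:
  assumes \<Omega>: "openin (top_of_set half_space_time) \<Omega>" "z \<in> \<Omega>" and eq: "\<And>y. y \<in> \<Omega> \<Longrightarrow> v y = w y"
  shows "space_deriv k v z = space_deriv k w z"
proof -
  obtain T where T: "open T" "\<Omega> = half_space_time \<inter> T" using \<Omega> by (auto simp: openin_open)
  have "open (space_line k z -` T)" by (intro open_vimage T continuous_intros)
  moreover have "0 \<in> space_line k z -` T" using \<Omega> T by auto
  ultimately have "eventually (\<lambda>h. h \<in> space_line k z -` T) (nhds 0)"
    by (rule eventually_nhds_in_open)
  moreover have "space_line k z h \<in> half_space_time" for h using \<Omega> T by (auto simp: mem_Times_iff)
  ultimately have "eventually (\<lambda>h. h \<in> UNIV \<longrightarrow> v (space_line k z h) = w (space_line k z h)) (nhds 0)"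
    by (auto elim!: eventually_mono simp: eq T(2))
  then show ?thesis unfolding space_deriv_def by (rule vector_derivative_cong_eq) auto
qed

lemma time_deriv_cong:
  assumes \<Omega>: "openin (top_of_set half_space_time) \<Omega>" "z \<in> \<Omega>" and eq: "\<And>y. y \<in> \<Omega> \<Longrightarrow> v y = w y"
  shows "time_deriv v z = time_deriv w z"
proof -
  obtain T where T: "open T" "\<Omega> = half_space_time \<inter> T" using \<Omega> by (auto simp: openin_open)
  have "open ((\<lambda>s. (fst z, s)) -` T)" by (intro open_vimage T continuous_intros)
  moreover have "snd z \<in> (\<lambda>s. (fst z, s)) -` T" using \<Omega> T by auto
  ultimately have "eventually (\<lambda>s. s \<in> (\<lambda>s. (fst z, s)) -` T) (nhds (snd z))"
    by (rule eventually_nhds_in_open)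
  then have "eventually (\<lambda>s. s \<in> {0..} \<longrightarrow> v (fst z, s) = w (fst z, s)) (nhds (snd z))"
    by (auto elim!: eventually_mono simp: eq T(2))
  then show ?thesis unfolding time_deriv_def
    by (rule vector_derivative_cong_eq) (use \<Omega> T in \<open>auto simp: mem_Times_iff\<close>)
qed

lemma has_vector_derivative_vec_lambda:
  fixes f :: "'n::finite \<Rightarrow> real \<Rightarrow> 'b::euclidean_space"
  assumes "\<And>i. (f i has_vector_derivative f' i) (at x within S)"
  shows "((\<lambda>h. \<chi> i. f i h) has_vector_derivative (\<chi> i. f' i)) (at x within S)"
  unfolding vec_lambda_eq_sum_axis
  by (intro has_vector_derivative_sum
      bounded_linear.has_vector_derivative[OF bounded_linear_axis] assms)

lemma conformation_trace_expand:
  fixes F d Y :: "real^'n^'n"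
  assumes "spd Y"
  shows "conformation_trace (F + x *\<^sub>R d) Y = conformation_trace F Y
    + 2 * x * (\<Sum>i\<in>UNIV. (mat_inv_sqrt Y *v F $ i) \<bullet> d $ i) + x\<^sup>2 * conformation_trace d Y"
proof -
  let ?W = "mat_inv_sqrt Y"
  note W = spdD(1)[OF spd_mat_inv_sqrt[OF assms]]
  have "(F $ i + x *\<^sub>R d $ i) \<bullet> (?W *v (F $ i + x *\<^sub>R d $ i)) =
    F $ i \<bullet> (?W *v F $ i) + 2 * x * ((?W *v F $ i) \<bullet> d $ i) + x\<^sup>2 * (d $ i \<bullet> (?W *v d $ i))" for i
    using symmetric_inner[OF W, of "F $ i" "d $ i"]
    by (simp add: linear_matrix_vector inner_add_left inner_add_right power2_eq_square algebra_simps
        inner_commute[of "d $ i" "?W *v F $ i"])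
  then show ?thesis
    by (simp add: conformation_trace_rows sum.distrib sum_distrib_left)
qed

lemma C_of_entry:
  assumes "spd (Y_of u)"
  shows "C_of u $ i $ k = (mat_inv_sqrt (Y_of u) *v F_of u $ i) \<bullet> F_of u $ k"
proof -
  let ?W = "mat_inv_sqrt (Y_of u)" and ?F = "F_of u"
  have "C_of u $ i $ k = ?F $ i \<bullet> (?W *v ?F $ k)"
    unfolding C_of_def matrix_mul_assoc[symmetric]
    by (simp add: matrix_matrix_mult_def inner_vec_def matrix_vector_mult_def transpose_def)
  also have "\<dots> = (?W *v ?F $ i) \<bullet> ?F $ k"
    using symmetric_inner[OF spdD(1)[OF spd_mat_inv_sqrt[OF assms]]] by simp
  finally show ?thesis .
qed

lemma scaled_state_projections:
  assumes "0 < c"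
  shows "\<rho>_of (c *\<^sub>R u) = c * \<rho>_of u" "\<eta>_of (c *\<^sub>R u) = \<eta>_of u" "j_of (c *\<^sub>R u) = j_of u"
    "v_of (c *\<^sub>R u) = v_of u" "F_of (c *\<^sub>R u) = F_of u" "Y_of (c *\<^sub>R u) = Y_of u"
        "y_of (c *\<^sub>R u) = y_of u"
  using assms by (simp_all add: state_projections)

context polytropic_material
begin

definition energy_extension :: "state \<Rightarrow> real" where
  "energy_extension u = \<rho>_of (symmetrize u) * E_tilde m (symmetrize u)"

definition energy_gradient :: "state \<Rightarrow> state \<Rightarrow> real" where
  "energy_gradient u = frechet_derivative energy_extension (at u)"

lemma energy_extension_relaxed: "u \<in> relaxed_states \<Longrightarrow> energy_extension u = \<rho>_of u * E_tilde m u"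
  by (simp add: energy_extension_def symmetrize_relaxed)

lemma smooth_on_energy_extension: "smooth_on symmetrizable_states energy_extension"
  unfolding energy_extension_def[abs_def]
  by (rule smooth_on_compose[OF smooth_on_energy smooth_on_symmetrize])
      (auto simp: symmetrizable_states_def)

lemma energy_extension_has_derivative:
  "u \<in> relaxed_states \<Longrightarrow> (energy_extension has_derivative energy_gradient u) (at u)"
  unfolding energy_gradient_def
  using smooth_on_has_derivative[OF open_symmetrizable_states smooth_on_energy_extension]
      relaxed_symmetrizable by blast

lemma linear_energy_gradient: "u \<in> relaxed_states \<Longrightarrow> linear (energy_gradient u)"
  using energy_extension_has_derivative has_derivative_linear by blast

text \<open>
  The value of the gradient in a direction is computed on a segment of relaxed states, where the
  extension is the energy itself.
\<close>

lemma energy_gradient_eqI: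
  assumes u: "u \<in> relaxed_states" and e: "0 < e"
    and rel: "\<And>h. \<bar>h\<bar> < e \<Longrightarrow> u + h *\<^sub>R w \<in> relaxed_states"
    and eq: "\<And>h. \<bar>h\<bar> < e \<Longrightarrow> \<rho>_of (u + h *\<^sub>R w) * E_tilde m (u + h *\<^sub>R w) = g h"
    and g: "(g has_real_derivative D) (at 0)"
  shows "energy_gradient u w = D"
proof -
  have l: "((\<lambda>h. u + h *\<^sub>R w) has_vector_derivative w) (at 0)"
      by (auto intro!: derivative_eq_intros)
  have "(energy_extension has_derivative energy_gradient u)
      (at (u + 0 *\<^sub>R w) within range (\<lambda>h. u + h *\<^sub>R w))"
    using energy_extension_has_derivative[OF u] by (simp add: has_derivative_at_withinI)
  from vector_derivative_diff_chain_within[OF l this]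
  have "((\<lambda>h. energy_extension (u + h *\<^sub>R w)) has_vector_derivative energy_gradient u w) (at 0)"
    by (simp add: o_def)
  then have "(g has_vector_derivative energy_gradient u w) (at 0)"
    by (rule has_vector_derivative_transform_within[OF _ e])
        (simp_all add: energy_extension_relaxed rel eq dist_norm)
  moreover have "(g has_vector_derivative D) (at 0)" using g
      by (simp add: has_real_derivative_iff_has_vector_derivative)
  ultimately show ?thesis by (rule vector_derivative_unique_at)
qed

text \<open>
  Multiplying a state by \<open>1 + h\<close> changes only \<open>\<rho>\<close> among the primitive fields. The density enters
  \<open>es_tilde\<close> directly, which gives the pressure, and through the logarithm in \<open>\<eta>hat\<close>, which
  gives the term with \<open>kB\<close>.
\<close>

lemma energy_gradient_scaling:
  assumes u: "u \<in> relaxed_states"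
  shows "energy_gradient u u = \<rho>_of u * E_tilde m u
      + (pressure m u + alpha m * \<rho>_of u * kB m * temp m u)"
proof -
  define a where "a = \<gamma> - 1 + alpha m * kB m / cV"
  have up: "0 < \<rho>_of u" "0 < y_of u" using u by (auto simp: relaxed_states_def)
  define g where "g h = (1 + h) * \<rho>_of u * (E_tilde m u - es_tilde m u
      + exp (log_energy u + a * ln (1 + h)))" for h
  have "energy_gradient u u = \<rho>_of u * E_tilde m u + \<rho>_of u * (es_tilde m u * a)"
  proof (rule energy_gradient_eqI[OF u zero_less_one])
    fix h :: real assume h: "\<bar>h\<bar> < 1"
    then have c: "0 < 1 + h" by auto
    have sc: "u + h *\<^sub>R u = (1 + h) *\<^sub>R u" by (simp add: algebra_simps)
    show rel: "u + h *\<^sub>R u \<in> relaxed_states"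
      unfolding sc using u c by (simp add: relaxed_states_def scaled_state_projections)
    have "log_energy ((1 + h) *\<^sub>R u) = log_energy u + a * ln (1 + h)"
      unfolding log_energy_def scaled_state_projections[OF c] ln_mult_pos[OF c up(1)]
      by (simp add: a_def ring_distribs add_divide_distrib)
    then have "es_tilde m ((1 + h) *\<^sub>R u) = exp (log_energy u + a * ln (1 + h))"
      using c up by (simp add: es_tilde_eq_exp scaled_state_projections)
    then show "\<rho>_of (u + h *\<^sub>R u) * E_tilde m (u + h *\<^sub>R u) = g h"
      unfolding sc g_def E_tilde_def by (simp add: scaled_state_projections[OF c])
  next
    have "(g has_real_derivative \<rho>_of u * E_tilde m u + \<rho>_of u * (exp (log_energy u) * a)) (at 0)"
      unfolding g_def using up
      by (auto intro!: derivative_eq_intros simp: es_tilde_eq_exp algebra_simps)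
    then show "(g has_real_derivative \<rho>_of u * E_tilde m u + \<rho>_of u * (es_tilde m u * a)) (at 0)"
      using up by (simp add: es_tilde_eq_exp)
  qed
  also have "\<rho>_of u * (es_tilde m u * a) = pressure m u + alpha m * \<rho>_of u * kB m * temp m u"
    using up pos by (simp add: pressure_eq temp_eq a_def field_simps)
  finally show ?thesis .
qed

text \<open>
  In these directions \<open>\<rho>\<close>, \<open>Y\<close> and \<open>y\<close> are constant, so the inverse square root of \<open>Y\<close> is not
  differentiated: along the line the specific energy is a quadratic polynomial plus the
  exponential of one. The flux identity uses the gradient only here and in the direction of the
  state itself.
\<close>

lemma energy_gradient_partial:
  fixes b c :: "real^3" and d :: "real^3^3"
  assumes u: "u \<in> relaxed_states"
  shows "energy_gradient u (0, a, b, c, d, 0, 0) = temp m u * a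
      + tau0 m / kappa m * (j_of u \<bullet> b) + v_of u \<bullet> c
    + alpha m * Ktemp m u * (\<Sum>i\<in>UNIV. (mat_inv_sqrt (Y_of u) *v F_of u $ i) \<bullet> d $ i)"
proof -
  let ?w = "(0, a, b, c, d, 0, 0) :: state" and ?Y = "Y_of u" and ?r = "\<rho>_of u"
  define B where "B = (\<Sum>i\<in>UNIV. (mat_inv_sqrt ?Y *v F_of u $ i) \<bullet> d $ i)"
  define Q where "Q = conformation_trace d ?Y"
  have up: "0 < ?r" "0 < y_of u" "spd ?Y" using u by (auto simp: relaxed_states_def)
  have prim: "\<rho>_of (u + h *\<^sub>R ?w) = ?r" "\<eta>_of (u + h *\<^sub>R ?w) = \<eta>_of u + (h / ?r) * a"
    "j_of (u + h *\<^sub>R ?w) = j_of u + (h / ?r) *\<^sub>R b" "v_of (u + h *\<^sub>R ?w) = v_of u + (h / ?r) *\<^sub>R c"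
    "F_of (u + h *\<^sub>R ?w) = F_of u + (h / ?r) *\<^sub>R d" "Y_of (u + h *\<^sub>R ?w) = ?Y"
        "y_of (u + h *\<^sub>R ?w) = y_of u" for h
    by (simp_all add: state_projections divide_inverse algebra_simps)
  define g where "g x = (norm (v_of u))\<^sup>2 / 2 + x * (v_of u \<bullet> c) + x\<^sup>2 * (norm c)\<^sup>2 / 2
    + exp (log_energy u + x * a / cV + alpha m * K1 m / (2 * cV) * (2 * x * B + x\<^sup>2 * Q))
    + tau0 m / (2 * kappa m) * ((norm (j_of u))\<^sup>2 + 2 * x * (j_of u \<bullet> b) + x\<^sup>2 * (norm b)\<^sup>2)
    + alpha m / 2 * K0 m * (tr_C u + 2 * x * B + x\<^sup>2 * Q) + eref m / 2 * (norm ?Y)\<^sup>2" for x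
  have nrm: "(norm (p + x *\<^sub>R q))\<^sup>2 = (norm p)\<^sup>2 + 2 * x * (p \<bullet> q) + x\<^sup>2 * (norm q)\<^sup>2"
      for p q :: "real^3" and x
    unfolding power2_norm_eq_inner
    by (simp add: inner_add_left inner_add_right inner_commute[of q p] power2_eq_square
        algebra_simps)
  let ?D = "v_of u \<bullet> c + exp (log_energy u) * (a / cV + alpha m * K1 m / cV * B)
    + tau0 m / kappa m * (j_of u \<bullet> b) + alpha m * K0 m * B"
  have "energy_gradient u ?w = ?D"
  proof (rule energy_gradient_eqI[OF u zero_less_one])
    fix h :: real
    show rel: "u + h *\<^sub>R ?w \<in> relaxed_states"
      using u unfolding relaxed_states_def mem_Collect_eq prim .
    have tr: "tr_C (u + h *\<^sub>R ?w) = tr_C u + 2 * (h / ?r) * B + (h / ?r)\<^sup>2 * Q"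
      unfolding prim B_def Q_def by (rule conformation_trace_expand[OF up(3)])
    have "log_energy (u + h *\<^sub>R ?w) = log_energy u + (h / ?r) * a / cV
        + alpha m * K1 m / (2 * cV) * (2 * (h / ?r) * B + (h / ?r)\<^sup>2 * Q)"
      unfolding log_energy_def tr unfolding prim by (simp add: add_divide_distrib distrib_left)
    moreover have "es_tilde m (u + h *\<^sub>R ?w) = exp (log_energy (u + h *\<^sub>R ?w))"
      by (rule es_tilde_eq_exp) (simp_all only: prim up)
    ultimately have es: "es_tilde m (u + h *\<^sub>R ?w)
        = exp (log_energy u + (h / ?r) * a / cV + alpha m * K1 m / (2 * cV) *
        (2 * (h / ?r) * B + (h / ?r)\<^sup>2 * Q))"
      by (simp only:)
    have "E_tilde m (u + h *\<^sub>R ?w) = g (h / ?r)"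
      unfolding E_tilde_def conformation_trace_def[symmetric] es tr g_def unfolding prim nrm
      by (simp add: add_divide_distrib)
    then show "\<rho>_of (u + h *\<^sub>R ?w) * E_tilde m (u + h *\<^sub>R ?w) = ?r * g (h / ?r)"
        by (simp only: prim(1))
  next
    \<comment> \<open>The conserved variables move with speed \<open>1\<close>, the primitive ones with speed \<open>1 / \<rho>\<close>, which
      cancels the factor \<open>\<rho>\<close> in front of the specific energy.\<close>
    have "(g has_real_derivative ?D) (at (0 / ?r))"
      unfolding g_def using pos by (auto intro!: derivative_eq_intros simp: field_simps)
    moreover have "((\<lambda>h. h / ?r) has_real_derivative 1 / ?r) (at 0)"
      using up by (auto intro!: derivative_eq_intros)
    ultimately have "((\<lambda>h. g (h / ?r)) has_real_derivative ?D * (1 / ?r)) (at 0)"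
        by (rule DERIV_chain2)
    from DERIV_cmult[OF this, of ?r] show "((\<lambda>h. ?r * g (h / ?r)) has_real_derivative ?D) (at 0)"
      using up by simp
  qed
  also have "?D = temp m u * a + tau0 m / kappa m * (j_of u \<bullet> b) + v_of u \<bullet> c
      + alpha m * Ktemp m u * B"
    using up pos by (simp add: es_tilde_eq_exp[symmetric] temp_eq Ktemp_def field_simps)
  finally show ?thesis by (simp add: B_def)
qed

end

section \<open>The energy balance law\<close>

locale field_domain =
  fixes \<Omega> :: "((real^3) \<times> real) set"
  assumes openin_domain: "openin (top_of_set half_space_time) \<Omega>"
begin

lemmas deriv_field = has_space_deriv[OF openin_domain]

lemma space_deriv_bilinear:
  assumes "bounded_bilinear B" "smooth_on \<Omega> f" "smooth_on \<Omega> g" "z \<in> \<Omega>"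
  shows "space_deriv k (\<lambda>z. B (f z) (g z)) z = B (f z) (space_deriv k g z)
      + B (space_deriv k f z) (g z)"
  using bounded_bilinear.has_vector_derivative[OF assms(1) deriv_field[OF assms(2,4)]
      deriv_field[OF assms(3,4)], of k k]
  by (intro space_derivI) simp

lemmas space_deriv_scaleR = space_deriv_bilinear[OF bounded_bilinear_scaleR]
lemmas space_deriv_mult = space_deriv_bilinear[OF bounded_bilinear_mult]

lemma space_deriv_linear:
  assumes "bounded_linear L" "smooth_on \<Omega> f" "z \<in> \<Omega>"
  shows "space_deriv k (\<lambda>z. L (f z)) z = L (space_deriv k f z)"
  by (intro space_derivI bounded_linear.has_vector_derivative[OF assms(1)] deriv_field assms)

lemma space_deriv_add:
  assumes "smooth_on \<Omega> f" "smooth_on \<Omega> g" "z \<in> \<Omega>"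
  shows "space_deriv k (\<lambda>z. f z + g z) z = space_deriv k f z + space_deriv k g z"
  by (intro space_derivI has_vector_derivative_add deriv_field assms)

lemma space_deriv_diff:
  assumes "smooth_on \<Omega> f" "smooth_on \<Omega> g" "z \<in> \<Omega>"
  shows "space_deriv k (\<lambda>z. f z - g z) z = space_deriv k f z - space_deriv k g z"
  by (intro space_derivI has_vector_derivative_diff deriv_field assms)

lemma space_deriv_sum:
  assumes "\<And>i. i \<in> I \<Longrightarrow> smooth_on \<Omega> (f i)" "z \<in> \<Omega>"
  shows "space_deriv k (\<lambda>z. \<Sum>i\<in>I. f i z) z = (\<Sum>i\<in>I. space_deriv k (f i) z)"
  by (intro space_derivI has_vector_derivative_sum deriv_field assms)

lemma space_deriv_minus:
  assumes "smooth_on \<Omega> f" "z \<in> \<Omega>"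
  shows "space_deriv k (\<lambda>z. - f z) z = - space_deriv k f z"
  by (intro space_derivI has_vector_derivative_minus deriv_field assms)

lemma space_deriv_const: "space_deriv k (\<lambda>z. c) z = 0"
  by (intro space_derivI has_vector_derivative_const)

lemma space_deriv_Pair:
  assumes "smooth_on \<Omega> f" "smooth_on \<Omega> g" "z \<in> \<Omega>"
  shows "space_deriv k (\<lambda>z. (f z, g z)) z = (space_deriv k f z, space_deriv k g z)"
  by (intro space_derivI has_vector_derivative_Pair deriv_field assms)

lemma space_deriv_vec_lambda:
  fixes f :: "(real^3) \<times> real \<Rightarrow> 'n::finite \<Rightarrow> 'b::euclidean_space"
  assumes "\<And>i. smooth_on \<Omega> (\<lambda>z. f z i)" "z \<in> \<Omega>"
  shows "space_deriv k (\<lambda>z. \<chi> i. f z i) z = (\<chi> i. space_deriv k (\<lambda>z. f z i) z)"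
  by (intro space_derivI has_vector_derivative_vec_lambda deriv_field assms)

lemma space_deriv_ln:
  fixes f :: "(real^3) \<times> real \<Rightarrow> real"
  assumes "smooth_on \<Omega> f" "z \<in> \<Omega>" "0 < f z"
  shows "space_deriv k (\<lambda>z. ln (f z)) z = space_deriv k f z / f z"
proof (rule space_derivI)
  have "((\<lambda>h. f (space_line k z h)) has_real_derivative space_deriv k f z) (at 0)"
    using deriv_field[OF assms(1,2)] by (simp add: has_real_derivative_iff_has_vector_derivative)
  then have "((\<lambda>h. ln (f (space_line k z h))) has_real_derivative space_deriv k f z / f z) (at 0)"
    using assms(3) by (auto intro!: derivative_eq_intros)
  then show "((\<lambda>h. ln (f (space_line k z h))) has_vector_derivative space_deriv k f z / f z) (at 0)"
    by (simp add: has_real_derivative_iff_has_vector_derivative)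
qed

end

text \<open>
  The part of the flux that is not transported with the velocity; it has no \<open>\<rho>\<close>, \<open>Y\<close> and \<open>y\<close>
  components, so the partial gradient applies to it.
\<close>

definition flux_extra :: "material \<Rightarrow> 3 \<Rightarrow> state \<Rightarrow> state" where
  "flux_extra m k u =
     (0, j_of u $ k / temp m u,
      (\<chi> i. (mat 1 :: real^3^3) $ i $ k * (kappa m / tau0 m) * ln (temp m u)),
      (\<chi> i. - (stress m u $ i $ k)),
      (\<chi> i a. - (v_of u $ i * (\<rho>_of u * F_of u $ k $ a))), 0, 0)"

lemma flux_eq_convective_plus_extra:
  assumes "0 < \<rho>_of u"
  shows "flux m k u = v_of u $ k *\<^sub>R u + flux_extra m k u"
proof -
  obtain r e J V FF YY w where u: "u = (r, e, J, V, FF, YY, w)" by (cases u rule: \<rho>_of.cases)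
  have r: "r > 0" using assms by (simp add: u)
  show ?thesis
    using r by (simp add: flux_def flux_extra_def Let_def u vec_eq_iff field_simps)
qed

context polytropic_material
begin

text \<open>Convected energy, heat flux and power of the stress, \<open>\<rho> E v + j - T\<^sup>\<top> v\<close>.\<close>

definition energy_flux :: "3 \<Rightarrow> state \<Rightarrow> real" where
  "energy_flux k u = v_of u $ k * (\<rho>_of u * E_tilde m u) + j_of u $ k
      - (\<Sum>i\<in>UNIV. stress m u $ i $ k * v_of u $ i)"

lemma smooth_on_energy_flux: "smooth_on relaxed_states (energy_flux k)"
  unfolding energy_flux_def[abs_def]
  by (intro smooth_on_add smooth_on_diff smooth_on_mult smooth_on_sum smooth_on_vec_nth
      smooth_on_energy
      smooth_on_primitive_fields smooth_on_stress)

text \<open>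
  The coefficient of the identity in the stress, up to its sign. It is also the second summand
  of the gradient in the direction of the state, which makes the pressure work of the convective
  flux agree with that of the stress.
\<close>

definition total_pressure :: "state \<Rightarrow> real" where
  "total_pressure u = pressure m u + alpha m * \<rho>_of u * kB m * temp m u"

lemma stress_entry:
  assumes "u \<in> relaxed_states"
  shows "stress m u $ i $ k = - (if i = k then total_pressure u else 0)
    + alpha m * \<rho>_of u * Ktemp m u * ((mat_inv_sqrt (Y_of u) *v F_of u $ i) \<bullet> F_of u $ k)"
  using assms C_of_entry[of u i k]
  by (simp add: stress_def total_pressure_def mat_def relaxed_states_def algebra_simps)

lemma flux_extra_smooth: "smooth_on relaxed_states (flux_extra m k)"
  unfolding flux_extra_def[abs_def] divide_inverse
  by (intro smooth_on_Pair smooth_on_vec_lambda smooth_on_minus smooth_on_mult smooth_on_const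
      smooth_on_vec_nth
      smooth_on_ln smooth_on_temp smooth_on_stress smooth_on_primitive_fields
          smooth_on_compose[OF smooth_on_inverse_real])
    (auto dest: temp_pos)

end

locale smooth_motion = polytropic_material + field_domain +
  fixes u :: "(real^3) \<times> real \<Rightarrow> state"
  assumes smooth_field: "smooth_on \<Omega> u" and admissible: "u ` \<Omega> \<subseteq> admissible_states"
    and constraints: "kinematic_constraints m \<Omega> u"
begin

lemma relaxed: "z \<in> \<Omega> \<Longrightarrow> u z \<in> relaxed_states"
  using admissible admissible_imp_relaxed by blast

lemma smooth_composite:
  fixes q :: "state \<Rightarrow> 'b::real_normed_vector"
  shows "smooth_on relaxed_states q \<Longrightarrow> smooth_on \<Omega> (\<lambda>z. q (u z))"
  by (rule smooth_on_compose[OF _ smooth_field]) (auto intro: relaxed)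

lemmas smooth_fields = smooth_on_primitive_fields[THEN smooth_composite]
    smooth_on_temp[THEN smooth_composite]
  smooth_on_stress[THEN smooth_composite] smooth_on_energy[THEN smooth_composite]
  flux_extra_smooth[THEN smooth_composite] smooth_field

text \<open>
  Since \<open>\<rho> det F\<close> is constant, \<open>\<rho> F\<close> is a constant multiple of the field in the Piola identity.
\<close>

lemma divergence_mass_deformation:
  assumes z: "z \<in> \<Omega>"
  shows "(\<Sum>k\<in>UNIV. space_deriv k (\<lambda>z. \<rho>_of (u z) * F_of (u z) $ k $ a) z) = 0"
proof -
  have "space_deriv k (\<lambda>z. F_of (u z) $ k $ a / det (F_of (u z))) z =
      inverse (rhoR m) * space_deriv k (\<lambda>z. \<rho>_of (u z) * F_of (u z) $ k $ a) z" for k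
  proof -
    have "space_deriv k (\<lambda>z. F_of (u z) $ k $ a / det (F_of (u z))) z =
      space_deriv k (\<lambda>z. inverse (rhoR m) * (\<rho>_of (u z) * F_of (u z) $ k $ a)) z"
    proof (rule space_deriv_cong[OF openin_domain z])
      fix y assume y: "y \<in> \<Omega>"
      have "\<rho>_of (u y) * det (F_of (u y)) = rhoR m" using constraints y
          by (simp add: kinematic_constraints_def)
      moreover from this have "det (F_of (u y)) \<noteq> 0" using pos by auto
      ultimately have "inverse (rhoR m) * \<rho>_of (u y) = inverse (det (F_of (u y)))"
        using pos by (auto simp: field_simps)
      then show "F_of (u y) $ k $ a / det (F_of (u y))
          = inverse (rhoR m) * (\<rho>_of (u y) * F_of (u y) $ k $ a)"
        by (simp add: mult.assoc[symmetric] divide_inverse)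
    qed
    also have "\<dots> = inverse (rhoR m) * space_deriv k (\<lambda>z. \<rho>_of (u z) * F_of (u z) $ k $ a) z"
      by (intro space_deriv_linear[OF bounded_linear_mult_right] smooth_on_mult
          smooth_on_vec_nth smooth_fields z)
    finally show ?thesis .
  qed
  moreover have "(\<Sum>k\<in>UNIV. space_deriv k (\<lambda>z. F_of (u z) $ k $ a / det (F_of (u z))) z) = 0"
    using constraints z by (simp add: kinematic_constraints_def)
  ultimately have "inverse (rhoR m) *
      (\<Sum>k\<in>UNIV. space_deriv k (\<lambda>z. \<rho>_of (u z) * F_of (u z) $ k $ a) z) = 0"
    by (simp add: sum_distrib_left)
  then show ?thesis using pos by simp
qed

lemma chain_rule_along:
  assumes z: "z \<in> \<Omega>" and L: "L x = z"
      and d: "((\<lambda>s. u (L s)) has_vector_derivative d) (at x within S)"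
  shows "((\<lambda>s. energy_extension (u (L s))) has_vector_derivative energy_gradient (u z) d)
      (at x within S)"
proof -
  have "(energy_extension has_derivative energy_gradient (u z))
      (at (u (L x)) within (\<lambda>s. u (L s)) ` S)"
    unfolding L using energy_extension_has_derivative[OF relaxed[OF z]]
        by (rule has_derivative_at_withinI)
  from vector_derivative_diff_chain_within[OF d this] show ?thesis by (simp add: o_def)
qed

lemma time_deriv_energy:
  assumes z: "z \<in> \<Omega>"
  shows "time_deriv (\<lambda>z. \<rho>_of (u z) * E_tilde m (u z)) z
      = energy_gradient (u z) (time_deriv (\<lambda>z. u z) z)"
proof -
  have t: "0 \<le> snd z" using openin_imp_subset[OF openin_domain] z by (auto simp: mem_Times_iff)
  have "time_deriv (\<lambda>z. energy_extension (u z)) z = energy_gradient (u z) (time_deriv (\<lambda>z. u z) z)"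
    by (rule time_derivI[OF t chain_rule_along[OF z _
        has_time_deriv[OF openin_domain smooth_field z]]]) simp
  moreover have "time_deriv (\<lambda>z. energy_extension (u z)) z
      = time_deriv (\<lambda>z. \<rho>_of (u z) * E_tilde m (u z)) z"
    by (rule time_deriv_cong[OF openin_domain z]) (simp add: energy_extension_relaxed relaxed)
  ultimately show ?thesis by simp
qed

lemma space_deriv_energy:
  assumes z: "z \<in> \<Omega>"
  shows "space_deriv k (\<lambda>z. \<rho>_of (u z) * E_tilde m (u z)) z
      = energy_gradient (u z) (space_deriv k u z)"
proof -
  have "space_deriv k (\<lambda>z. energy_extension (u z)) z = energy_gradient (u z) (space_deriv k u z)"
    by (rule space_derivI[OF chain_rule_along[OF z _ deriv_field[OF smooth_field z]]]) simp
  moreover have "space_deriv k (\<lambda>z. energy_extension (u z)) z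
      = space_deriv k (\<lambda>z. \<rho>_of (u z) * E_tilde m (u z)) z"
    by (rule space_deriv_cong[OF openin_domain z]) (simp add: energy_extension_relaxed relaxed)
  ultimately show ?thesis by simp
qed

lemma space_deriv_flux_extra:
  assumes z: "z \<in> \<Omega>"
  shows "space_deriv k (\<lambda>z. flux_extra m k (u z)) z =
    (0, space_deriv k (\<lambda>z. j_of (u z) $ k / temp m (u z)) z,
     (\<chi> i. (mat 1 :: real^3^3) $ i $ k * (kappa m / tau0 m) *
         (space_deriv k (\<lambda>z. temp m (u z)) z / temp m (u z))),
     (\<chi> i. - space_deriv k (\<lambda>z. stress m (u z) $ i $ k) z),
     (\<chi> i a. - (v_of (u z) $ i * space_deriv k (\<lambda>z. \<rho>_of (u z) * F_of (u z) $ k $ a) z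
        + space_deriv k (\<lambda>z. v_of (u z) $ i) z * (\<rho>_of (u z) * F_of (u z) $ k $ a))), 0, 0)"
proof -
  have tp: "0 < temp m (u y)" if "y \<in> \<Omega>" for y using temp_pos[OF relaxed[OF that]] .
  note sm = smooth_on_mult smooth_on_vec_nth smooth_on_minus smooth_on_const smooth_fields
  have s2: "smooth_on \<Omega> (\<lambda>z. j_of (u z) $ k / temp m (u z))"
    by (intro smooth_on_divide sm) (use tp in force)
  have ln: "smooth_on \<Omega> (\<lambda>z. ln (temp m (u z)))" by (intro smooth_on_ln sm tp)
  have s3: "smooth_on \<Omega>
      (\<lambda>z. (mat 1 :: real^3^3) $ i $ k * (kappa m / tau0 m) * ln (temp m (u z)))" for i
    by (intro smooth_on_mult smooth_on_const ln)
  have s4: "smooth_on \<Omega> (\<lambda>z. stress m (u z) $ i $ k)" for i by (intro sm)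
  have s5: "smooth_on \<Omega> (\<lambda>z. v_of (u z) $ i)" "smooth_on \<Omega> (\<lambda>z. \<rho>_of (u z) * F_of (u z) $ k $ a)"
    "smooth_on \<Omega> (\<lambda>z. v_of (u z) $ i * (\<rho>_of (u z) * F_of (u z) $ k $ a))" for i a by (intro sm)+
  have "space_deriv k (\<lambda>z. flux_extra m k (u z)) z =
    (0, space_deriv k (\<lambda>z. j_of (u z) $ k / temp m (u z)) z,
     (\<chi> i. space_deriv k (\<lambda>z. (mat 1 :: real^3^3) $ i $ k * (kappa m / tau0 m) * ln
         (temp m (u z))) z),
     (\<chi> i. space_deriv k (\<lambda>z. - (stress m (u z) $ i $ k)) z),
     (\<chi> i a. space_deriv k (\<lambda>z. - (v_of (u z) $ i * (\<rho>_of (u z) * F_of (u z) $ k $ a))) z), 0, 0)"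
    unfolding flux_extra_def
    by (simp only: space_deriv_Pair space_deriv_vec_lambda space_deriv_const smooth_on_Pair
        smooth_on_vec_lambda
      smooth_on_const smooth_on_minus s2 s3 s4 s5 z) (simp add: zero_prod_def)
  also have "\<dots> = (0, space_deriv k (\<lambda>z. j_of (u z) $ k / temp m (u z)) z,
     (\<chi> i. (mat 1 :: real^3^3) $ i $ k * (kappa m / tau0 m) *
         (space_deriv k (\<lambda>z. temp m (u z)) z / temp m (u z))),
     (\<chi> i. - space_deriv k (\<lambda>z. stress m (u z) $ i $ k) z),
     (\<chi> i a. - (v_of (u z) $ i * space_deriv k (\<lambda>z. \<rho>_of (u z) * F_of (u z) $ k $ a) z
        + space_deriv k (\<lambda>z. v_of (u z) $ i) z * (\<rho>_of (u z) * F_of (u z) $ k $ a))), 0, 0)"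
    by (simp only: space_deriv_minus space_deriv_mult[OF s5(1) s5(2)] s4 s5 z
      space_deriv_linear[OF bounded_linear_mult_right ln] space_deriv_ln smooth_fields tp)
  finally show ?thesis .
qed

text \<open>
  Split the flux as \<open>v\<^sub>k u + X\<^sub>k\<close>. The convective part contributes the derivative of \<open>v\<^sub>k \<rho> E\<close>
  plus \<open>P \<partial>\<^sub>k v\<^sub>k\<close> with the total pressure \<open>P\<close>. In the gradient applied to \<open>\<partial>\<^sub>k X\<^sub>k\<close>, the
  entropy flux \<open>j / \<theta>\<close> and the flux \<open>\<kappa> log \<theta> / \<tau>\<^sub>0\<close> add up to the divergence of \<open>j\<close>; the \<open>v\<close>
  component gives minus \<open>v\<close> times the divergence of the stress; and the \<open>F\<close> component gives
  minus the elastic stress times the velocity gradient, because the terms in which \<open>\<rho> F\<close> is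
  differentiated vanish by the Piola identity. Combined with \<open>P \<partial>\<^sub>k v\<^sub>k\<close>, the latter is minus
  the full stress times the velocity gradient.
\<close>

lemma energy_gradient_flux_divergence:
  assumes z: "z \<in> \<Omega>"
  shows "energy_gradient (u z) (\<Sum>k\<in>UNIV. space_deriv k (\<lambda>z. flux m k (u z)) z)
    = (\<Sum>k\<in>UNIV. space_deriv k (\<lambda>z. energy_flux k (u z)) z)"
proof -
  let ?U = "u z" and ?\<theta> = "temp m (u z)"
  note lin = linear_energy_gradient[OF relaxed[OF z]]
  note sm = smooth_on_mult smooth_on_scaleR smooth_on_vec_nth smooth_on_const smooth_on_sum
      smooth_on_add smooth_on_diff smooth_fields
  have tp: "0 < temp m (u y)" if "y \<in> \<Omega>" for y using temp_pos[OF relaxed[OF that]] .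
  define s where "s = \<rho>_of ?U * E_tilde m ?U"
  define S where "S k = space_deriv k (\<lambda>z. \<rho>_of (u z) * E_tilde m (u z)) z" for k
  define dv where "dv k i = space_deriv k (\<lambda>z. v_of (u z) $ i) z" for k i
  define dT where "dT k i = space_deriv k (\<lambda>z. stress m (u z) $ i $ k) z" for k i
  define dj where "dj k = space_deriv k (\<lambda>z. j_of (u z) $ k) z" for k
  define dq where "dq k = space_deriv k (\<lambda>z. j_of (u z) $ k / temp m (u z)) z" for k
  define d\<theta> where "d\<theta> k = space_deriv k (\<lambda>z. temp m (u z)) z" for k
  define dF where "dF k a = space_deriv k (\<lambda>z. \<rho>_of (u z) * F_of (u z) $ k $ a) z" for k a
  define WF where "WF i = mat_inv_sqrt (Y_of ?U) *v F_of ?U $ i" for i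
  define P where "P = total_pressure ?U"
  define c where "c = alpha m * Ktemp m ?U"
  let ?v = "\<lambda>i. v_of ?U $ i" and ?j = "\<lambda>i. j_of ?U $ i"
  have heat: "?\<theta> * dq k + d\<theta> k * (?j k / ?\<theta>) = dj k" for k
  proof -
    have sq: "smooth_on \<Omega> (\<lambda>z. j_of (u z) $ k / temp m (u z))"
      by (intro smooth_on_divide sm) (use tp in force)
    have "space_deriv k (\<lambda>z. temp m (u z) * (j_of (u z) $ k / temp m (u z))) z = ?\<theta> * dq k
        + d\<theta> k * (?j k / ?\<theta>)"
      unfolding dq_def d\<theta>_def by (intro space_deriv_mult sq smooth_fields z)
    moreover have "space_deriv k (\<lambda>z. temp m (u z) * (j_of (u z) $ k / temp m (u z))) z = dj k"
      unfolding dj_def by (rule space_deriv_cong[OF openin_domain z]) (use tp in force)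
    ultimately show ?thesis by simp
  qed
  \<comment> \<open>\<open>WF i\<close> is row \<open>i\<close> of \<open>F Y\<^sup>-\<^sup>1\<^sup>/\<^sup>2\<close>, so \<open>WF i \<bullet> F $ k\<close> is the entry \<open>C\<^sub>i\<^sub>k\<close>.\<close>
  have extra: "energy_gradient ?U (space_deriv k (\<lambda>z. flux_extra m k (u z)) z) =
      dj k - (\<Sum>i\<in>UNIV. ?v i * dT k i)
      - c * (\<Sum>i\<in>UNIV. ?v i * (\<Sum>a\<in>UNIV. WF i $ a * dF k a))
      - c * \<rho>_of ?U * (\<Sum>i\<in>UNIV. dv k i * (WF i \<bullet> F_of ?U $ k))" for k
  proof -
    have "j_of ?U \<bullet> (\<chi> i. (mat 1 :: real^3^3) $ i $ k * (kappa m / tau0 m) * (d\<theta> k / ?\<theta>))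
        = kappa m / tau0 m * (?j k * (d\<theta> k / ?\<theta>))"
      by (simp add: inner_vec_def mat_def if_distrib if_distribR cong: if_cong)
    then have 1: "tau0 m / kappa m *
        (j_of ?U \<bullet> (\<chi> i. (mat 1 :: real^3^3) $ i $ k * (kappa m / tau0 m) * (d\<theta> k / ?\<theta>))) = d\<theta> k
        * (?j k / ?\<theta>)"
      using pos by simp
    have 2: "v_of ?U \<bullet> (\<chi> i. - dT k i) = - (\<Sum>i\<in>UNIV. ?v i * dT k i)"
      by (simp add: inner_vec_def sum_negf)
    have 3: "(\<Sum>i\<in>UNIV. WF i \<bullet> (\<chi> i a. - (?v i * dF k a + dv k i * (\<rho>_of ?U * F_of ?U $ k $ a))) $ i)
      = - (\<Sum>i\<in>UNIV. ?v i * (\<Sum>a\<in>UNIV. WF i $ a * dF k a)) - \<rho>_of ?U *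
          (\<Sum>i\<in>UNIV. dv k i * (WF i \<bullet> F_of ?U $ k))"
    proof -
      have "WF i \<bullet> (\<chi> i a. - (?v i * dF k a + dv k i * (\<rho>_of ?U * F_of ?U $ k $ a))) $ i =
          - (?v i * (\<Sum>a\<in>UNIV. WF i $ a * dF k a)) - \<rho>_of ?U * (dv k i * (WF i \<bullet> F_of ?U $ k))" for i
      proof -
        have "(\<chi> i a. - (?v i * dF k a + dv k i * (\<rho>_of ?U * F_of ?U $ k $ a))) $ i =
            - (?v i *\<^sub>R (\<chi> a. dF k a)) - (\<rho>_of ?U * dv k i) *\<^sub>R F_of ?U $ k"
          by (simp add: vec_eq_iff)
        then have "WF i \<bullet> (\<chi> i a. - (?v i * dF k a + dv k i * (\<rho>_of ?U * F_of ?U $ k $ a))) $ i =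
            - (?v i * (WF i \<bullet> (\<chi> a. dF k a))) - (\<rho>_of ?U * dv k i) * (WF i \<bullet> F_of ?U $ k)"
          by (simp only: inner_diff_right inner_minus_right inner_scaleR_right)
        moreover have "WF i \<bullet> (\<chi> a. dF k a) = (\<Sum>a\<in>UNIV. WF i $ a * dF k a)"
            by (simp add: inner_vec_def)
        ultimately show ?thesis by simp
      qed
      then show ?thesis by (simp only: sum_subtractf sum_negf sum_distrib_left[symmetric])
    qed
    show ?thesis
      unfolding space_deriv_flux_extra[OF z] energy_gradient_partial[OF relaxed[OF z]]
        dv_def[symmetric] dT_def[symmetric] dq_def[symmetric] d\<theta>_def[symmetric]
            dF_def[symmetric] WF_def[symmetric]
        1 2 3
      using heat[of k] by (simp add: c_def algebra_simps)
  qed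
  have flux: "energy_gradient ?U (space_deriv k (\<lambda>z. flux m k (u z)) z) =
      ?v k * S k + dv k k * (s + P) + energy_gradient ?U
          (space_deriv k (\<lambda>z. flux_extra m k (u z)) z)" for k
  proof -
    have "space_deriv k (\<lambda>z. flux m k (u z)) z
        = space_deriv k (\<lambda>z. v_of (u z) $ k *\<^sub>R u z + flux_extra m k (u z)) z"
      by (rule space_deriv_cong[OF openin_domain z], rule flux_eq_convective_plus_extra)
        (use relaxed in \<open>auto simp: relaxed_states_def\<close>)
    also have "\<dots> = space_deriv k (\<lambda>z. v_of (u z) $ k *\<^sub>R u z) z
        + space_deriv k (\<lambda>z. flux_extra m k (u z)) z"
      by (intro space_deriv_add sm z)
    also have "space_deriv k (\<lambda>z. v_of (u z) $ k *\<^sub>R u z) z = ?v k *\<^sub>R space_deriv k u z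
        + dv k k *\<^sub>R ?U"
      unfolding dv_def by (intro space_deriv_scaleR sm z)
    finally show ?thesis
      by (simp add: linear_add[OF lin] linear_scale[OF lin] S_def space_deriv_energy[OF z]
          energy_gradient_scaling[OF relaxed[OF z]] s_def P_def total_pressure_def)
  qed
  have eflux: "space_deriv k (\<lambda>z. energy_flux k (u z)) z =
      ?v k * S k + dv k k * s + dj k -
          (\<Sum>i\<in>UNIV. stress m ?U $ i $ k * dv k i + dT k i * ?v i)" for k
  proof -
    have "space_deriv k (\<lambda>z. energy_flux k (u z)) z =
      space_deriv k (\<lambda>z. v_of (u z) $ k * (\<rho>_of (u z) * E_tilde m (u z))) z + dj k
      - (\<Sum>i\<in>UNIV. space_deriv k (\<lambda>z. stress m (u z) $ i $ k * v_of (u z) $ i) z)"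
      unfolding energy_flux_def dj_def
      by (subst space_deriv_diff, (intro sm z)+, subst space_deriv_add, (intro sm z)+, subst
          space_deriv_sum, (intro sm z)+, rule refl)
    also have "space_deriv k (\<lambda>z. v_of (u z) $ k * (\<rho>_of (u z) * E_tilde m (u z))) z
        = ?v k * S k + dv k k * s"
      unfolding S_def dv_def s_def by (intro space_deriv_mult smooth_on_vec_nth smooth_fields z)
    also have "(\<Sum>i\<in>UNIV. space_deriv k (\<lambda>z. stress m (u z) $ i $ k * v_of (u z) $ i) z) =
        (\<Sum>i\<in>UNIV. stress m ?U $ i $ k * dv k i + dT k i * ?v i)"
      unfolding dT_def dv_def by
          (intro sum.cong refl space_deriv_mult smooth_on_vec_nth smooth_fields z)
    finally show ?thesis by simp
  qed
  have stress: "(\<Sum>i\<in>UNIV. stress m ?U $ i $ k * dv k i) =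
      - P * dv k k + c * \<rho>_of ?U * (\<Sum>i\<in>UNIV. dv k i * (WF i \<bullet> F_of ?U $ k))" for k
  proof -
    have "stress m ?U $ i $ k * dv k i = (if i = k then - P * dv k i else 0)
        + c * \<rho>_of ?U * (dv k i * (WF i \<bullet> F_of ?U $ k))" for i
      unfolding stress_entry[OF relaxed[OF z]] P_def c_def WF_def by (simp add: algebra_simps)
    then show ?thesis by (simp add: sum.distrib sum_distrib_left)
  qed
  have piola: "(\<Sum>k\<in>UNIV. \<Sum>i\<in>UNIV. ?v i * (\<Sum>a\<in>UNIV. WF i $ a * dF k a)) = 0"
  proof -
    have "(\<Sum>k\<in>UNIV. \<Sum>i\<in>UNIV. ?v i * (\<Sum>a\<in>UNIV. WF i $ a * dF k a)) =
        (\<Sum>i\<in>UNIV. ?v i * (\<Sum>k\<in>UNIV. \<Sum>a\<in>UNIV. WF i $ a * dF k a))"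
      by (subst sum.swap) (simp only: sum_distrib_left)
    also have "\<dots> = (\<Sum>i\<in>UNIV. ?v i * (\<Sum>a\<in>UNIV. WF i $ a * (\<Sum>k\<in>UNIV. dF k a)))"
    proof -
      have "(\<Sum>k\<in>UNIV. \<Sum>a\<in>UNIV. WF i $ a * dF k a) = (\<Sum>a\<in>UNIV. WF i $ a * (\<Sum>k\<in>UNIV. dF k a))" for i
        by (subst sum.swap) (simp only: sum_distrib_left)
      then show ?thesis by (simp only:)
    qed
    finally show ?thesis
      unfolding dF_def divergence_mass_deformation[OF z] by simp
  qed
  have "energy_gradient ?U (space_deriv k (\<lambda>z. flux m k (u z)) z) =
      space_deriv k (\<lambda>z. energy_flux k (u z)) z - c *
          (\<Sum>i\<in>UNIV. ?v i * (\<Sum>a\<in>UNIV. WF i $ a * dF k a))" for k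
    unfolding flux extra eflux sum.distrib stress by (simp add: algebra_simps)
  then have "(\<Sum>k\<in>UNIV. energy_gradient ?U (space_deriv k (\<lambda>z. flux m k (u z)) z)) =
      (\<Sum>k\<in>UNIV. space_deriv k (\<lambda>z. energy_flux k (u z)) z)"
    using piola by (simp add: sum_subtractf sum_distrib_left[symmetric])
  then show ?thesis by (simp add: linear_sum[OF lin])
qed

lemma energy_balance:
  assumes "balance_law_on \<Omega> (\<lambda>w. w) (flux m) c u"
  shows "balance_law_on \<Omega> (\<lambda>u. \<rho>_of u * E_tilde m u) energy_flux (\<lambda>u. energy_gradient u (c u)) u"
  unfolding balance_law_on_def
proof
  fix z assume z: "z \<in> \<Omega>"
  have "time_deriv (\<lambda>z. u z) z + (\<Sum>k\<in>UNIV. space_deriv k (\<lambda>z. flux m k (u z)) z) = c (u z)"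
    using assms z by (simp add: balance_law_on_def)
  then show "time_deriv (\<lambda>z. \<rho>_of (u z) * E_tilde m (u z)) z
      + (\<Sum>k\<in>UNIV. space_deriv k (\<lambda>z. energy_flux k (u z)) z) =
      energy_gradient (u z) (c (u z))"
    unfolding time_deriv_energy[OF z] energy_gradient_flux_divergence[OF z, symmetric]
    by (simp only: linear_add[OF linear_energy_gradient[OF relaxed[OF z]], symmetric])
qed

end

theorem theorem4:
  fixes m :: material
    and cV \<theta>ref \<rho>ref \<gamma> :: real
    and f :: "state \<Rightarrow> real^3"
  assumes "0 < alpha m" "0 < K0 m" "0 < K1 m" "0 < kB m" "0 < tau0 m" "0 < kappa m"
    and "0 < rhoR m" "0 < eref m"
    and "\<And>\<theta>. 0 < \<theta> \<Longrightarrow> 0 < zeta m \<theta>" and "smooth_on {0<..} (zeta m)"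
    and "smooth_on admissible_states f"
    and "1 < \<gamma>" "0 < cV" "0 < \<theta>ref" "0 < \<rho>ref"
    and "es m = polytropic cV \<theta>ref \<rho>ref \<gamma>"
  shows "mathematical_entropy admissible_states (flux m) (source m f) (kinematic_constraints m)
           (\<lambda>u. \<rho>_of u * E_tilde m u)"
proof -
  interpret polytropic_material m cV \<theta>ref \<rho>ref \<gamma> by unfold_locales (use assms in auto)
  show ?thesis
    unfolding mathematical_entropy_def
  proof (intro conjI exI[of _ energy_flux] exI[of _ "\<lambda>u. energy_gradient u (source m f u)"] allI impI)
    show "smooth_on admissible_states (\<lambda>u. \<rho>_of u * E_tilde m u)"
      by (rule smooth_on_subset[OF smooth_on_energy admissible_imp_relaxed])
    show "strictly_convex_on (convex hull admissible_states) (\<lambda>u. \<rho>_of u * E_tilde m u)"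
      by (rule strictly_convex_on_subset[OF energy_strictly_convex
            hull_minimal[of _ _ convex, OF admissible_imp_relaxed convex_relaxed_states] convex_convex_hull])
    show "smooth_on admissible_states (energy_flux k)" for k
      by (rule smooth_on_subset[OF smooth_on_energy_flux admissible_imp_relaxed])
    have "smooth_on admissible_states (source m f)" using assms(9-11) by (rule smooth_on_source)
    then show "smooth_on admissible_states (\<lambda>u. energy_gradient u (source m f u))"
      unfolding energy_gradient_def
      using admissible_imp_relaxed relaxed_symmetrizable
      by (intro smooth_on_frechet_derivative[OF open_symmetrizable_states smooth_on_energy_extension]) auto
    fix \<Omega> u
    assume u: "smooth_solution admissible_states (flux m) (source m f) \<Omega> u \<and> kinematic_constraints m \<Omega> u"
    then interpret smooth_motion m cV \<theta>ref \<rho>ref \<gamma> \<Omega> u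
      by unfold_locales (auto simp: smooth_solution_def)
    show "balance_law_on \<Omega> (\<lambda>u. \<rho>_of u * E_tilde m u) energy_flux (\<lambda>u. energy_gradient u (source m f u)) u"
      using u by (intro energy_balance) (simp add: smooth_solution_def)
  qed
qed

end
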